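(* Let $A,B,C$ be algebras, $R_1:B\otimes A\to A\otimes B$ and $R_2:C\otimes B\to B\otimes C$ unital twisting maps, and $R_3=\tau_{CA}:C\otimes A\to A\otimes C$ the usual flip, such that the hexagon equation $$(A\otimes R_2)\circ(R_3\otimes B)\circ(C\otimes R_1)=(R_1\otimes C)\circ(B\otimes R_3)\circ(R_2\otimes A)$$ holds. Assume given a left deformation datum $(\mu,\rho,\lambda)$ between $A$ and $B$ for $R_1$, with associated algebra $A^d$ and map $R_1^d$, and a right deformation datum $(\nu,\theta,\gamma)$ between $B$ and $C$ for $R_2$, with associated algebra ${}^dC$ and map ${}^dR_2$ (see the context for these definitions and notation). Assume also that for all $a\in A$, $c\in C$: $$a_{(0)}\otimes a_{(1)_{R_2}}(c_{R_2})_{\{-1\}}\otimes(c_{R_2})_{\{0\}}=a_{(0)_{R_1}}\otimes c_{\{-1\}_{R_1}}a_{(1)}\otimes c_{\{0\}},$$ $$a_{[0]}\otimes c_{<-1>}a_{[1]_{R_2}}\otimes c_{<0>_{R_2}}=(a_{R_1})_{[0]}\otimes(a_{R_1})_{[1]}c_{<-1>_{R_1}}\otimes c_{<0>},$$ $$a_{(0)_{R_1}}\otimes c_{<-1>_{R_1}}a_{(1)_{R_2}}\otimes c_{<0>_{R_2}}=a_{(0)}\otimes a_{(1)}c_{<-1>}\otimes c_{<0>}.$$ Then $R_1^d:B\otimes A^d\to A^d\otimes B$, ${}^dR_2:{}^dC\otimes B\to B\otimes{}^dC$ and $R_3:{}^dC\otimes A^d\to A^d\otimes{}^dC$ are unital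 twisting maps satisfying the hexagon equation $$(A^d\otimes{}^dR_2)\circ(R_3\otimes B)\circ({}^dC\otimes R_1^d)=(R_1^d\otimes{}^dC)\circ(B\otimes R_3)\circ({}^dR_2\otimes A^d),$$ and there is an algebra isomorphism $$A^d\otimes_{R_1^d}B\otimes_{{}^dR_2}{}^dC\simeq A\otimes_{R_1}B\otimes_{R_2}C,\qquad a\otimes b\otimes c\mapsto a_{(0)}\otimes a_{(1)}bc_{<-1>}\otimes c_{<0>}.$$
   Context: Fix a field or commutative ring $k$; $\otimes=\otimes_k$; algebras are associative unital $k$-algebras; $\mu_A$ is the product of $A$; an object also denotes its identity map. A twisting map for algebras $A,B$ is a linear map $R:B\otimes A\to A\otimes B$ with $$R\circ(B\otimes\mu_A)=(\mu_A\otimes B)\circ(A\otimes R)\circ(R\otimes A),\qquad R\circ(\mu_B\otimes A)=(A\otimes\mu_B)\circ(R\otimes B)\circ(B\otimes R);$$ it is unital if $R(1\otimes a)=a\otimes1$, $R(b\otimes1)=1\otimes b$. Write $R(b\otimes a)=a_R\otimes b_R$ (summation understood). $A\otimes_RB$ is $A\otimes B$ with product $(a\otimes b)(a'\otimes b')=aa'_R\otimes b_Rb'$. If unital twisting maps $R_1,R_2,R_3$ satisfy the hexagon equation, $A\otimes_{R_1}B\otimes_{R_2}C$ is the algebra $(A\otimes_{R_1}B)\otimes_{T_1}C$ with $T_1:=(A\otimes R_2)\circ(R_3\otimes B)$, equal to $A\otimes_{T_2}(B\otimes_{R_2}C)$ with $T_2:=(R_1\otimes C)\circ(B\otimes R_3)$.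 Left deformation datum between $A$ and $B$ for $R=R_1$: linear maps $\mu:B\otimes A\to A$, $\mu(b\otimes a)=b\cdot a$; $\rho:A\to A\otimes B$, $\rho(a)=a_{(0)}\otimes a_{(1)}$; $\lambda:A\to A\otimes B$, $\lambda(a)=a_{[0]}\otimes a_{[1]}$, such that, with $a*a':=a_{(0)}(a_{(1)}\cdot a')$: $\rho(1)=1\otimes1$, $\lambda(1)=1\otimes1$, $1\cdot a=a$, $a_{(0)}(a_{(1)}\cdot1)=a$, $b\cdot(a*a')=a_{(0)_R}(b_Ra_{(1)}\cdot a')$, $\rho(a*a')=a_{(0)}a'_{(0)_R}\otimes a_{(1)_R}a'_{(1)}$, $\lambda(aa')=a_{[0]}*(a'_R)_{[0]}\otimes(a'_R)_{[1]}(a_{[1]})_R$, $a_{(0)_{[0]}}\otimes a_{(0)_{[1]}}a_{(1)}=a\otimes1$, $a_{[0]_{(0)}}\otimes a_{[0]_{(1)}}a_{[1]}=a\otimes1$, for all $a,a'\in A$, $b\in B$. Then $A^d:=(A,*,1)$ is an associative unital algebra, and $R_1^d(b\otimes a):=(a_{(0)_{R_1}})_{[0]}\otimes(a_{(0)_{R_1}})_{[1]}b_{R_1}a_{(1)}$ is a twisting map. Right deformation datum between $B$ and $C$ for $R=R_2$ (with $R(c\otimes b)=b_R\otimes c_R$): linear maps $\nu:C\otimes B\to C$, $\nu(c\otimes b)=c\cdot b$; $\theta:C\to B\otimes C$, $\theta(c)=c_{<-1>}\otimes c_{<0>}$; $\gamma:C\to B\otimes C$, $\gamma(c)=c_{\{-1\}}\otimes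 c_{\{0\}}$, such that, with $c*c':=(c\cdot c'_{<-1>})c'_{<0>}$: $\theta(1)=1\otimes1$, $\gamma(1)=1\otimes1$, $c\cdot1=c$, $(1\cdot c_{<-1>})c_{<0>}=c$, $(c*c')\cdot b=(c\cdot c'_{<-1>}b_R)c'_{<0>_R}$, $\theta(c*c')=c_{<-1>}c'_{<-1>_R}\otimes c_{<0>_R}c'_{<0>}$, $\gamma(cc')=c'_{\{-1\}_R}(c_R)_{\{-1\}}\otimes(c_R)_{\{0\}}*c'_{\{0\}}$, $c_{<-1>}c_{<0>_{\{-1\}}}\otimes c_{<0>_{\{0\}}}=1\otimes c$, $c_{\{-1\}}c_{\{0\}_{<-1>}}\otimes c_{\{0\}_{<0>}}=1\otimes c$, for all $c,c'\in C$, $b\in B$. Then ${}^dC:=(C,*,1)$ is an associative unital algebra, and ${}^dR_2(c\otimes b):=c_{<-1>}b_{R_2}(c_{<0>_{R_2}})_{\{-1\}}\otimes(c_{<0>_{R_2}})_{\{0\}}$ is a twisting map. In all formulas the two factors carrying the same subscript $R$ (or $R_1$, $R_2$) are the components of $R$ applied to those two elements: e.g. $a_{(1)_{R_2}}\otimes c_{R_2}=R_2(c\otimes a_{(1)})$, $a_{(0)_{R_1}}\otimes c_{\{-1\}_{R_1}}=R_1(c_{\{-1\}}\otimes a_{(0)})$, $a'_R\otimes(a_{[1]})_R=R(a_{[1]}\otimes a')$, $c'_{\{-1\}_R}\otimes c_R=R(c\otimes c'_{\{-1\}})$; nested subscripts mean successive application of the maps to the indicated component. *)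

theory Defs
  imports "HOL-Algebra.Module" "HOL-Algebra.QuotRing" "HOL-Algebra.Free_Abelian_Groups"
begin

section \<open>Algebras and linear maps over a commutative ring\<close>

text \<open>The locale \<^locale>\<open>algebra\<close> of the library is restricted to commutative algebras. Here
  algebras are associative and unital; the zero ring is not excluded, neither for the base ring
  nor for the algebras.\<close>

locale assoc_algebra = module k A + ring A for k (structure) and A (structure) +
  assumes smult_mult_left: "\<lbrakk>r \<in> carrier k; x \<in> carrier A; y \<in> carrier A\<rbrakk> \<Longrightarrow>
      (r \<odot>\<^bsub>A\<^esub> x) \<otimes>\<^bsub>A\<^esub> y = r \<odot>\<^bsub>A\<^esub> (x \<otimes>\<^bsub>A\<^esub> y)"
    and smult_mult_right: "\<lbrakk>r \<in> carrier k; x \<in> carrier A; y \<in> carrier A\<rbrakk> \<Longrightarrow>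
      x \<otimes>\<^bsub>A\<^esub> (r \<odot>\<^bsub>A\<^esub> y) = r \<odot>\<^bsub>A\<^esub> (x \<otimes>\<^bsub>A\<^esub> y)"

definition k_linear :: "'k ring \<Rightarrow> ('k, 'a) module \<Rightarrow> ('k, 'b) module \<Rightarrow> ('a \<Rightarrow> 'b) \<Rightarrow> bool"
  where "k_linear k M N f \<longleftrightarrow>
    f \<in> carrier M \<rightarrow> carrier N \<and>
    (\<forall>x\<in>carrier M. \<forall>y\<in>carrier M. f (x \<oplus>\<^bsub>M\<^esub> y) = f x \<oplus>\<^bsub>N\<^esub> f y) \<and>
    (\<forall>r\<in>carrier k. \<forall>x\<in>carrier M. f (r \<odot>\<^bsub>M\<^esub> x) = r \<odot>\<^bsub>N\<^esub> f x)"

definition algebra_iso :: "'k ring \<Rightarrow> ('k, 'a) module \<Rightarrow> ('k, 'b) module \<Rightarrow> ('a \<Rightarrow> 'b) \<Rightarrow> bool"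
  where "algebra_iso k A B f \<longleftrightarrow>
    assoc_algebra k A \<and> assoc_algebra k B \<and> f \<in> ring_iso A B \<and> k_linear k A B f"

section \<open>The tensor product of two modules\<close>

text \<open>The tensor product is the free abelian group on pairs modulo the subgroup generated by
  biadditivity and \<open>k\<close>-balancedness; its elements are cosets.\<close>

type_synonym ('a, 'b) tensor = "('a \<times> 'b \<Rightarrow>\<^sub>0 int) set"

definition tensor_rels ::
    "'k ring \<Rightarrow> ('k, 'a) module \<Rightarrow> ('k, 'b) module \<Rightarrow> ('a \<times> 'b \<Rightarrow>\<^sub>0 int) set"
  where "tensor_rels k M N =
    {frag_of (x \<oplus>\<^bsub>M\<^esub> x', y) - frag_of (x, y) - frag_of (x', y) | x x' y.
        x \<in> carrier M \<and> x' \<in> carrier M \<and> y \<in> carrier N} \<union>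
    {frag_of (x, y \<oplus>\<^bsub>N\<^esub> y') - frag_of (x, y) - frag_of (x, y') | x y y'.
        x \<in> carrier M \<and> y \<in> carrier N \<and> y' \<in> carrier N} \<union>
    {frag_of (r \<odot>\<^bsub>M\<^esub> x, y) - frag_of (x, r \<odot>\<^bsub>N\<^esub> y) | r x y.
        r \<in> carrier k \<and> x \<in> carrier M \<and> y \<in> carrier N}"

definition tensor_null ::
    "'k ring \<Rightarrow> ('k, 'a) module \<Rightarrow> ('k, 'b) module \<Rightarrow> ('a \<times> 'b \<Rightarrow>\<^sub>0 int) set"
  where "tensor_null k M N =
    generate (free_Abelian_group (carrier M \<times> carrier N)) (tensor_rels k M N)"

text \<open>Scalars act on the first factor of each generator; the set product with the null subgroup
  turns the image of a coset into a coset again. The multiplicative fields of the record carry no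
  information for a tensor product of mere modules.\<close>

definition tensor_product :: "('k, 'a) module \<Rightarrow> 'k ring \<Rightarrow> ('k, 'b) module \<Rightarrow>
    ('k, ('a, 'b) tensor) module"  (\<open>(_ \<boxtimes>\<^bsub>_\<^esub> _)\<close> [71, 0, 71] 70)
  where "M \<boxtimes>\<^bsub>k\<^esub> N =
    (let F = free_Abelian_group (carrier M \<times> carrier N);
         Z = tensor_null k M N;
         Q = F Mod Z
     in \<lparr>carrier = carrier Q, mult = (\<lambda>_ _. undefined), one = undefined,
         ring.zero = \<one>\<^bsub>Q\<^esub>, add = (\<lambda>X Y. X \<otimes>\<^bsub>Q\<^esub> Y),
         smult = (\<lambda>r X. Z <#>\<^bsub>F\<^esub>
                   (frag_extend (\<lambda>(x, y). frag_of (r \<odot>\<^bsub>M\<^esub> x, y)) ` X))\<rparr>)"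

definition pure_tensor ::
    "'a \<Rightarrow> 'k ring \<Rightarrow> ('k, 'a) module \<Rightarrow> ('k, 'b) module \<Rightarrow> 'b \<Rightarrow> ('a, 'b) tensor"
    (\<open>(_ \<otimes>\<^bsub>[_|_,_]\<^esub> _)\<close> [66, 0, 0, 0, 66] 65)
  where "x \<otimes>\<^bsub>[k|M,N]\<^esub> y =
    tensor_null k M N #>\<^bsub>free_Abelian_group (carrier M \<times> carrier N)\<^esub> frag_of (x, y)"

text \<open>Sweedler notation. For \<open>t = \<Sum>\<^sub>i x\<^sub>i \<otimes> y\<^sub>i\<close> and a biadditive balanced \<open>h\<close> with values in
  \<open>P\<close>, the following is \<open>\<Sum>\<^sub>i h x\<^sub>i y\<^sub>i\<close>, i.e. the value at \<open>t\<close> of the linear map that \<open>h\<close> induces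
  on the tensor product: every representative of the coset \<open>t\<close> gives the same sum. So an expression
  written with \<open>\<rho>(a) = a\<^sub>0 \<otimes> a\<^sub>1\<close> becomes \<open>sweedler P (\<rho> a) (\<lambda>a\<^sub>0 a\<^sub>1. \<dots>)\<close>.\<close>

definition sweedler ::
    "('k, 'c) module \<Rightarrow> ('a, 'b) tensor \<Rightarrow> ('a \<Rightarrow> 'b \<Rightarrow> 'c) \<Rightarrow> 'c"
  where "sweedler P t h = the_elem ((\<lambda>u. \<Oplus>\<^bsub>P\<^esub>p\<in>Poly_Mapping.keys u.
    [Poly_Mapping.lookup u p] \<cdot>\<^bsub>P\<^esub> h (fst p) (snd p)) ` t)"

text \<open>\<open>f \<otimes> g\<close> for maps \<open>f\<close> into \<open>M\<close> and \<open>g\<close> into \<open>N\<close>.\<close>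

definition tensor_map :: "'k ring \<Rightarrow> ('k, 'c) module \<Rightarrow> ('k, 'd) module \<Rightarrow>
    ('a \<Rightarrow> 'c) \<Rightarrow> ('b \<Rightarrow> 'd) \<Rightarrow> ('a, 'b) tensor \<Rightarrow> ('c, 'd) tensor"
  where "tensor_map k M N f g t =
    sweedler (M \<boxtimes>\<^bsub>k\<^esub> N) t (\<lambda>x y. f x \<otimes>\<^bsub>[k|M,N]\<^esub> g y)"

definition mult_map :: "('k, 'a) module \<Rightarrow> ('a, 'a) tensor \<Rightarrow> 'a"
  where "mult_map A t = sweedler A t (\<lambda>x y. x \<otimes>\<^bsub>A\<^esub> y)"

definition flip_map :: "'k ring \<Rightarrow> ('k, 'a) module \<Rightarrow> ('k, 'b) module \<Rightarrow>
    ('a, 'b) tensor \<Rightarrow> ('b, 'a) tensor"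
  where "flip_map k M N t = sweedler (N \<boxtimes>\<^bsub>k\<^esub> M) t (\<lambda>x y. y \<otimes>\<^bsub>[k|N,M]\<^esub> x)"

text \<open>The associativity isomorphisms \<open>(L \<otimes> M) \<otimes> N \<rightarrow> L \<otimes> (M \<otimes> N)\<close> and back, which the usual
  notation suppresses.\<close>

definition assoc_right :: "'k ring \<Rightarrow> ('k, 'a) module \<Rightarrow> ('k, 'b) module \<Rightarrow> ('k, 'c) module \<Rightarrow>
    (('a, 'b) tensor, 'c) tensor \<Rightarrow> ('a, ('b, 'c) tensor) tensor"
  where "assoc_right k L M N t =
    sweedler (L \<boxtimes>\<^bsub>k\<^esub> (M \<boxtimes>\<^bsub>k\<^esub> N)) t (\<lambda>s z.
      sweedler (L \<boxtimes>\<^bsub>k\<^esub> (M \<boxtimes>\<^bsub>k\<^esub> N)) s (\<lambda>x y.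
        x \<otimes>\<^bsub>[k|L,M \<boxtimes>\<^bsub>k\<^esub> N]\<^esub> (y \<otimes>\<^bsub>[k|M,N]\<^esub> z)))"

definition assoc_left :: "'k ring \<Rightarrow> ('k, 'a) module \<Rightarrow> ('k, 'b) module \<Rightarrow> ('k, 'c) module \<Rightarrow>
    ('a, ('b, 'c) tensor) tensor \<Rightarrow> (('a, 'b) tensor, 'c) tensor"
  where "assoc_left k L M N t =
    sweedler ((L \<boxtimes>\<^bsub>k\<^esub> M) \<boxtimes>\<^bsub>k\<^esub> N) t (\<lambda>x s.
      sweedler ((L \<boxtimes>\<^bsub>k\<^esub> M) \<boxtimes>\<^bsub>k\<^esub> N) s (\<lambda>y z.
        (x \<otimes>\<^bsub>[k|L,M]\<^esub> y) \<otimes>\<^bsub>[k|L \<boxtimes>\<^bsub>k\<^esub> M,N]\<^esub> z))"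

section \<open>Twisting maps and twisted tensor products\<close>

locale twisting_map = A: assoc_algebra k A + B: assoc_algebra k B
  for k :: "'k ring" and A :: "('k, 'a) module" and B :: "('k, 'b) module"
    and R :: "('b, 'a) tensor \<Rightarrow> ('a, 'b) tensor" +
  assumes linear: "k_linear k (B \<boxtimes>\<^bsub>k\<^esub> A) (A \<boxtimes>\<^bsub>k\<^esub> B) R"
    and twist_mult_A: "\<And>t. t \<in> carrier (B \<boxtimes>\<^bsub>k\<^esub> (A \<boxtimes>\<^bsub>k\<^esub> A)) \<Longrightarrow>
      (R \<circ> tensor_map k B A id (mult_map A)) t =
      (tensor_map k A B (mult_map A) id \<circ> assoc_left k A A B \<circ>
       tensor_map k A (A \<boxtimes>\<^bsub>k\<^esub> B) id R \<circ> assoc_right k A B A \<circ>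
       tensor_map k (A \<boxtimes>\<^bsub>k\<^esub> B) A R id \<circ> assoc_left k B A A) t"
    and twist_mult_B: "\<And>t. t \<in> carrier ((B \<boxtimes>\<^bsub>k\<^esub> B) \<boxtimes>\<^bsub>k\<^esub> A) \<Longrightarrow>
      (R \<circ> tensor_map k B A (mult_map B) id) t =
      (tensor_map k A B id (mult_map B) \<circ> assoc_right k A B B \<circ>
       tensor_map k (A \<boxtimes>\<^bsub>k\<^esub> B) B R id \<circ> assoc_left k B A B \<circ>
       tensor_map k B (A \<boxtimes>\<^bsub>k\<^esub> B) id R \<circ> assoc_right k B B A) t"

locale unital_twisting_map = twisting_map +
  assumes twist_unit_B: "a \<in> carrier A \<Longrightarrow>
      R (\<one>\<^bsub>B\<^esub> \<otimes>\<^bsub>[k|B,A]\<^esub> a) = a \<otimes>\<^bsub>[k|A,B]\<^esub> \<one>\<^bsub>B\<^esub>"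
    and twist_unit_A: "b \<in> carrier B \<Longrightarrow>
      R (b \<otimes>\<^bsub>[k|B,A]\<^esub> \<one>\<^bsub>A\<^esub>) = \<one>\<^bsub>A\<^esub> \<otimes>\<^bsub>[k|A,B]\<^esub> b"

definition twisted_product :: "'k ring \<Rightarrow> ('k, 'a) module \<Rightarrow> ('k, 'b) module \<Rightarrow>
    (('b, 'a) tensor \<Rightarrow> ('a, 'b) tensor) \<Rightarrow> ('k, ('a, 'b) tensor) module"
  where "twisted_product k A B R = (A \<boxtimes>\<^bsub>k\<^esub> B)
    \<lparr>mult := \<lambda>s t.
       sweedler (A \<boxtimes>\<^bsub>k\<^esub> B) s (\<lambda>a b.
       sweedler (A \<boxtimes>\<^bsub>k\<^esub> B) t (\<lambda>a' b'.
       sweedler (A \<boxtimes>\<^bsub>k\<^esub> B) (R (b \<otimes>\<^bsub>[k|B,A]\<^esub> a')) (\<lambda>a'R bR.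
         (a \<otimes>\<^bsub>A\<^esub> a'R) \<otimes>\<^bsub>[k|A,B]\<^esub> (bR \<otimes>\<^bsub>B\<^esub> b')))),
     one := \<one>\<^bsub>A\<^esub> \<otimes>\<^bsub>[k|A,B]\<^esub> \<one>\<^bsub>B\<^esub>\<rparr>"

definition hexagon :: "'k ring \<Rightarrow> ('k, 'a) module \<Rightarrow> ('k, 'b) module \<Rightarrow> ('k, 'c) module \<Rightarrow>
    (('b, 'a) tensor \<Rightarrow> ('a, 'b) tensor) \<Rightarrow> (('c, 'b) tensor \<Rightarrow> ('b, 'c) tensor) \<Rightarrow>
    (('c, 'a) tensor \<Rightarrow> ('a, 'c) tensor) \<Rightarrow> bool"
  where "hexagon k A B C R\<^sub>1 R\<^sub>2 R\<^sub>3 \<longleftrightarrow>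
    (\<forall>t \<in> carrier (C \<boxtimes>\<^bsub>k\<^esub> (B \<boxtimes>\<^bsub>k\<^esub> A)).
      (tensor_map k A (B \<boxtimes>\<^bsub>k\<^esub> C) id R\<^sub>2 \<circ> assoc_right k A C B \<circ>
       tensor_map k (A \<boxtimes>\<^bsub>k\<^esub> C) B R\<^sub>3 id \<circ> assoc_left k C A B \<circ>
       tensor_map k C (A \<boxtimes>\<^bsub>k\<^esub> B) id R\<^sub>1) t =
      (assoc_right k A B C \<circ> tensor_map k (A \<boxtimes>\<^bsub>k\<^esub> B) C R\<^sub>1 id \<circ>
       assoc_left k B A C \<circ> tensor_map k B (A \<boxtimes>\<^bsub>k\<^esub> C) id R\<^sub>3 \<circ>
       assoc_right k B C A \<circ> tensor_map k (B \<boxtimes>\<^bsub>k\<^esub> C) A R\<^sub>2 id \<circ>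
       assoc_left k C B A) t)"

text \<open>\<open>T\<^sub>1 = (A \<otimes> R\<^sub>2) \<circ> (R\<^sub>3 \<otimes> B) : C \<otimes> (A \<otimes> B) \<rightarrow> (A \<otimes> B) \<otimes> C\<close>, the twisting map that defines
  the iterated product \<open>A \<otimes> B \<otimes> C\<close> as \<open>(A \<otimes> B) \<otimes> C\<close>.\<close>

definition iterated_twist :: "'k ring \<Rightarrow> ('k, 'a) module \<Rightarrow> ('k, 'b) module \<Rightarrow> ('k, 'c) module \<Rightarrow>
    (('c, 'b) tensor \<Rightarrow> ('b, 'c) tensor) \<Rightarrow> (('c, 'a) tensor \<Rightarrow> ('a, 'c) tensor) \<Rightarrow>
    ('c, ('a, 'b) tensor) tensor \<Rightarrow> (('a, 'b) tensor, 'c) tensor"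
  where "iterated_twist k A B C R\<^sub>2 R\<^sub>3 =
    assoc_left k A B C \<circ> tensor_map k A (B \<boxtimes>\<^bsub>k\<^esub> C) id R\<^sub>2 \<circ> assoc_right k A C B \<circ>
    tensor_map k (A \<boxtimes>\<^bsub>k\<^esub> C) B R\<^sub>3 id \<circ> assoc_left k C A B"

definition iterated_product ::
    "'k ring \<Rightarrow> ('k, 'a) module \<Rightarrow> ('k, 'b) module \<Rightarrow> ('k, 'c) module \<Rightarrow>
    (('b, 'a) tensor \<Rightarrow> ('a, 'b) tensor) \<Rightarrow> (('c, 'b) tensor \<Rightarrow> ('b, 'c) tensor) \<Rightarrow>
    (('c, 'a) tensor \<Rightarrow> ('a, 'c) tensor) \<Rightarrow> ('k, (('a, 'b) tensor, 'c) tensor) module"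
  where "iterated_product k A B C R\<^sub>1 R\<^sub>2 R\<^sub>3 =
    twisted_product k (twisted_product k A B R\<^sub>1) C (iterated_twist k A B C R\<^sub>2 R\<^sub>3)"

section \<open>Left deformation data\<close>

definition left_star :: "'k ring \<Rightarrow> ('k, 'a) module \<Rightarrow> ('k, 'b) module \<Rightarrow>
    (('b, 'a) tensor \<Rightarrow> 'a) \<Rightarrow> ('a \<Rightarrow> ('a, 'b) tensor) \<Rightarrow> 'a \<Rightarrow> 'a \<Rightarrow> 'a"
  where "left_star k A B \<mu> \<rho> a a' =
    sweedler A (\<rho> a) (\<lambda>a0 a1. a0 \<otimes>\<^bsub>A\<^esub> \<mu> (a1 \<otimes>\<^bsub>[k|B,A]\<^esub> a'))"

definition left_deformed_algebra :: "'k ring \<Rightarrow> ('k, 'a) module \<Rightarrow> ('k, 'b) module \<Rightarrow>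
    (('b, 'a) tensor \<Rightarrow> 'a) \<Rightarrow> ('a \<Rightarrow> ('a, 'b) tensor) \<Rightarrow> ('k, 'a) module"
  where "left_deformed_algebra k A B \<mu> \<rho> = A\<lparr>mult := left_star k A B \<mu> \<rho>\<rparr>"

definition left_deformed_twist :: "'k ring \<Rightarrow> ('k, 'a) module \<Rightarrow> ('k, 'b) module \<Rightarrow>
    (('b, 'a) tensor \<Rightarrow> ('a, 'b) tensor) \<Rightarrow> ('a \<Rightarrow> ('a, 'b) tensor) \<Rightarrow> ('a \<Rightarrow> ('a, 'b) tensor) \<Rightarrow>
    ('b, 'a) tensor \<Rightarrow> ('a, 'b) tensor"
  where "left_deformed_twist k A B R \<rho> \<Lambda> t =
    sweedler (A \<boxtimes>\<^bsub>k\<^esub> B) t (\<lambda>b a.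
    sweedler (A \<boxtimes>\<^bsub>k\<^esub> B) (\<rho> a) (\<lambda>a0 a1.
    sweedler (A \<boxtimes>\<^bsub>k\<^esub> B) (R (b \<otimes>\<^bsub>[k|B,A]\<^esub> a0)) (\<lambda>a0R bR.
    sweedler (A \<boxtimes>\<^bsub>k\<^esub> B) (\<Lambda> a0R) (\<lambda>x y.
      x \<otimes>\<^bsub>[k|A,B]\<^esub> (y \<otimes>\<^bsub>B\<^esub> bR \<otimes>\<^bsub>B\<^esub> a1)))))"

text \<open>\<open>\<Lambda>\<close> is the second map \<open>A \<rightarrow> A \<otimes> B\<close> of the datum, usually written as a lower-case lambda,
  which is reserved for abstraction.\<close>

locale left_deformation_datum = unital_twisting_map k A B R
  for k :: "'k ring" and A :: "('k, 'a) module" and B :: "('k, 'b) module"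
    and R :: "('b, 'a) tensor \<Rightarrow> ('a, 'b) tensor" +
  fixes \<mu> :: "('b, 'a) tensor \<Rightarrow> 'a"
    and \<rho> :: "'a \<Rightarrow> ('a, 'b) tensor"
    and \<Lambda> :: "'a \<Rightarrow> ('a, 'b) tensor"
  assumes linear_mu: "k_linear k (B \<boxtimes>\<^bsub>k\<^esub> A) A \<mu>"
    and linear_rho: "k_linear k A (A \<boxtimes>\<^bsub>k\<^esub> B) \<rho>"
    and linear_lambda: "k_linear k A (A \<boxtimes>\<^bsub>k\<^esub> B) \<Lambda>"
    and rho_one: "\<rho> \<one>\<^bsub>A\<^esub> = \<one>\<^bsub>A\<^esub> \<otimes>\<^bsub>[k|A,B]\<^esub> \<one>\<^bsub>B\<^esub>"
    and lambda_one: "\<Lambda> \<one>\<^bsub>A\<^esub> = \<one>\<^bsub>A\<^esub> \<otimes>\<^bsub>[k|A,B]\<^esub> \<one>\<^bsub>B\<^esub>"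
    and one_act: "a \<in> carrier A \<Longrightarrow> \<mu> (\<one>\<^bsub>B\<^esub> \<otimes>\<^bsub>[k|B,A]\<^esub> a) = a"
    and act_one: "a \<in> carrier A \<Longrightarrow>
      sweedler A (\<rho> a) (\<lambda>a0 a1. a0 \<otimes>\<^bsub>A\<^esub> \<mu> (a1 \<otimes>\<^bsub>[k|B,A]\<^esub> \<one>\<^bsub>A\<^esub>)) = a"
    and act_star: "\<lbrakk>a \<in> carrier A; a' \<in> carrier A; b \<in> carrier B\<rbrakk> \<Longrightarrow>
      \<mu> (b \<otimes>\<^bsub>[k|B,A]\<^esub> left_star k A B \<mu> \<rho> a a') =
      sweedler A (\<rho> a) (\<lambda>a0 a1.
      sweedler A (R (b \<otimes>\<^bsub>[k|B,A]\<^esub> a0)) (\<lambda>a0R bR.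
        a0R \<otimes>\<^bsub>A\<^esub> \<mu> ((bR \<otimes>\<^bsub>B\<^esub> a1) \<otimes>\<^bsub>[k|B,A]\<^esub> a')))"
    and rho_star: "\<lbrakk>a \<in> carrier A; a' \<in> carrier A\<rbrakk> \<Longrightarrow>
      \<rho> (left_star k A B \<mu> \<rho> a a') =
      sweedler (A \<boxtimes>\<^bsub>k\<^esub> B) (\<rho> a) (\<lambda>a0 a1.
      sweedler (A \<boxtimes>\<^bsub>k\<^esub> B) (\<rho> a') (\<lambda>a'0 a'1.
      sweedler (A \<boxtimes>\<^bsub>k\<^esub> B) (R (a1 \<otimes>\<^bsub>[k|B,A]\<^esub> a'0)) (\<lambda>a'0R a1R.
        (a0 \<otimes>\<^bsub>A\<^esub> a'0R) \<otimes>\<^bsub>[k|A,B]\<^esub> (a1R \<otimes>\<^bsub>B\<^esub> a'1))))"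
    and lambda_mult: "\<lbrakk>a \<in> carrier A; a' \<in> carrier A\<rbrakk> \<Longrightarrow>
      \<Lambda> (a \<otimes>\<^bsub>A\<^esub> a') =
      sweedler (A \<boxtimes>\<^bsub>k\<^esub> B) (\<Lambda> a) (\<lambda>a0 a1.
      sweedler (A \<boxtimes>\<^bsub>k\<^esub> B) (R (a1 \<otimes>\<^bsub>[k|B,A]\<^esub> a')) (\<lambda>a'R a1R.
      sweedler (A \<boxtimes>\<^bsub>k\<^esub> B) (\<Lambda> a'R) (\<lambda>x y.
        left_star k A B \<mu> \<rho> a0 x \<otimes>\<^bsub>[k|A,B]\<^esub> (y \<otimes>\<^bsub>B\<^esub> a1R))))"
    and rho_lambda: "a \<in> carrier A \<Longrightarrow>
      sweedler (A \<boxtimes>\<^bsub>k\<^esub> B) (\<rho> a) (\<lambda>a0 a1.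
      sweedler (A \<boxtimes>\<^bsub>k\<^esub> B) (\<Lambda> a0) (\<lambda>x y. x \<otimes>\<^bsub>[k|A,B]\<^esub> (y \<otimes>\<^bsub>B\<^esub> a1))) =
      a \<otimes>\<^bsub>[k|A,B]\<^esub> \<one>\<^bsub>B\<^esub>"
    and lambda_rho: "a \<in> carrier A \<Longrightarrow>
      sweedler (A \<boxtimes>\<^bsub>k\<^esub> B) (\<Lambda> a) (\<lambda>a0 a1.
      sweedler (A \<boxtimes>\<^bsub>k\<^esub> B) (\<rho> a0) (\<lambda>x y. x \<otimes>\<^bsub>[k|A,B]\<^esub> (y \<otimes>\<^bsub>B\<^esub> a1))) =
      a \<otimes>\<^bsub>[k|A,B]\<^esub> \<one>\<^bsub>B\<^esub>"

section \<open>Right deformation data\<close>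

text \<open>In the bound variables, \<open>c1\<close> and \<open>c0\<close> stand for the components of \<open>\<theta> c\<close> and \<open>\<gamma> c\<close> indexed
  by \<open>-1\<close> and \<open>0\<close>.\<close>

definition right_star :: "'k ring \<Rightarrow> ('k, 'b) module \<Rightarrow> ('k, 'c) module \<Rightarrow>
    (('c, 'b) tensor \<Rightarrow> 'c) \<Rightarrow> ('c \<Rightarrow> ('b, 'c) tensor) \<Rightarrow> 'c \<Rightarrow> 'c \<Rightarrow> 'c"
  where "right_star k B C \<nu> \<theta> c c' =
    sweedler C (\<theta> c') (\<lambda>c'1 c'0. \<nu> (c \<otimes>\<^bsub>[k|C,B]\<^esub> c'1) \<otimes>\<^bsub>C\<^esub> c'0)"

definition right_deformed_algebra :: "'k ring \<Rightarrow> ('k, 'b) module \<Rightarrow> ('k, 'c) module \<Rightarrow>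
    (('c, 'b) tensor \<Rightarrow> 'c) \<Rightarrow> ('c \<Rightarrow> ('b, 'c) tensor) \<Rightarrow> ('k, 'c) module"
  where "right_deformed_algebra k B C \<nu> \<theta> = C\<lparr>mult := right_star k B C \<nu> \<theta>\<rparr>"

definition right_deformed_twist :: "'k ring \<Rightarrow> ('k, 'b) module \<Rightarrow> ('k, 'c) module \<Rightarrow>
    (('c, 'b) tensor \<Rightarrow> ('b, 'c) tensor) \<Rightarrow> ('c \<Rightarrow> ('b, 'c) tensor) \<Rightarrow> ('c \<Rightarrow> ('b, 'c) tensor) \<Rightarrow>
    ('c, 'b) tensor \<Rightarrow> ('b, 'c) tensor"
  where "right_deformed_twist k B C R \<theta> \<gamma> t =
    sweedler (B \<boxtimes>\<^bsub>k\<^esub> C) t (\<lambda>c b.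
    sweedler (B \<boxtimes>\<^bsub>k\<^esub> C) (\<theta> c) (\<lambda>c1 c0.
    sweedler (B \<boxtimes>\<^bsub>k\<^esub> C) (R (c0 \<otimes>\<^bsub>[k|C,B]\<^esub> b)) (\<lambda>bR c0R.
    sweedler (B \<boxtimes>\<^bsub>k\<^esub> C) (\<gamma> c0R) (\<lambda>x y.
      (c1 \<otimes>\<^bsub>B\<^esub> bR \<otimes>\<^bsub>B\<^esub> x) \<otimes>\<^bsub>[k|B,C]\<^esub> y))))"

locale right_deformation_datum = unital_twisting_map k B C R
  for k :: "'k ring" and B :: "('k, 'b) module" and C :: "('k, 'c) module"
    and R :: "('c, 'b) tensor \<Rightarrow> ('b, 'c) tensor" +
  fixes \<nu> :: "('c, 'b) tensor \<Rightarrow> 'c"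
    and \<theta> :: "'c \<Rightarrow> ('b, 'c) tensor"
    and \<gamma> :: "'c \<Rightarrow> ('b, 'c) tensor"
  assumes linear_nu: "k_linear k (C \<boxtimes>\<^bsub>k\<^esub> B) C \<nu>"
    and linear_theta: "k_linear k C (B \<boxtimes>\<^bsub>k\<^esub> C) \<theta>"
    and linear_gamma: "k_linear k C (B \<boxtimes>\<^bsub>k\<^esub> C) \<gamma>"
    and theta_one: "\<theta> \<one>\<^bsub>C\<^esub> = \<one>\<^bsub>B\<^esub> \<otimes>\<^bsub>[k|B,C]\<^esub> \<one>\<^bsub>C\<^esub>"
    and gamma_one: "\<gamma> \<one>\<^bsub>C\<^esub> = \<one>\<^bsub>B\<^esub> \<otimes>\<^bsub>[k|B,C]\<^esub> \<one>\<^bsub>C\<^esub>"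
    and act_one: "c \<in> carrier C \<Longrightarrow> \<nu> (c \<otimes>\<^bsub>[k|C,B]\<^esub> \<one>\<^bsub>B\<^esub>) = c"
    and one_act: "c \<in> carrier C \<Longrightarrow>
      sweedler C (\<theta> c) (\<lambda>c1 c0. \<nu> (\<one>\<^bsub>C\<^esub> \<otimes>\<^bsub>[k|C,B]\<^esub> c1) \<otimes>\<^bsub>C\<^esub> c0) = c"
    and star_act: "\<lbrakk>c \<in> carrier C; c' \<in> carrier C; b \<in> carrier B\<rbrakk> \<Longrightarrow>
      \<nu> (right_star k B C \<nu> \<theta> c c' \<otimes>\<^bsub>[k|C,B]\<^esub> b) =
      sweedler C (\<theta> c') (\<lambda>c'1 c'0.
      sweedler C (R (c'0 \<otimes>\<^bsub>[k|C,B]\<^esub> b)) (\<lambda>bR c'0R.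
        \<nu> (c \<otimes>\<^bsub>[k|C,B]\<^esub> (c'1 \<otimes>\<^bsub>B\<^esub> bR)) \<otimes>\<^bsub>C\<^esub> c'0R))"
    and theta_star: "\<lbrakk>c \<in> carrier C; c' \<in> carrier C\<rbrakk> \<Longrightarrow>
      \<theta> (right_star k B C \<nu> \<theta> c c') =
      sweedler (B \<boxtimes>\<^bsub>k\<^esub> C) (\<theta> c) (\<lambda>c1 c0.
      sweedler (B \<boxtimes>\<^bsub>k\<^esub> C) (\<theta> c') (\<lambda>c'1 c'0.
      sweedler (B \<boxtimes>\<^bsub>k\<^esub> C) (R (c0 \<otimes>\<^bsub>[k|C,B]\<^esub> c'1)) (\<lambda>c'1R c0R.
        (c1 \<otimes>\<^bsub>B\<^esub> c'1R) \<otimes>\<^bsub>[k|B,C]\<^esub> (c0R \<otimes>\<^bsub>C\<^esub> c'0))))"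
    and gamma_mult: "\<lbrakk>c \<in> carrier C; c' \<in> carrier C\<rbrakk> \<Longrightarrow>
      \<gamma> (c \<otimes>\<^bsub>C\<^esub> c') =
      sweedler (B \<boxtimes>\<^bsub>k\<^esub> C) (\<gamma> c') (\<lambda>c'1 c'0.
      sweedler (B \<boxtimes>\<^bsub>k\<^esub> C) (R (c \<otimes>\<^bsub>[k|C,B]\<^esub> c'1)) (\<lambda>c'1R cR.
      sweedler (B \<boxtimes>\<^bsub>k\<^esub> C) (\<gamma> cR) (\<lambda>x y.
        (c'1R \<otimes>\<^bsub>B\<^esub> x) \<otimes>\<^bsub>[k|B,C]\<^esub> right_star k B C \<nu> \<theta> y c'0)))"
    and theta_gamma: "c \<in> carrier C \<Longrightarrow>
      sweedler (B \<boxtimes>\<^bsub>k\<^esub> C) (\<theta> c) (\<lambda>c1 c0.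
      sweedler (B \<boxtimes>\<^bsub>k\<^esub> C) (\<gamma> c0) (\<lambda>x y. (c1 \<otimes>\<^bsub>B\<^esub> x) \<otimes>\<^bsub>[k|B,C]\<^esub> y)) =
      \<one>\<^bsub>B\<^esub> \<otimes>\<^bsub>[k|B,C]\<^esub> c"
    and gamma_theta: "c \<in> carrier C \<Longrightarrow>
      sweedler (B \<boxtimes>\<^bsub>k\<^esub> C) (\<gamma> c) (\<lambda>c1 c0.
      sweedler (B \<boxtimes>\<^bsub>k\<^esub> C) (\<theta> c0) (\<lambda>x y. (c1 \<otimes>\<^bsub>B\<^esub> x) \<otimes>\<^bsub>[k|B,C]\<^esub> y)) =
      \<one>\<^bsub>B\<^esub> \<otimes>\<^bsub>[k|B,C]\<^esub> c"

end

theory Submission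
  imports Defs
begin

text \<open>A unital twisting map is the same thing as a factorization: if \<open>f : A \<rightarrow> X\<close> and
  \<open>g : B \<rightarrow> X\<close> are algebra maps such that \<open>a \<otimes> b \<mapsto> f a g b\<close> is bijective, and
  \<open>R\<close> satisfies \<open>(f \<cdot> g) (R (b \<otimes> a)) = g b f a\<close>, then associativity in \<open>X\<close> makes \<open>R\<close> a unital
  twisting map and the bijection an algebra isomorphism.

  The datum \<open>(\<mu>, \<rho>, \<Lambda>)\<close> makes \<open>\<rho>\<close> an injective algebra map from \<open>A\<^sup>d\<close> into the twisted product of
  \<open>A\<close> and \<open>B\<close>, and the latter factorizes through \<open>\<rho>\<close> and \<open>B\<close>, with \<open>\<Lambda>\<close> providing the inverse; the
  corresponding twist is \<open>R\<^sub>1\<^sup>d\<close>. The right datum is treated in the same way.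

  In the iterated product \<open>E\<close> of \<open>A\<close>, \<open>B\<close>, \<open>C\<close> put \<open>f\<^sub>A = \<rho>\<close>, \<open>f\<^sub>B = id\<close> and \<open>f\<^sub>C = \<theta>\<close>, followed by
  the inclusions. The third compatibility condition says that the images of \<open>f\<^sub>A\<close> and \<open>f\<^sub>C\<close>
  commute. Hence both sides of the deformed hexagon equation at \<open>c \<otimes> b \<otimes> a\<close> are mapped to
  \<open>f\<^sub>C c f\<^sub>B b f\<^sub>A a\<close> by the bijection \<open>a \<otimes> b \<otimes> c \<mapsto> f\<^sub>A a f\<^sub>B b f\<^sub>C c\<close>, which is therefore the
  required isomorphism.\<close>

section \<open>The tensor product as a module\<close>

text \<open>A tensor is a coset of formal sums and \<open>sweedler\<close> returns the only element
  of a set of values, so a nested Sweedler expression is opaque until its summands are known to be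
  bilinear. The proof avoids manipulating such sums: from the inside out, each is replaced by a
  linear map of one tensor, typically a left or right multiplication in an algebra, and two linear
  maps are compared on pure tensors. The axioms of twisting maps and of deformation data thereby
  turn into short identities between products.

  Associativity of \<open>E\<close> is not free: that \<open>T1\<close> over the undeformed data
  satisfies the axioms is computed from the hexagon equation. For the deformed data the direction is
  reversed, and the axioms are pulled back from the associative algebra \<open>E\<close>. The
  formula for the deformed twist is forced: the bijection a \<otimes> b -> \<rho>(a) b must send its
  value at b \<otimes> a to b \<rho>(a), and \<Lambda> provides the inverse of that bijection.
  Bijectivity for three factors reduces to two factors, because the map is the right deformation on
  B and C followed by the left one on A and B, up to associativity.\<close>

context
  fixes k :: "'k ring"
begin

definition tensor_class :: "('k, 'a) module \<Rightarrow> ('k, 'b) module \<Rightarrow> ('a \<times> 'b \<Rightarrow>\<^sub>0 int) \<Rightarrow> ('a, 'b) tensor"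
  where "tensor_class M N u =
    tensor_null k M N #>\<^bsub>free_Abelian_group (carrier M \<times> carrier N)\<^esub> u"

lemma tensor_class_eq: "tensor_class M N u = (\<lambda>z. z + u) ` tensor_null k M N"
  by (auto simp: tensor_class_def r_coset_def)

lemma pure_tensor_class: "x \<otimes>\<^bsub>[k|M,N]\<^esub> y = tensor_class M N (frag_of (x, y))"
  by (simp add: pure_tensor_def tensor_class_def)

lemma tensor_product_simps:
  "carrier (M \<boxtimes>\<^bsub>k\<^esub> N) = tensor_class M N ` {u. Poly_Mapping.keys u \<subseteq> carrier M \<times> carrier N}"
  "\<zero>\<^bsub>M \<boxtimes>\<^bsub>k\<^esub> N\<^esub> = tensor_null k M N"
  "X \<oplus>\<^bsub>M \<boxtimes>\<^bsub>k\<^esub> N\<^esub> Y = X <#>\<^bsub>free_Abelian_group (carrier M \<times> carrier N)\<^esub> Y"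
  "r \<odot>\<^bsub>M \<boxtimes>\<^bsub>k\<^esub> N\<^esub> X = tensor_null k M N <#>\<^bsub>free_Abelian_group (carrier M \<times> carrier N)\<^esub>
     (frag_extend (\<lambda>(x, y). frag_of (r \<odot>\<^bsub>M\<^esub> x, y)) ` X)"
  by (auto simp: tensor_product_def Let_def carrier_FactGroup tensor_class_def)

text \<open>Only the carrier, the addition and the scalar action enter the relations. Twisted
  products and deformed algebras leave these three unchanged, so inside a tensor product they may be
  replaced by the modules on which they are built.\<close>

lemma tensor_product_cong:
  assumes "carrier M = carrier M'" "add M = add M'" "smult M = smult M'"
    and "carrier N = carrier N'" "add N = add N'" "smult N = smult N'"
  shows "tensor_null k M N = tensor_null k M' N'" "M \<boxtimes>\<^bsub>k\<^esub> N = M' \<boxtimes>\<^bsub>k\<^esub> N'"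
    "x \<otimes>\<^bsub>[k|M,N]\<^esub> y = x \<otimes>\<^bsub>[k|M',N']\<^esub> y"
proof -
  have "tensor_rels k M N = tensor_rels k M' N'"
    by (simp add: tensor_rels_def assms)
  then show n: "tensor_null k M N = tensor_null k M' N'"
    by (simp add: tensor_null_def assms)
  show "M \<boxtimes>\<^bsub>k\<^esub> N = M' \<boxtimes>\<^bsub>k\<^esub> N'" "x \<otimes>\<^bsub>[k|M,N]\<^esub> y = x \<otimes>\<^bsub>[k|M',N']\<^esub> y"
    by (simp_all add: tensor_product_def pure_tensor_def n assms)
qed

lemma tensor_null_closed:
  assumes "module k M" "module k N"
  shows "u \<in> tensor_null k M N \<Longrightarrow> Poly_Mapping.keys u \<subseteq> carrier M \<times> carrier N"
    "0 \<in> tensor_null k M N"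
    "\<lbrakk>u \<in> tensor_null k M N; v \<in> tensor_null k M N\<rbrakk> \<Longrightarrow> u + v \<in> tensor_null k M N"
    "u \<in> tensor_null k M N \<Longrightarrow> - u \<in> tensor_null k M N"
proof -
  interpret M: module k M by fact
  interpret N: module k N by fact
  let ?S = "carrier M \<times> carrier N"
  let ?F = "free_Abelian_group ?S"
  have "tensor_rels k M N \<subseteq> carrier ?F"
    unfolding tensor_rels_def
    by (auto dest!: subsetD[OF keys_diff])
  then interpret Z: subgroup "tensor_null k M N" ?F
    unfolding tensor_null_def by (intro group.generate_is_subgroup) auto
  show sub: "Poly_Mapping.keys u \<subseteq> ?S" if "u \<in> tensor_null k M N" for u
    using subsetD[OF Z.subset that] by (simp only: carrier_free_Abelian_group_iff)
  show "0 \<in> tensor_null k M N"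
    using Z.one_closed by simp
  show "u + v \<in> tensor_null k M N" if "u \<in> tensor_null k M N" "v \<in> tensor_null k M N" for u v
    using Z.m_closed[OF that] by simp
  show "- u \<in> tensor_null k M N" if "u \<in> tensor_null k M N" for u
    using Z.m_inv_closed[OF that] sub[OF that] by simp
qed

text \<open>The case \<open>uminus\<close> serves the inverses of generators in
  \<open>generate\<close>. The support bounds are handed to the induction steps so that facts valid
  only for formal sums over the carriers can be applied there.\<close>

lemma tensor_null_induct [consumes 3, case_names rels zero add uminus]:
  assumes "module k M" "module k N" "u \<in> tensor_null k M N"
    and "\<And>u. u \<in> tensor_rels k M N \<Longrightarrow> P u" and "P 0"
    and "\<And>u v. \<lbrakk>Poly_Mapping.keys u \<subseteq> carrier M \<times> carrier N; Poly_Mapping.keys v \<subseteq> carrier M \<times> carrier N;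
       P u; P v\<rbrakk> \<Longrightarrow> P (u + v)"
    and "\<And>u. \<lbrakk>Poly_Mapping.keys u \<subseteq> carrier M \<times> carrier N; P u\<rbrakk> \<Longrightarrow> P (- u)"
  shows "P u"
proof -
  let ?F = "free_Abelian_group (carrier M \<times> carrier N)"
  have keys: "Poly_Mapping.keys u \<subseteq> carrier M \<times> carrier N"
    if "u \<in> generate ?F (tensor_rels k M N)" for u
    using that tensor_null_closed(1)[OF assms(1,2)] by (simp add: tensor_null_def)
  have "u \<in> generate ?F (tensor_rels k M N)"
    using assms(3) by (simp add: tensor_null_def)
  then show ?thesis
  proof induction
    case (inv h)
    then show ?case
      using keys[OF generate.incl[OF inv]] assms(4,7) by simp
  next
    case (eng h1 h2)
    then show ?case
      using keys assms(6) by simp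
  qed (use assms(4,5) in auto)
qed

lemma tensor_class_eqI:
  assumes "module k M" "module k N" "u - v \<in> tensor_null k M N"
  shows "tensor_class M N u = tensor_class M N v"
proof -
  have "\<exists>z' \<in> tensor_null k M N. z + u = z' + v" if "z \<in> tensor_null k M N" for z
    using that tensor_null_closed(3)[OF assms(1,2) that assms(3)]
    by (intro bexI[of _ "z + (u - v)"]) auto
  moreover have "\<exists>z' \<in> tensor_null k M N. z + v = z' + u" if "z \<in> tensor_null k M N" for z
    using that tensor_null_closed(3)[OF assms(1,2) that tensor_null_closed(4)[OF assms]]
    by (intro bexI[of _ "z + - (u - v)"]) auto
  ultimately show ?thesis
    unfolding tensor_class_eq by (auto simp: image_iff)
qed

lemma tensor_class_add:
  assumes "module k M" "module k N"
  shows "tensor_class M N u \<oplus>\<^bsub>M \<boxtimes>\<^bsub>k\<^esub> N\<^esub> tensor_class M N v = tensor_class M N (u + v)"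
proof -
  have 1: "z + u + (z' + v) \<in> tensor_class M N (u + v)"
    if "z \<in> tensor_null k M N" "z' \<in> tensor_null k M N" for z z'
    using tensor_null_closed(3)[OF assms that]
    by (auto simp: tensor_class_eq image_iff intro!: bexI[of _ "z + z'"])
  have 2: "z + (u + v) \<in> (\<Union>x\<in>tensor_class M N u. \<Union>y\<in>tensor_class M N v. {x + y})"
    if "z \<in> tensor_null k M N" for z
  proof -
    have "z + u \<in> tensor_class M N u" "v \<in> tensor_class M N v"
      using that tensor_null_closed(2)[OF assms] by (auto simp: tensor_class_eq image_iff)
    then show ?thesis
      by (intro UN_I[of "z + u"] UN_I[of v]) (auto simp: add.assoc)
  qed
  show ?thesis
    unfolding tensor_product_simps set_mult_def
    using 1 2 by (auto simp: tensor_class_eq)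
qed

lemma tensor_class_zero: "tensor_class M N 0 = \<zero>\<^bsub>M \<boxtimes>\<^bsub>k\<^esub> N\<^esub>"
  by (simp add: tensor_class_eq tensor_product_simps)

abbreviation frag_smult :: "('k, 'a) module \<Rightarrow> 'k \<Rightarrow> ('a \<times> 'b \<Rightarrow>\<^sub>0 int) \<Rightarrow> ('a \<times> 'b \<Rightarrow>\<^sub>0 int)"
  where "frag_smult M r \<equiv> frag_extend (\<lambda>(x, y). frag_of (r \<odot>\<^bsub>M\<^esub> x, y))"

lemma keys_frag_smult:
  assumes "module k M" "r \<in> carrier k" "Poly_Mapping.keys u \<subseteq> carrier M \<times> carrier N"
  shows "Poly_Mapping.keys (frag_smult M r u) \<subseteq> carrier M \<times> carrier N"
  using keys_frag_extend[of "\<lambda>(x, y). frag_of (r \<odot>\<^bsub>M\<^esub> x, y)" u] assms module.smult_closed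
  by fastforce

text \<open>Scaling sends each relation to a relation of the same kind; for balancedness this uses
  that \<open>k\<close> is commutative. Hence the scalar action descends to cosets.\<close>

lemma frag_smult_null:
  assumes "module k M" "module k N" "r \<in> carrier k" "u \<in> tensor_null k M N"
  shows "frag_smult M r u \<in> tensor_null k M N"
  using assms(1,2,4)
proof (induction rule: tensor_null_induct)
  case (rels u)
  interpret M: module k M by fact
  interpret N: module k N by fact
  have "frag_smult M r u \<in> tensor_rels k M N"
    using rels unfolding tensor_rels_def
  proof (elim UnE CollectE exE conjE, goal_cases)
    case (1 x x' y)
    then show ?case
      using assms(3) by (auto simp: frag_extend_diff M.smult_r_distr intro!: exI)
  next
    case (2 x y y')
    then show ?case
      using assms(3) by (auto simp: frag_extend_diff intro!: exI)
  next
    case (3 s x y)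
    have "r \<odot>\<^bsub>M\<^esub> (s \<odot>\<^bsub>M\<^esub> x) = s \<odot>\<^bsub>M\<^esub> (r \<odot>\<^bsub>M\<^esub> x)"
      using 3 assms(3) by (simp flip: M.smult_assoc1 add: M.R.m_comm)
    then show ?case
      using assms(3) 3 by (auto simp: frag_extend_diff intro!: exI)
  qed
  then show ?case
    by (simp add: tensor_null_def generate.incl)
qed (auto simp: frag_extend_add frag_extend_minus tensor_null_closed[OF assms(1,2)])

lemma tensor_class_smult:
  assumes "module k M" "module k N" "r \<in> carrier k"
  shows "r \<odot>\<^bsub>M \<boxtimes>\<^bsub>k\<^esub> N\<^esub> tensor_class M N u = tensor_class M N (frag_smult M r u)"
proof -
  have 1: "z + frag_smult M r (z' + u) \<in> tensor_class M N (frag_smult M r u)"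
    if "z \<in> tensor_null k M N" "z' \<in> tensor_null k M N" for z z'
    using tensor_null_closed(3)[OF assms(1,2) that(1) frag_smult_null[OF assms that(2)]]
    by (auto simp: tensor_class_eq image_iff frag_extend_add intro!: bexI[of _ "z + frag_smult M r z'"])
  have 2: "z + frag_smult M r u \<in> (\<Union>x\<in>tensor_null k M N. \<Union>y\<in>frag_smult M r ` tensor_class M N u. {x + y})"
    if "z \<in> tensor_null k M N" for z
  proof -
    have "u \<in> tensor_class M N u"
      using tensor_null_closed(2)[OF assms(1,2)] by (auto simp: tensor_class_eq image_iff)
    then show ?thesis
      using that by (intro UN_I[of z] UN_I[of "frag_smult M r u"]) auto
  qed
  show ?thesis
    unfolding tensor_product_simps set_mult_def
    using 1 2 by (auto simp: tensor_class_eq)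
qed

lemma tensor_classE:
  assumes "t \<in> carrier (M \<boxtimes>\<^bsub>k\<^esub> N)"
  obtains u where "Poly_Mapping.keys u \<subseteq> carrier M \<times> carrier N" "t = tensor_class M N u"
  using assms by (auto simp: tensor_product_simps)

lemma tensor_class_in_carrier:
  "Poly_Mapping.keys u \<subseteq> carrier M \<times> carrier N \<Longrightarrow> tensor_class M N u \<in> carrier (M \<boxtimes>\<^bsub>k\<^esub> N)"
  by (auto simp: tensor_product_simps)

lemma pure_tensor_in_carrier [simp]:
  "\<lbrakk>x \<in> carrier M; y \<in> carrier N\<rbrakk> \<Longrightarrow> x \<otimes>\<^bsub>[k|M,N]\<^esub> y \<in> carrier (M \<boxtimes>\<^bsub>k\<^esub> N)"
  unfolding pure_tensor_class by (rule tensor_class_in_carrier) auto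

lemma pure_tensor_bilinear:
  assumes "module k M" "module k N"
  shows "\<lbrakk>x \<in> carrier M; x' \<in> carrier M; y \<in> carrier N\<rbrakk> \<Longrightarrow>
      (x \<oplus>\<^bsub>M\<^esub> x') \<otimes>\<^bsub>[k|M,N]\<^esub> y = (x \<otimes>\<^bsub>[k|M,N]\<^esub> y) \<oplus>\<^bsub>M \<boxtimes>\<^bsub>k\<^esub> N\<^esub> (x' \<otimes>\<^bsub>[k|M,N]\<^esub> y)"
    "\<lbrakk>x \<in> carrier M; y \<in> carrier N; y' \<in> carrier N\<rbrakk> \<Longrightarrow>
      x \<otimes>\<^bsub>[k|M,N]\<^esub> (y \<oplus>\<^bsub>N\<^esub> y') = (x \<otimes>\<^bsub>[k|M,N]\<^esub> y) \<oplus>\<^bsub>M \<boxtimes>\<^bsub>k\<^esub> N\<^esub> (x \<otimes>\<^bsub>[k|M,N]\<^esub> y')"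
    "\<lbrakk>r \<in> carrier k; x \<in> carrier M; y \<in> carrier N\<rbrakk> \<Longrightarrow>
      (r \<odot>\<^bsub>M\<^esub> x) \<otimes>\<^bsub>[k|M,N]\<^esub> y = r \<odot>\<^bsub>M \<boxtimes>\<^bsub>k\<^esub> N\<^esub> (x \<otimes>\<^bsub>[k|M,N]\<^esub> y)"
    "\<lbrakk>r \<in> carrier k; x \<in> carrier M; y \<in> carrier N\<rbrakk> \<Longrightarrow>
      x \<otimes>\<^bsub>[k|M,N]\<^esub> (r \<odot>\<^bsub>N\<^esub> y) = r \<odot>\<^bsub>M \<boxtimes>\<^bsub>k\<^esub> N\<^esub> (x \<otimes>\<^bsub>[k|M,N]\<^esub> y)"
proof -
  have rel: "tensor_class M N u = tensor_class M N v" if "u - v \<in> tensor_rels k M N" for u v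
    by (rule tensor_class_eqI[OF assms]) (use that in \<open>simp add: tensor_null_def generate.incl\<close>)
  show "(x \<oplus>\<^bsub>M\<^esub> x') \<otimes>\<^bsub>[k|M,N]\<^esub> y = (x \<otimes>\<^bsub>[k|M,N]\<^esub> y) \<oplus>\<^bsub>M \<boxtimes>\<^bsub>k\<^esub> N\<^esub> (x' \<otimes>\<^bsub>[k|M,N]\<^esub> y)"
    if "x \<in> carrier M" "x' \<in> carrier M" "y \<in> carrier N"
    unfolding pure_tensor_class tensor_class_add[OF assms]
    by (rule rel) (use that in \<open>auto simp: tensor_rels_def algebra_simps\<close>)
  show "x \<otimes>\<^bsub>[k|M,N]\<^esub> (y \<oplus>\<^bsub>N\<^esub> y') = (x \<otimes>\<^bsub>[k|M,N]\<^esub> y) \<oplus>\<^bsub>M \<boxtimes>\<^bsub>k\<^esub> N\<^esub> (x \<otimes>\<^bsub>[k|M,N]\<^esub> y')"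
    if "x \<in> carrier M" "y \<in> carrier N" "y' \<in> carrier N"
    unfolding pure_tensor_class tensor_class_add[OF assms]
    by (rule rel) (use that in \<open>auto simp: tensor_rels_def algebra_simps\<close>)
  show *: "(r \<odot>\<^bsub>M\<^esub> x) \<otimes>\<^bsub>[k|M,N]\<^esub> y = r \<odot>\<^bsub>M \<boxtimes>\<^bsub>k\<^esub> N\<^esub> (x \<otimes>\<^bsub>[k|M,N]\<^esub> y)"
    if "r \<in> carrier k" "x \<in> carrier M" "y \<in> carrier N"
    using that by (simp add: pure_tensor_class tensor_class_smult assms)
  have "(r \<odot>\<^bsub>M\<^esub> x) \<otimes>\<^bsub>[k|M,N]\<^esub> y = x \<otimes>\<^bsub>[k|M,N]\<^esub> (r \<odot>\<^bsub>N\<^esub> y)"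
    if "r \<in> carrier k" "x \<in> carrier M" "y \<in> carrier N"
    unfolding pure_tensor_class
    by (rule rel) (use that in \<open>auto simp: tensor_rels_def\<close>)
  with * show "x \<otimes>\<^bsub>[k|M,N]\<^esub> (r \<odot>\<^bsub>N\<^esub> y) = r \<odot>\<^bsub>M \<boxtimes>\<^bsub>k\<^esub> N\<^esub> (x \<otimes>\<^bsub>[k|M,N]\<^esub> y)"
    if "r \<in> carrier k" "x \<in> carrier M" "y \<in> carrier N"
    using that by simp
qed

text \<open>No case for zero or for negatives is needed, since 0 \<otimes> 0 represents zero and the
  negative of x \<otimes> y is again pure. Nothing is assumed about the tensor product itself, so
  the rule is available for proving that it is a module.\<close>

lemma tensor_induct [consumes 3, case_names pure add]:
  assumes "module k M" "module k N" "t \<in> carrier (M \<boxtimes>\<^bsub>k\<^esub> N)"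
    and pure: "\<And>x y. \<lbrakk>x \<in> carrier M; y \<in> carrier N\<rbrakk> \<Longrightarrow> P (x \<otimes>\<^bsub>[k|M,N]\<^esub> y)"
    and add: "\<And>s t. \<lbrakk>s \<in> carrier (M \<boxtimes>\<^bsub>k\<^esub> N); t \<in> carrier (M \<boxtimes>\<^bsub>k\<^esub> N); P s; P t\<rbrakk> \<Longrightarrow> P (s \<oplus>\<^bsub>M \<boxtimes>\<^bsub>k\<^esub> N\<^esub> t)"
  shows "P t"
proof -
  interpret M: module k M by fact
  interpret N: module k N by fact
  let ?c = "tensor_class M N" and ?S = "carrier M \<times> carrier N"
  note tensor_null_closed(2)[OF assms(1,2), simp]
  have eq: "?c u = ?c v" if "u = v \<or> u - v \<in> tensor_null k M N" for u v
    using that tensor_class_eqI[OF assms(1,2)] by auto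
  obtain u where u: "Poly_Mapping.keys u \<subseteq> ?S" "t = ?c u"
    using tensor_classE[OF assms(3)] by blast
  \<comment> \<open>The biadditivity relation for 0 + 0 = 0 collapses to the negative of this
    generator.\<close>
  have rel: "frag_of (\<zero>\<^bsub>M\<^esub> , y) \<in> tensor_null k M N" if "y \<in> carrier N" for y
  proof -
    have "frag_of (\<zero>\<^bsub>M\<^esub> \<oplus>\<^bsub>M\<^esub> \<zero>\<^bsub>M\<^esub>, y) - frag_of (\<zero>\<^bsub>M\<^esub>, y) - frag_of (\<zero>\<^bsub>M\<^esub>, y) \<in> tensor_rels k M N"
      using that unfolding tensor_rels_def by blast
    then have "- frag_of (\<zero>\<^bsub>M\<^esub>, y) \<in> tensor_null k M N"
      by (simp add: tensor_null_def generate.incl)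
    from tensor_null_closed(4)[OF assms(1,2) this] show ?thesis
      by simp
  qed
  have class_0: "?c 0 = \<zero>\<^bsub>M\<^esub> \<otimes>\<^bsub>[k|M,N]\<^esub> \<zero>\<^bsub>N\<^esub>"
    unfolding pure_tensor_class
    by (rule tensor_class_eqI[OF assms(1,2)])
      (use tensor_null_closed(4)[OF assms(1,2) rel[of "\<zero>\<^bsub>N\<^esub>"]] in simp)
  have neg: "?c (- frag_of (x, y)) = (\<ominus>\<^bsub>M\<^esub> x) \<otimes>\<^bsub>[k|M,N]\<^esub> y" if "x \<in> carrier M" "y \<in> carrier N" for x y
  proof -
    have "frag_of (x \<oplus>\<^bsub>M\<^esub> \<ominus>\<^bsub>M\<^esub> x, y) - frag_of (x, y) - frag_of (\<ominus>\<^bsub>M\<^esub> x, y) \<in> tensor_rels k M N"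
      using that unfolding tensor_rels_def by blast
    then have "frag_of (\<zero>\<^bsub>M\<^esub>, y) - frag_of (x, y) - frag_of (\<ominus>\<^bsub>M\<^esub> x, y) \<in> tensor_null k M N"
      using that by (simp add: tensor_null_def generate.incl M.r_neg)
    from tensor_null_closed(3)[OF assms(1,2) this tensor_null_closed(4)[OF assms(1,2) rel[OF that(2)]]]
    show ?thesis
      unfolding pure_tensor_class
      by (intro tensor_class_eqI[OF assms(1,2)]) (simp add: algebra_simps)
  qed
  \<comment> \<open>Formal sums are generated by differences, whereas \<open>P\<close> is preserved
    only by sums. Carrying the claim for \<open>- u\<close> along lets u - v be treated as u + (-
    v).\<close>
  have "Poly_Mapping.keys u \<subseteq> ?S \<and> P (?c u) \<and> P (?c (- u))"
    using u(1)
  proof (induction u rule: frag_induction)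
    case zero
    then show ?case
      using pure[of "\<zero>\<^bsub>M\<^esub>" "\<zero>\<^bsub>N\<^esub>"] by (simp add: class_0)
  next
    case (one p)
    then show ?case
      using pure[of "fst p" "snd p"] pure[of "\<ominus>\<^bsub>M\<^esub> fst p" "snd p"] neg[of "fst p" "snd p"]
      by (auto simp: pure_tensor_class)
  next
    case (diff u v)
    have "P (?c (u - v))" "P (?c (- (u - v)))"
      using add[of "?c u" "?c (- v)"] add[of "?c v" "?c (- u)"] diff
      by (simp_all add: tensor_class_add assms tensor_class_in_carrier)
    then show ?case
      using diff keys_diff[of u v] by auto
  qed
  then show ?thesis
    using u by simp
qed

end

section \<open>Linear maps out of tensor products\<close>

context
  fixes k :: "'k ring"
begin

lemma k_linearI:
  assumes "\<And>x. x \<in> carrier M \<Longrightarrow> f x \<in> carrier N"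
    and "\<And>x y. \<lbrakk>x \<in> carrier M; y \<in> carrier M\<rbrakk> \<Longrightarrow> f (x \<oplus>\<^bsub>M\<^esub> y) = f x \<oplus>\<^bsub>N\<^esub> f y"
    and "\<And>r x. \<lbrakk>r \<in> carrier k; x \<in> carrier M\<rbrakk> \<Longrightarrow> f (r \<odot>\<^bsub>M\<^esub> x) = r \<odot>\<^bsub>N\<^esub> f x"
  shows "k_linear k M N f"
  using assms by (auto simp: k_linear_def)

lemma k_linearD:
  assumes "k_linear k M N f"
  shows "x \<in> carrier M \<Longrightarrow> f x \<in> carrier N"
    "\<lbrakk>x \<in> carrier M; y \<in> carrier M\<rbrakk> \<Longrightarrow> f (x \<oplus>\<^bsub>M\<^esub> y) = f x \<oplus>\<^bsub>N\<^esub> f y"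
    "\<lbrakk>r \<in> carrier k; x \<in> carrier M\<rbrakk> \<Longrightarrow> f (r \<odot>\<^bsub>M\<^esub> x) = r \<odot>\<^bsub>N\<^esub> f x"
  using assms by (auto simp: k_linear_def)

lemma k_linear_comp:
  "\<lbrakk>k_linear k M N g; k_linear k L M f\<rbrakk> \<Longrightarrow> k_linear k L N (\<lambda>x. g (f x))"
  by (auto simp: k_linear_def Pi_iff)

lemma k_linear_id: "k_linear k M M (\<lambda>x. x)" "k_linear k M M id"
  by (simp_all add: k_linear_def)

lemma k_linear_cong:
  "\<lbrakk>module k M; \<And>x. x \<in> carrier M \<Longrightarrow> f x = g x\<rbrakk> \<Longrightarrow> k_linear k M N f \<longleftrightarrow> k_linear k M N g"
  by (simp add: k_linear_def Pi_iff module.smult_closed abelian_monoid.a_closed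
      abelian_group.axioms module.axioms)

text \<open>The additive axioms hold on representatives. The axioms for the scalars fail there (two
  scalars do not add up in the free group) and are checked on pure tensors instead, once the action
  is known to be additive.\<close>

lemma module_tensor_product [simp]:
  assumes "module k M" "module k N"
  shows "module k (M \<boxtimes>\<^bsub>k\<^esub> N)"
proof -
  interpret M: module k M by fact
  interpret N: module k N by fact
  let ?T = "M \<boxtimes>\<^bsub>k\<^esub> N"
  let ?c = "tensor_class k M N"
  note cls = tensor_class_add[OF assms] tensor_class_smult[OF assms] tensor_class_zero[of k M N]
  have add_closed: "s \<oplus>\<^bsub>?T\<^esub> t \<in> carrier ?T" if "s \<in> carrier ?T" "t \<in> carrier ?T" for s t
    using that by (elim tensor_classE) (auto simp: cls intro!: tensor_class_in_carrier dest!: subsetD[OF keys_add])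
  have grp: "abelian_group ?T"
  proof (rule abelian_groupI)
    show "\<zero>\<^bsub>?T\<^esub> \<in> carrier ?T"
      using tensor_class_in_carrier[of 0 M N k] by (simp add: cls)
    show "s \<oplus>\<^bsub>?T\<^esub> t \<oplus>\<^bsub>?T\<^esub> u = s \<oplus>\<^bsub>?T\<^esub> (t \<oplus>\<^bsub>?T\<^esub> u)"
      if "s \<in> carrier ?T" "t \<in> carrier ?T" "u \<in> carrier ?T" for s t u
      using that by (elim tensor_classE) (simp add: cls add.assoc)
    show "s \<oplus>\<^bsub>?T\<^esub> t = t \<oplus>\<^bsub>?T\<^esub> s" if "s \<in> carrier ?T" "t \<in> carrier ?T" for s t
      using that by (elim tensor_classE) (simp add: cls add.commute)
    show "\<zero>\<^bsub>?T\<^esub> \<oplus>\<^bsub>?T\<^esub> s = s" if "s \<in> carrier ?T" for s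
      using that by (elim tensor_classE) (simp add: tensor_class_add[OF assms] flip: tensor_class_zero)
    show "\<exists>t\<in>carrier ?T. t \<oplus>\<^bsub>?T\<^esub> s = \<zero>\<^bsub>?T\<^esub>" if s: "s \<in> carrier ?T" for s
    proof -
      obtain u where u: "Poly_Mapping.keys u \<subseteq> carrier M \<times> carrier N" "s = ?c u"
        using tensor_classE[OF s] by blast
      show ?thesis
        by (rule bexI[of _ "?c (- u)"]) (use u in \<open>auto simp: cls tensor_class_in_carrier\<close>)
    qed
  qed (rule add_closed)
  interpret T: abelian_group ?T by (rule grp)
  have smult_closed: "r \<odot>\<^bsub>?T\<^esub> t \<in> carrier ?T" if r: "r \<in> carrier k" and t: "t \<in> carrier ?T" for r t
  proof -
    obtain u where u: "Poly_Mapping.keys u \<subseteq> carrier M \<times> carrier N" "t = ?c u"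
      using tensor_classE[OF t] by blast
    show ?thesis
      unfolding u(2) tensor_class_smult[OF assms r]
      by (rule tensor_class_in_carrier[OF keys_frag_smult[OF assms(1) r u(1)]])
  qed
  have smult_add: "r \<odot>\<^bsub>?T\<^esub> (s \<oplus>\<^bsub>?T\<^esub> t) = r \<odot>\<^bsub>?T\<^esub> s \<oplus>\<^bsub>?T\<^esub> r \<odot>\<^bsub>?T\<^esub> t"
    if "r \<in> carrier k" "s \<in> carrier ?T" "t \<in> carrier ?T" for r s t
    using that by (elim tensor_classE) (simp add: cls frag_extend_add)
  show ?thesis
  proof (rule moduleI)
    show "cring k" by (rule M.is_cring)
    show "(r \<oplus>\<^bsub>k\<^esub> s) \<odot>\<^bsub>?T\<^esub> t = r \<odot>\<^bsub>?T\<^esub> t \<oplus>\<^bsub>?T\<^esub> s \<odot>\<^bsub>?T\<^esub> t"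
      if "r \<in> carrier k" "s \<in> carrier k" "t \<in> carrier ?T" for r s t
      using assms that(3)
    proof (induction rule: tensor_induct)
      case (pure x y)
      then show ?case
        using that by (simp flip: pure_tensor_bilinear(1,3)[OF assms] add: M.smult_l_distr)
    next
      case (add x y)
      then show ?case
        using that smult_closed by (simp add: smult_add T.a_ac)
    qed
    show "(r \<otimes>\<^bsub>k\<^esub> s) \<odot>\<^bsub>?T\<^esub> t = r \<odot>\<^bsub>?T\<^esub> (s \<odot>\<^bsub>?T\<^esub> t)"
      if "r \<in> carrier k" "s \<in> carrier k" "t \<in> carrier ?T" for r s t
      using assms that(3)
    proof (induction rule: tensor_induct)
      case (pure x y)
      then show ?case
        using that by (simp flip: pure_tensor_bilinear(3)[OF assms] add: M.smult_assoc1)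
    next
      case (add x y)
      then show ?case
        using that smult_closed by (simp add: smult_add)
    qed
    show "\<one>\<^bsub>k\<^esub> \<odot>\<^bsub>?T\<^esub> t = t" if "t \<in> carrier ?T" for t
      using assms that
    proof (induction rule: tensor_induct)
      case (pure x y)
      then show ?case
        by (simp flip: pure_tensor_bilinear(3)[OF assms])
    next
      case (add x y)
      then show ?case
        by (simp add: smult_add)
    qed
  qed (use grp smult_closed smult_add in auto)
qed

lemma k_linear_pure_tensor:
  assumes "module k M" "module k N"
  shows "\<lbrakk>y \<in> carrier N; k_linear k L M f\<rbrakk> \<Longrightarrow> k_linear k L (M \<boxtimes>\<^bsub>k\<^esub> N) (\<lambda>x. f x \<otimes>\<^bsub>[k|M,N]\<^esub> y)"
    "\<lbrakk>x \<in> carrier M; k_linear k L N g\<rbrakk> \<Longrightarrow> k_linear k L (M \<boxtimes>\<^bsub>k\<^esub> N) (\<lambda>y. x \<otimes>\<^bsub>[k|M,N]\<^esub> g y)"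
  by (auto intro!: k_linearI simp: k_linearD pure_tensor_bilinear[OF assms])

lemma tensor_ext:
  assumes "t \<in> carrier (M \<boxtimes>\<^bsub>k\<^esub> N)" "module k M" "module k N"
    and "k_linear k (M \<boxtimes>\<^bsub>k\<^esub> N) P F" "k_linear k (M \<boxtimes>\<^bsub>k\<^esub> N) P G"
    and "\<And>x y. \<lbrakk>x \<in> carrier M; y \<in> carrier N\<rbrakk> \<Longrightarrow> F (x \<otimes>\<^bsub>[k|M,N]\<^esub> y) = G (x \<otimes>\<^bsub>[k|M,N]\<^esub> y)"
  shows "F t = G t"
  using assms(2,3,1)
  by (induction rule: tensor_induct) (use assms(4-6) in \<open>simp_all add: k_linearD\<close>)

definition k_bilinear :: "('k, 'a) module \<Rightarrow> ('k, 'b) module \<Rightarrow> ('k, 'c) module \<Rightarrow> ('a \<Rightarrow> 'b \<Rightarrow> 'c) \<Rightarrow> bool"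
  where "k_bilinear M N P h \<longleftrightarrow>
    (\<forall>x\<in>carrier M. k_linear k N P (h x)) \<and> (\<forall>y\<in>carrier N. k_linear k M P (\<lambda>x. h x y))"

lemma k_bilinearI:
  assumes "\<And>x. x \<in> carrier M \<Longrightarrow> k_linear k N P (h x)"
    and "\<And>y. y \<in> carrier N \<Longrightarrow> k_linear k M P (\<lambda>x. h x y)"
  shows "k_bilinear M N P h"
  using assms by (simp add: k_bilinear_def)

lemma k_bilinearD:
  assumes "k_bilinear M N P h"
  shows "x \<in> carrier M \<Longrightarrow> k_linear k N P (h x)"
    "y \<in> carrier N \<Longrightarrow> k_linear k M P (\<lambda>x. h x y)"
    "\<lbrakk>x \<in> carrier M; y \<in> carrier N\<rbrakk> \<Longrightarrow> h x y \<in> carrier P"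
  using assms k_linearD(1)[of N P "h x"] by (auto simp: k_bilinear_def)

definition frag_sum :: "('k, 'c) module \<Rightarrow> ('a \<Rightarrow> 'b \<Rightarrow> 'c) \<Rightarrow> ('a \<times> 'b \<Rightarrow>\<^sub>0 int) \<Rightarrow> 'c"
  where "frag_sum P h u = (\<Oplus>\<^bsub>P\<^esub>p\<in>Poly_Mapping.keys u.
    [Poly_Mapping.lookup u p] \<cdot>\<^bsub>P\<^esub> h (fst p) (snd p))"

lemma frag_sum_add:
  assumes "abelian_group P" "\<And>x y. \<lbrakk>x \<in> carrier M; y \<in> carrier N\<rbrakk> \<Longrightarrow> h x y \<in> carrier P"
    and "Poly_Mapping.keys u \<subseteq> carrier M \<times> carrier N" "Poly_Mapping.keys v \<subseteq> carrier M \<times> carrier N"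
  shows "frag_sum P h (u + v) = frag_sum P h u \<oplus>\<^bsub>P\<^esub> frag_sum P h v"
proof -
  interpret P: abelian_group P by fact
  let ?W = "Poly_Mapping.keys u \<union> Poly_Mapping.keys v"
  let ?g = "\<lambda>u p. [Poly_Mapping.lookup u p] \<cdot>\<^bsub>P\<^esub> h (fst p) (snd p)"
  have carr: "?g w p \<in> carrier P" if "p \<in> ?W" for w :: "_ \<Rightarrow>\<^sub>0 int" and p
    using that assms(2)[of "fst p" "snd p"] assms(3,4) by (auto intro!: P.add.int_pow_closed)
  have pow_0: "[(0::int)] \<cdot>\<^bsub>P\<^esub> x = \<zero>\<^bsub>P\<^esub>" for x
    by (simp add: add_pow_def)
  \<comment> \<open>Coefficients may cancel in u + v, so all three sums are extended by zero terms
    to the union of the two supports.\<close>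
  have ext: "frag_sum P h w = (\<Oplus>\<^bsub>P\<^esub>p\<in>?W. ?g w p)" if "Poly_Mapping.keys w \<subseteq> ?W" for w
    unfolding frag_sum_def
  proof (rule P.add.finprod_mono_neutral_cong_left)
    fix p assume "p \<in> ?W - Poly_Mapping.keys w"
    then have "Poly_Mapping.lookup w p = 0"
      by (simp add: in_keys_iff)
    then show "?g w p = \<zero>\<^bsub>P\<^esub>"
      by (simp only: pow_0)
  qed (use that carr in auto)
  have "frag_sum P h (u + v) = (\<Oplus>\<^bsub>P\<^esub>p\<in>?W. ?g u p \<oplus>\<^bsub>P\<^esub> ?g v p)"
    unfolding ext[OF keys_add]
    by (rule P.finsum_cong')
      (use assms(2-4) carr in \<open>auto simp: lookup_add P.add.int_pow_mult\<close>)
  also have "\<dots> = frag_sum P h u \<oplus>\<^bsub>P\<^esub> frag_sum P h v"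
    unfolding ext[of u, simplified] ext[of v, simplified]
    by (rule P.finsum_addf) (use carr in auto)
  finally show ?thesis .
qed

lemma frag_sum_of:
  assumes "abelian_group P" "h x y \<in> carrier P"
  shows "frag_sum P h (frag_of (x, y)) = h x y"
proof -
  interpret P: abelian_group P by fact
  show ?thesis
    using assms(2) by (simp add: frag_sum_def P.add.finprod_singleton)
qed

text \<open>A bilinear summand makes the sum vanish on every relation, hence on the whole null
  subgroup. The sum is then constant on each coset, which is what makes \<open>the_elem\<close>
  meaningful.\<close>

lemma sweedler_class:
  assumes "module k M" "module k N" "module k P" "k_bilinear M N P h"
    and "Poly_Mapping.keys u \<subseteq> carrier M \<times> carrier N"
  shows "sweedler P (tensor_class k M N u) h = frag_sum P h u"
proof -
  interpret M: module k M by fact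
  interpret N: module k N by fact
  interpret P: module k P by fact
  have P: "abelian_group P" ..
  note bil = k_bilinearD[OF assms(4)]
  let ?S = "carrier M \<times> carrier N"
  have sum_closed: "frag_sum P h w \<in> carrier P" if "Poly_Mapping.keys w \<subseteq> ?S" for w
    unfolding frag_sum_def using that bil(3) by (intro P.finsum_closed) (auto intro!: P.add.int_pow_closed)
  have sum_0: "frag_sum P h 0 = \<zero>\<^bsub>P\<^esub>"
    by (simp add: frag_sum_def)
  have sum_add: "frag_sum P h (v + w) = frag_sum P h v \<oplus>\<^bsub>P\<^esub> frag_sum P h w"
    if "Poly_Mapping.keys v \<subseteq> ?S" "Poly_Mapping.keys w \<subseteq> ?S" for v w
    by (rule frag_sum_add[OF P _ that]) (use bil(3) in blast)
  have sum_minus: "frag_sum P h (- w) = \<ominus>\<^bsub>P\<^esub> frag_sum P h w" if "Poly_Mapping.keys w \<subseteq> ?S" for w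
    by (rule P.minus_equality[symmetric])
      (use sum_add[of "- w" w] that sum_closed[of w] sum_closed[of "- w"] in \<open>auto simp: sum_0\<close>)
  have sum_of: "frag_sum P h (frag_of (x, y)) = h x y" if "x \<in> carrier M" "y \<in> carrier N" for x y
    using frag_sum_of[OF P, of h x y] bil(3) that by blast
  have sum_diff: "frag_sum P h (w - w') = frag_sum P h w \<ominus>\<^bsub>P\<^esub> frag_sum P h w'"
    if "Poly_Mapping.keys w \<subseteq> ?S" "Poly_Mapping.keys w' \<subseteq> ?S" for w w'
    using sum_add[of w "- w'"] that by (simp add: sum_minus P.minus_eq)
  have null: "frag_sum P h z = \<zero>\<^bsub>P\<^esub>" if "z \<in> tensor_null k M N" for z
    using assms(1,2) that
  proof (induction rule: tensor_null_induct)
    case (rels u)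
    then show ?case
      unfolding tensor_rels_def
    proof (elim UnE CollectE exE conjE, goal_cases)
      case (1 x x' y)
      then show ?case
        using k_linearD(2)[OF bil(2)] k_linearD(1)[OF bil(2)] keys_diff[of "frag_of (x \<oplus>\<^bsub>M\<^esub> x', y)" "frag_of (x, y)"]
        by (subst 1, subst sum_diff, force, force, subst sum_diff)
          (auto simp: sum_of P.minus_eq P.a_ac P.r_neg P.r_neg2)
    next
      case (2 x y y')
      then show ?case
        using k_linearD(2)[OF bil(1)] k_linearD(1)[OF bil(1)] keys_diff[of "frag_of (x, y \<oplus>\<^bsub>N\<^esub> y')" "frag_of (x, y)"]
        by (subst 2, subst sum_diff, force, force, subst sum_diff)
          (auto simp: sum_of P.minus_eq P.a_ac P.r_neg P.r_neg2)
    next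
      case (3 s x y)
      then show ?case
        using k_linearD(3)[OF bil(1)] k_linearD(3)[OF bil(2)] bil(3)
        by (subst 3, subst sum_diff) (auto simp: sum_of P.r_neg P.minus_eq)
    qed
  qed (auto simp: sum_0 sum_add sum_minus)
  have "frag_sum P h (z + u) = frag_sum P h u" if "z \<in> tensor_null k M N" for z
    using sum_add[OF tensor_null_closed(1)[OF assms(1,2) that] assms(5)] null[OF that] sum_closed[OF assms(5)]
    by simp
  then have "frag_sum P h ` tensor_class k M N u = {frag_sum P h u}"
    using tensor_null_closed(2)[OF assms(1,2)] by (auto simp: tensor_class_eq image_iff intro!: bexI[of _ 0])
  then show ?thesis
    by (simp add: sweedler_def frag_sum_def[abs_def])
qed

lemma sweedler_pure:
  assumes "module k M" "module k N" "module k P" "k_bilinear M N P h"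
    and "x \<in> carrier M" "y \<in> carrier N"
  shows "sweedler P (x \<otimes>\<^bsub>[k|M,N]\<^esub> y) h = h x y"
  unfolding pure_tensor_class using assms k_bilinearD(3)[OF assms(4)]
  by (simp add: sweedler_class frag_sum_of module.axioms)

lemma sweedler_linear:
  assumes "module k M" "module k N" "module k P" "k_bilinear M N P h"
  shows "k_linear k (M \<boxtimes>\<^bsub>k\<^esub> N) P (\<lambda>t. sweedler P t h)"
proof -
  interpret M: module k M by fact
  interpret N: module k N by fact
  interpret P: module k P by fact
  interpret T: module k "M \<boxtimes>\<^bsub>k\<^esub> N" by (simp add: assms)
  have P: "abelian_group P" ..
  note bil = k_bilinearD[OF assms(4)]
  have add_hom: "sweedler P (s \<oplus>\<^bsub>M \<boxtimes>\<^bsub>k\<^esub> N\<^esub> t) h = sweedler P s h \<oplus>\<^bsub>P\<^esub> sweedler P t h"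
    if s: "s \<in> carrier (M \<boxtimes>\<^bsub>k\<^esub> N)" and t: "t \<in> carrier (M \<boxtimes>\<^bsub>k\<^esub> N)" for s t
  proof -
    obtain u where u: "Poly_Mapping.keys u \<subseteq> carrier M \<times> carrier N" "s = tensor_class k M N u"
      using tensor_classE[OF s] by blast
    obtain v where v: "Poly_Mapping.keys v \<subseteq> carrier M \<times> carrier N" "t = tensor_class k M N v"
      using tensor_classE[OF t] by blast
    have "Poly_Mapping.keys (u + v) \<subseteq> carrier M \<times> carrier N"
      using u v keys_add[of u v] by auto
    moreover have "frag_sum P h (u + v) = frag_sum P h u \<oplus>\<^bsub>P\<^esub> frag_sum P h v"
      by (rule frag_sum_add[OF P _ u(1) v(1)]) (use bil(3) in blast)
    ultimately show ?thesis
      using u v by (simp add: tensor_class_add[OF assms(1,2)] sweedler_class[OF assms])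
  qed
  have closed: "sweedler P t h \<in> carrier P" if "t \<in> carrier (M \<boxtimes>\<^bsub>k\<^esub> N)" for t
    using assms(1,2) that
    by (induction rule: tensor_induct) (auto simp: add_hom sweedler_pure[OF assms] bil(3))
  have smult: "sweedler P (r \<odot>\<^bsub>M \<boxtimes>\<^bsub>k\<^esub> N\<^esub> t) h = r \<odot>\<^bsub>P\<^esub> sweedler P t h"
    if "r \<in> carrier k" "t \<in> carrier (M \<boxtimes>\<^bsub>k\<^esub> N)" for r t
    using assms(1,2) that(2)
  proof (induction rule: tensor_induct)
    case (pure x y)
    then show ?case
      using that k_linearD(3)[OF bil(2)]
      by (simp flip: pure_tensor_bilinear(3)[OF assms(1,2)] add: sweedler_pure[OF assms])
  next
    case (add s t)
    then show ?case
      using that closed by (simp add: add_hom T.smult_r_distr P.smult_r_distr)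
  qed
  show ?thesis
    by (intro k_linearI add_hom closed smult)
qed

text \<open>Bilinearity is not involved: the two summands give equal sums on every representative,
  so the two sets of values coincide, whether or not they are singletons.\<close>

lemma sweedler_cong:
  fixes P :: "('k, 'c) module"
  assumes "t \<in> carrier (M \<boxtimes>\<^bsub>k\<^esub> N)" "module k M" "module k N"
    and "\<And>x y. \<lbrakk>x \<in> carrier M; y \<in> carrier N\<rbrakk> \<Longrightarrow> h x y = h' x y"
    and "\<And>x y. \<lbrakk>x \<in> carrier M; y \<in> carrier N\<rbrakk> \<Longrightarrow> h' x y \<in> carrier P" "abelian_group P"
  shows "sweedler P t h = sweedler P t h'"
proof -
  interpret P: abelian_group P by fact
  obtain u where u: "Poly_Mapping.keys u \<subseteq> carrier M \<times> carrier N" "t = tensor_class k M N u"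
    using tensor_classE[OF assms(1)] by blast
  have keys: "Poly_Mapping.keys w \<subseteq> carrier M \<times> carrier N" if "w \<in> t" for w
  proof -
    obtain z where "z \<in> tensor_null k M N" "w = z + u"
      using \<open>w \<in> t\<close> u by (auto simp: tensor_class_eq)
    then show ?thesis
      using u tensor_null_closed(1)[OF assms(2,3), of z] keys_add[of z u] by auto
  qed
  have "frag_sum P h w = frag_sum P h' w" if "w \<in> t" for w
    unfolding frag_sum_def
  proof (rule P.finsum_cong')
    fix p assume "p \<in> Poly_Mapping.keys w"
    then have p: "fst p \<in> carrier M" "snd p \<in> carrier N"
      using keys[OF that] by auto
    then show "[Poly_Mapping.lookup w p] \<cdot>\<^bsub>P\<^esub> h (fst p) (snd p) = [Poly_Mapping.lookup w p] \<cdot>\<^bsub>P\<^esub> h' (fst p) (snd p)"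
      using assms(4) by simp
  next
    show "(\<lambda>p. [Poly_Mapping.lookup w p] \<cdot>\<^bsub>P\<^esub> h' (fst p) (snd p)) \<in> Poly_Mapping.keys w \<rightarrow> carrier P"
      using keys[OF that] assms(5) by (auto intro!: P.add.int_pow_closed)
  qed simp
  then have "frag_sum P h ` t = frag_sum P h' ` t"
    by (rule image_cong[OF refl])
  then show ?thesis
    by (simp add: sweedler_def frag_sum_def[abs_def])
qed

text \<open>Evaluates a Sweedler sum without checking that its summand is bilinear: it suffices to
  exhibit a linear map that agrees with the summand on pure tensors.\<close>

lemma sweedler_eqI:
  assumes "module k M" "module k N" "module k P" "k_linear k (M \<boxtimes>\<^bsub>k\<^esub> N) P F"
    and "t \<in> carrier (M \<boxtimes>\<^bsub>k\<^esub> N)"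
    and "\<And>x y. \<lbrakk>x \<in> carrier M; y \<in> carrier N\<rbrakk> \<Longrightarrow> h x y = F (x \<otimes>\<^bsub>[k|M,N]\<^esub> y)"
  shows "sweedler P t h = F t"
proof -
  let ?h = "\<lambda>x y. F (x \<otimes>\<^bsub>[k|M,N]\<^esub> y)"
  have bil: "k_bilinear M N P ?h"
    by (intro k_bilinearI k_linear_comp[OF assms(4)] k_linear_pure_tensor k_linear_id assms)
  have "sweedler P t h = sweedler P t ?h"
    by (rule sweedler_cong[OF assms(5,1,2,6)])
      (use assms k_bilinearD(3)[OF bil] in \<open>auto simp: module.axioms\<close>)
  also have "\<dots> = F t"
    by (rule tensor_ext[OF assms(5,1,2) sweedler_linear[OF assms(1-3) bil] assms(4)])
      (simp add: sweedler_pure[OF assms(1-3) bil])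
  finally show ?thesis .
qed

end

section \<open>Functoriality, associativity and the calculus of algebra maps\<close>

context
  fixes k :: "'k ring"
begin

lemma k_linear_add:
  assumes "module k M" "module k N" "k_linear k M N f" "k_linear k M N g"
  shows "k_linear k M N (\<lambda>x. f x \<oplus>\<^bsub>N\<^esub> g x)"
proof -
  interpret M: module k M by fact
  interpret N: module k N by fact
  show ?thesis
    by (rule k_linearI) (auto simp: k_linearD[OF assms(3)] k_linearD[OF assms(4)] N.a_ac N.smult_r_distr)
qed

text \<open>Induction on the tensor, not on the parameter: at a pure tensor the value is
  \<open>h z x y\<close>, and a pointwise sum of linear maps is linear. This handles inner Sweedler
  sums that depend on a variable bound outside.\<close>

lemma sweedler_param_linear:
  assumes "module k L" "module k M" "module k N" "module k P"
    and "\<And>z. z \<in> carrier L \<Longrightarrow> k_bilinear k M N P (h z)"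
    and "\<And>x y. \<lbrakk>x \<in> carrier M; y \<in> carrier N\<rbrakk> \<Longrightarrow> k_linear k L P (\<lambda>z. h z x y)"
    and "s \<in> carrier (M \<boxtimes>\<^bsub>k\<^esub> N)"
  shows "k_linear k L P (\<lambda>z. sweedler P s (h z))"
  using assms(2,3,7)
proof (induction rule: tensor_induct)
  case (pure x y)
  then show ?case
    using k_linear_cong[OF assms(1), of "\<lambda>z. sweedler P (x \<otimes>\<^bsub>[k|M,N]\<^esub> y) (h z)" "\<lambda>z. h z x y" P]
      assms(6) sweedler_pure[OF assms(2-5)] by simp
next
  case (add s t)
  have "sweedler P (s \<oplus>\<^bsub>M \<boxtimes>\<^bsub>k\<^esub> N\<^esub> t) (h z) = sweedler P s (h z) \<oplus>\<^bsub>P\<^esub> sweedler P t (h z)"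
    if "z \<in> carrier L" for z
    by (rule k_linearD(2)[OF sweedler_linear[OF assms(2-4) assms(5)[OF that]]]) (use add in auto)
  then show ?case
    using k_linear_cong[OF assms(1), of "\<lambda>z. sweedler P (s \<oplus>\<^bsub>M \<boxtimes>\<^bsub>k\<^esub> N\<^esub> t) (h z)"]
      k_linear_add[OF assms(1,4) add.IH] by simp
qed

lemma tensor_map_linear:
  assumes "module k M'" "module k N'" "module k M" "module k N" "k_linear k M' M f" "k_linear k N' N g"
  shows "k_linear k (M' \<boxtimes>\<^bsub>k\<^esub> N') (M \<boxtimes>\<^bsub>k\<^esub> N) (tensor_map k M N f g)"
    and tensor_map_pure: "\<lbrakk>x \<in> carrier M'; y \<in> carrier N'\<rbrakk> \<Longrightarrow>
      tensor_map k M N f g (x \<otimes>\<^bsub>[k|M',N']\<^esub> y) = f x \<otimes>\<^bsub>[k|M,N]\<^esub> g y"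
proof -
  have *: "k_bilinear k M' N' (M \<boxtimes>\<^bsub>k\<^esub> N) (\<lambda>x y. f x \<otimes>\<^bsub>[k|M,N]\<^esub> g y)"
    by (intro k_bilinearI k_linear_pure_tensor assms k_linearD(1)[OF assms(5)] k_linearD(1)[OF assms(6)])
  show "k_linear k (M' \<boxtimes>\<^bsub>k\<^esub> N') (M \<boxtimes>\<^bsub>k\<^esub> N) (tensor_map k M N f g)"
    unfolding tensor_map_def[abs_def] by (intro sweedler_linear assms module_tensor_product *)
  show "tensor_map k M N f g (x \<otimes>\<^bsub>[k|M',N']\<^esub> y) = f x \<otimes>\<^bsub>[k|M,N]\<^esub> g y"
    if "x \<in> carrier M'" "y \<in> carrier N'"
    unfolding tensor_map_def using that by (intro sweedler_pure assms module_tensor_product *)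
qed

lemma tensor_map_inverse:
  assumes "module k M" "module k N" "module k M'" "module k N'"
    and "k_linear k M M' f" "k_linear k M' M f'" "k_linear k N N' g" "k_linear k N' N g'"
    and inverse: "\<And>x. x \<in> carrier M \<Longrightarrow> f' (f x) = x" "\<And>y. y \<in> carrier N \<Longrightarrow> g' (g y) = y"
    and t: "t \<in> carrier (M \<boxtimes>\<^bsub>k\<^esub> N)"
  shows "tensor_map k M N f' g' (tensor_map k M' N' f g t) = t" (is "?F t = ?I t")
proof (rule tensor_ext[where F = ?F and G = ?I, OF t assms(1,2)])
  note tm = tensor_map_linear[OF assms(1-4,5,7)] tensor_map_linear[OF assms(3,4,1,2,6,8)]
  show "k_linear k (M \<boxtimes>\<^bsub>k\<^esub> N) (M \<boxtimes>\<^bsub>k\<^esub> N) ?F" "k_linear k (M \<boxtimes>\<^bsub>k\<^esub> N) (M \<boxtimes>\<^bsub>k\<^esub> N) ?I"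
    by (intro k_linear_comp[OF tm(3) tm(1)] k_linear_id)+
  show "?F (x \<otimes>\<^bsub>[k|M,N]\<^esub> y) = x \<otimes>\<^bsub>[k|M,N]\<^esub> y" if "x \<in> carrier M" "y \<in> carrier N" for x y
    using that k_linearD(1)[OF assms(5)] k_linearD(1)[OF assms(7)]
    by (simp add: tm inverse)
qed

lemma flip_map_linear:
  assumes "module k M" "module k N"
  shows "k_linear k (M \<boxtimes>\<^bsub>k\<^esub> N) (N \<boxtimes>\<^bsub>k\<^esub> M) (flip_map k M N)"
    and flip_map_pure: "\<lbrakk>x \<in> carrier M; y \<in> carrier N\<rbrakk> \<Longrightarrow>
      flip_map k M N (x \<otimes>\<^bsub>[k|M,N]\<^esub> y) = y \<otimes>\<^bsub>[k|N,M]\<^esub> x"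
proof -
  have *: "k_bilinear k M N (N \<boxtimes>\<^bsub>k\<^esub> M) (\<lambda>x y. y \<otimes>\<^bsub>[k|N,M]\<^esub> x)"
    by (intro k_bilinearI k_linear_pure_tensor assms k_linear_id)
  show "k_linear k (M \<boxtimes>\<^bsub>k\<^esub> N) (N \<boxtimes>\<^bsub>k\<^esub> M) (flip_map k M N)"
    unfolding flip_map_def[abs_def] by (intro sweedler_linear assms module_tensor_product *)
  show "flip_map k M N (x \<otimes>\<^bsub>[k|M,N]\<^esub> y) = y \<otimes>\<^bsub>[k|N,M]\<^esub> x" if "x \<in> carrier M" "y \<in> carrier N"
    unfolding flip_map_def using that by (intro sweedler_pure assms module_tensor_product *)
qed

text \<open>The inner sum is linear in its tensor by \<open>sweedler_linear\<close> and in the outer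
  variable by \<open>sweedler_param_linear\<close>; so the outer summand is bilinear and both sums
  can be evaluated.\<close>

lemma assoc_right_linear:
  assumes "module k L" "module k M" "module k N"
  shows "k_linear k ((L \<boxtimes>\<^bsub>k\<^esub> M) \<boxtimes>\<^bsub>k\<^esub> N) (L \<boxtimes>\<^bsub>k\<^esub> (M \<boxtimes>\<^bsub>k\<^esub> N)) (assoc_right k L M N)"
    and assoc_right_pure: "\<lbrakk>x \<in> carrier L; y \<in> carrier M; z \<in> carrier N\<rbrakk> \<Longrightarrow>
      assoc_right k L M N ((x \<otimes>\<^bsub>[k|L,M]\<^esub> y) \<otimes>\<^bsub>[k|L \<boxtimes>\<^bsub>k\<^esub> M,N]\<^esub> z) =
      x \<otimes>\<^bsub>[k|L,M \<boxtimes>\<^bsub>k\<^esub> N]\<^esub> (y \<otimes>\<^bsub>[k|M,N]\<^esub> z)"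
proof -
  let ?P = "L \<boxtimes>\<^bsub>k\<^esub> (M \<boxtimes>\<^bsub>k\<^esub> N)"
  let ?h = "\<lambda>z x y. x \<otimes>\<^bsub>[k|L,M \<boxtimes>\<^bsub>k\<^esub> N]\<^esub> (y \<otimes>\<^bsub>[k|M,N]\<^esub> z)"
  note mods = assms module_tensor_product
  have 1: "k_bilinear k L M ?P (?h z)" if "z \<in> carrier N" for z
    using that by (intro k_bilinearI k_linear_pure_tensor k_linear_id mods pure_tensor_in_carrier)
  have 2: "k_bilinear k (L \<boxtimes>\<^bsub>k\<^esub> M) N ?P (\<lambda>s z. sweedler ?P s (?h z))"
  proof (rule k_bilinearI)
    show "k_linear k N ?P (\<lambda>z. sweedler ?P s (?h z))" if "s \<in> carrier (L \<boxtimes>\<^bsub>k\<^esub> M)" for s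
      using that 1
      by (intro sweedler_param_linear[where M = L and N = M] mods k_linear_pure_tensor k_linear_id)
    show "k_linear k (L \<boxtimes>\<^bsub>k\<^esub> M) ?P (\<lambda>s. sweedler ?P s (?h z))" if "z \<in> carrier N" for z
      by (intro sweedler_linear mods 1 that)
  qed
  show "k_linear k ((L \<boxtimes>\<^bsub>k\<^esub> M) \<boxtimes>\<^bsub>k\<^esub> N) ?P (assoc_right k L M N)"
    unfolding assoc_right_def[abs_def] by (intro sweedler_linear mods 2)
  show "assoc_right k L M N ((x \<otimes>\<^bsub>[k|L,M]\<^esub> y) \<otimes>\<^bsub>[k|L \<boxtimes>\<^bsub>k\<^esub> M,N]\<^esub> z) = ?h z x y"
    if "x \<in> carrier L" "y \<in> carrier M" "z \<in> carrier N"
    using that by (simp add: assoc_right_def sweedler_pure[OF _ _ _ 1] sweedler_pure[OF _ _ _ 2] assms)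
qed

lemma assoc_left_linear:
  assumes "module k L" "module k M" "module k N"
  shows "k_linear k (L \<boxtimes>\<^bsub>k\<^esub> (M \<boxtimes>\<^bsub>k\<^esub> N)) ((L \<boxtimes>\<^bsub>k\<^esub> M) \<boxtimes>\<^bsub>k\<^esub> N) (assoc_left k L M N)"
    and assoc_left_pure: "\<lbrakk>x \<in> carrier L; y \<in> carrier M; z \<in> carrier N\<rbrakk> \<Longrightarrow>
      assoc_left k L M N (x \<otimes>\<^bsub>[k|L,M \<boxtimes>\<^bsub>k\<^esub> N]\<^esub> (y \<otimes>\<^bsub>[k|M,N]\<^esub> z)) =
      (x \<otimes>\<^bsub>[k|L,M]\<^esub> y) \<otimes>\<^bsub>[k|L \<boxtimes>\<^bsub>k\<^esub> M,N]\<^esub> z"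
proof -
  let ?P = "(L \<boxtimes>\<^bsub>k\<^esub> M) \<boxtimes>\<^bsub>k\<^esub> N"
  let ?h = "\<lambda>x y z. (x \<otimes>\<^bsub>[k|L,M]\<^esub> y) \<otimes>\<^bsub>[k|L \<boxtimes>\<^bsub>k\<^esub> M,N]\<^esub> z"
  note mods = assms module_tensor_product
  have 1: "k_bilinear k M N ?P (?h x)" if "x \<in> carrier L" for x
    using that by (intro k_bilinearI k_linear_pure_tensor k_linear_id mods pure_tensor_in_carrier)
  have 2: "k_bilinear k L (M \<boxtimes>\<^bsub>k\<^esub> N) ?P (\<lambda>x s. sweedler ?P s (?h x))"
  proof (rule k_bilinearI)
    show "k_linear k L ?P (\<lambda>x. sweedler ?P s (?h x))" if "s \<in> carrier (M \<boxtimes>\<^bsub>k\<^esub> N)" for s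
      using that 1
      by (intro sweedler_param_linear[where M = M and N = N] mods k_linear_pure_tensor k_linear_id)
    show "k_linear k (M \<boxtimes>\<^bsub>k\<^esub> N) ?P (\<lambda>s. sweedler ?P s (?h x))" if "x \<in> carrier L" for x
      by (intro sweedler_linear mods 1 that)
  qed
  show "k_linear k (L \<boxtimes>\<^bsub>k\<^esub> (M \<boxtimes>\<^bsub>k\<^esub> N)) ?P (assoc_left k L M N)"
    unfolding assoc_left_def[abs_def] by (intro sweedler_linear mods 2)
  show "assoc_left k L M N (x \<otimes>\<^bsub>[k|L,M \<boxtimes>\<^bsub>k\<^esub> N]\<^esub> (y \<otimes>\<^bsub>[k|M,N]\<^esub> z)) = ?h x y z"
    if "x \<in> carrier L" "y \<in> carrier M" "z \<in> carrier N"
    using that by (simp add: assoc_left_def sweedler_pure[OF _ _ _ 1] sweedler_pure[OF _ _ _ 2] assms)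
qed

lemma assoc_left_right:
  assumes "module k L" "module k M" "module k N"
  shows "t \<in> carrier ((L \<boxtimes>\<^bsub>k\<^esub> M) \<boxtimes>\<^bsub>k\<^esub> N) \<Longrightarrow> assoc_left k L M N (assoc_right k L M N t) = t" (is "_ \<Longrightarrow> ?A t = t")
    and "u \<in> carrier (L \<boxtimes>\<^bsub>k\<^esub> (M \<boxtimes>\<^bsub>k\<^esub> N)) \<Longrightarrow> assoc_right k L M N (assoc_left k L M N u) = u" (is "_ \<Longrightarrow> ?B u = u")
proof -
  note mods = assms module_tensor_product
  note lin = k_linear_comp[OF assoc_left_linear(1)] k_linear_comp[OF assoc_right_linear(1)]
    k_linear_pure_tensor k_linear_id
  have 1: "?A ((x \<otimes>\<^bsub>[k|L,M]\<^esub> y) \<otimes>\<^bsub>[k|L \<boxtimes>\<^bsub>k\<^esub> M,N]\<^esub> z) = (x \<otimes>\<^bsub>[k|L,M]\<^esub> y) \<otimes>\<^bsub>[k|L \<boxtimes>\<^bsub>k\<^esub> M,N]\<^esub> z"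
    "?B (x \<otimes>\<^bsub>[k|L,M \<boxtimes>\<^bsub>k\<^esub> N]\<^esub> (y \<otimes>\<^bsub>[k|M,N]\<^esub> z)) = x \<otimes>\<^bsub>[k|L,M \<boxtimes>\<^bsub>k\<^esub> N]\<^esub> (y \<otimes>\<^bsub>[k|M,N]\<^esub> z)"
    if "x \<in> carrier L" "y \<in> carrier M" "z \<in> carrier N" for x y z
    using that by (simp_all add: assoc_left_pure assoc_right_pure assms)
  \<comment> \<open>Extension from pure to arbitrary tensors happens one level of nesting at a
    time.\<close>
  have 2: "?A (s \<otimes>\<^bsub>[k|L \<boxtimes>\<^bsub>k\<^esub> M,N]\<^esub> z) = s \<otimes>\<^bsub>[k|L \<boxtimes>\<^bsub>k\<^esub> M,N]\<^esub> z"
    if "s \<in> carrier (L \<boxtimes>\<^bsub>k\<^esub> M)" "z \<in> carrier N" for s z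
    by (rule tensor_ext[OF that(1) assms(1,2), where P = "(L \<boxtimes>\<^bsub>k\<^esub> M) \<boxtimes>\<^bsub>k\<^esub> N"]; (intro lin mods that 1)?)
  have 3: "?B (x \<otimes>\<^bsub>[k|L,M \<boxtimes>\<^bsub>k\<^esub> N]\<^esub> s) = x \<otimes>\<^bsub>[k|L,M \<boxtimes>\<^bsub>k\<^esub> N]\<^esub> s"
    if "s \<in> carrier (M \<boxtimes>\<^bsub>k\<^esub> N)" "x \<in> carrier L" for s x
    by (rule tensor_ext[OF that(1) assms(2,3), where P = "L \<boxtimes>\<^bsub>k\<^esub> (M \<boxtimes>\<^bsub>k\<^esub> N)"]; (intro lin mods that 1)?)
  show "?A t = t" if "t \<in> carrier ((L \<boxtimes>\<^bsub>k\<^esub> M) \<boxtimes>\<^bsub>k\<^esub> N)"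
    by (rule tensor_ext[OF that, where P = "(L \<boxtimes>\<^bsub>k\<^esub> M) \<boxtimes>\<^bsub>k\<^esub> N"]; (intro lin mods that 2)?)
  show "?B u = u" if "u \<in> carrier (L \<boxtimes>\<^bsub>k\<^esub> (M \<boxtimes>\<^bsub>k\<^esub> N))"
    by (rule tensor_ext[OF that, where P = "L \<boxtimes>\<^bsub>k\<^esub> (M \<boxtimes>\<^bsub>k\<^esub> N)"]; (intro lin mods that 3)?)
qed

lemma tensor_ext3_right:
  assumes "t \<in> carrier (L \<boxtimes>\<^bsub>k\<^esub> (M \<boxtimes>\<^bsub>k\<^esub> N))" "module k L" "module k M" "module k N"
    and "k_linear k (L \<boxtimes>\<^bsub>k\<^esub> (M \<boxtimes>\<^bsub>k\<^esub> N)) P F" "k_linear k (L \<boxtimes>\<^bsub>k\<^esub> (M \<boxtimes>\<^bsub>k\<^esub> N)) P G"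
    and "\<And>x y z. \<lbrakk>x \<in> carrier L; y \<in> carrier M; z \<in> carrier N\<rbrakk> \<Longrightarrow>
      F (x \<otimes>\<^bsub>[k|L,M \<boxtimes>\<^bsub>k\<^esub> N]\<^esub> (y \<otimes>\<^bsub>[k|M,N]\<^esub> z)) = G (x \<otimes>\<^bsub>[k|L,M \<boxtimes>\<^bsub>k\<^esub> N]\<^esub> (y \<otimes>\<^bsub>[k|M,N]\<^esub> z))"
  shows "F t = G t"
proof (rule tensor_ext[OF assms(1)])
  fix x s assume x: "x \<in> carrier L" and s: "s \<in> carrier (M \<boxtimes>\<^bsub>k\<^esub> N)"
  show "F (x \<otimes>\<^bsub>[k|L,M \<boxtimes>\<^bsub>k\<^esub> N]\<^esub> s) = G (x \<otimes>\<^bsub>[k|L,M \<boxtimes>\<^bsub>k\<^esub> N]\<^esub> s)"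
    by (rule tensor_ext[OF s, where P = P])
      (intro k_linear_comp[OF assms(5)] k_linear_comp[OF assms(6)] k_linear_pure_tensor k_linear_id
        assms module_tensor_product x; assumption)+
qed (use assms in simp_all)

lemma tensor_ext3_left:
  assumes "t \<in> carrier ((L \<boxtimes>\<^bsub>k\<^esub> M) \<boxtimes>\<^bsub>k\<^esub> N)" "module k L" "module k M" "module k N"
    and "k_linear k ((L \<boxtimes>\<^bsub>k\<^esub> M) \<boxtimes>\<^bsub>k\<^esub> N) P F" "k_linear k ((L \<boxtimes>\<^bsub>k\<^esub> M) \<boxtimes>\<^bsub>k\<^esub> N) P G"
    and "\<And>x y z. \<lbrakk>x \<in> carrier L; y \<in> carrier M; z \<in> carrier N\<rbrakk> \<Longrightarrow>
      F ((x \<otimes>\<^bsub>[k|L,M]\<^esub> y) \<otimes>\<^bsub>[k|L \<boxtimes>\<^bsub>k\<^esub> M,N]\<^esub> z) = G ((x \<otimes>\<^bsub>[k|L,M]\<^esub> y) \<otimes>\<^bsub>[k|L \<boxtimes>\<^bsub>k\<^esub> M,N]\<^esub> z)"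
  shows "F t = G t"
proof (rule tensor_ext[OF assms(1)])
  fix s z assume s: "s \<in> carrier (L \<boxtimes>\<^bsub>k\<^esub> M)" and z: "z \<in> carrier N"
  show "F (s \<otimes>\<^bsub>[k|L \<boxtimes>\<^bsub>k\<^esub> M,N]\<^esub> z) = G (s \<otimes>\<^bsub>[k|L \<boxtimes>\<^bsub>k\<^esub> M,N]\<^esub> z)"
    by (rule tensor_ext[OF s, where P = P])
      (intro k_linear_comp[OF assms(5)] k_linear_comp[OF assms(6)] k_linear_pure_tensor k_linear_id
        assms module_tensor_product z; assumption)+
qed (use assms in simp_all)

lemma module_cong:
  fixes M M' :: "('k, 'a) module"
  assumes "carrier M = carrier M'" "add M = add M'" "ring.zero M = ring.zero M'" "smult M = smult M'"
  shows "module k M \<longleftrightarrow> module k M'"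
  by (simp add: module_def module_axioms_def abelian_group_def abelian_group_axioms_def abelian_monoid_def assms)

lemma assoc_algebraI:
  assumes "module k X" "k_bilinear k X X X (mult X)" "\<one>\<^bsub>X\<^esub> \<in> carrier X"
    and "\<And>x y z. \<lbrakk>x \<in> carrier X; y \<in> carrier X; z \<in> carrier X\<rbrakk> \<Longrightarrow> x \<otimes>\<^bsub>X\<^esub> y \<otimes>\<^bsub>X\<^esub> z = x \<otimes>\<^bsub>X\<^esub> (y \<otimes>\<^bsub>X\<^esub> z)"
    and "\<And>x. x \<in> carrier X \<Longrightarrow> \<one>\<^bsub>X\<^esub> \<otimes>\<^bsub>X\<^esub> x = x" "\<And>x. x \<in> carrier X \<Longrightarrow> x \<otimes>\<^bsub>X\<^esub> \<one>\<^bsub>X\<^esub> = x"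
  shows "assoc_algebra k X"
proof -
  interpret X: module k X by fact
  note bil = k_bilinearD[OF assms(2)]
  have "monoid X"
    by (rule monoidI) (use assms bil(3) in auto)
  moreover have "abelian_group X" ..
  ultimately have "ring X"
    by (intro ringI) (use k_linearD(2)[OF bil(1)] k_linearD(2)[OF bil(2)] in auto)
  then show ?thesis
    using assms(1) by (auto intro!: assoc_algebra.intro assoc_algebra_axioms.intro
        simp: k_linearD(3)[OF bil(1)] k_linearD(3)[OF bil(2)])
qed

lemma assoc_algebra_bilinear:
  assumes "assoc_algebra k X"
  shows "k_bilinear k X X X (mult X)"
proof -
  interpret X: assoc_algebra k X by fact
  show ?thesis
    by (intro k_bilinearI k_linearI) (simp_all add: X.r_distr X.l_distr X.smult_mult_left X.smult_mult_right)
qed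

lemma assoc_algebra_module: "assoc_algebra k X \<Longrightarrow> module k X"
  by (simp add: assoc_algebra_def)

lemma k_linear_mult:
  assumes "assoc_algebra k X"
  shows "\<lbrakk>y \<in> carrier X; k_linear k L X f\<rbrakk> \<Longrightarrow> k_linear k L X (\<lambda>x. f x \<otimes>\<^bsub>X\<^esub> y)"
    "\<lbrakk>x \<in> carrier X; k_linear k L X f\<rbrakk> \<Longrightarrow> k_linear k L X (\<lambda>y. x \<otimes>\<^bsub>X\<^esub> f y)"
  using k_linear_comp[OF k_bilinearD(1)[OF assoc_algebra_bilinear[OF assms]], of x]
    k_linear_comp[OF k_bilinearD(2)[OF assoc_algebra_bilinear[OF assms]], of y] by auto

lemma mult_map_linear:
  assumes "assoc_algebra k X"
  shows "k_linear k (X \<boxtimes>\<^bsub>k\<^esub> X) X (mult_map X)"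
    and mult_map_pure: "\<lbrakk>x \<in> carrier X; y \<in> carrier X\<rbrakk> \<Longrightarrow> mult_map X (x \<otimes>\<^bsub>[k|X,X]\<^esub> y) = x \<otimes>\<^bsub>X\<^esub> y"
  unfolding mult_map_def[abs_def]
  by (intro sweedler_linear sweedler_pure assoc_algebra_module assoc_algebra_bilinear assms; assumption)+

lemma k_linear_tensor_map:
  "\<lbrakk>k_linear k L (M' \<boxtimes>\<^bsub>k\<^esub> N') h; k_linear k M' M f; k_linear k N' N g;
    module k M'; module k N'; module k M; module k N\<rbrakk> \<Longrightarrow>
    k_linear k L (M \<boxtimes>\<^bsub>k\<^esub> N) (\<lambda>x. tensor_map k M N f g (h x))"
  by (rule k_linear_comp[OF tensor_map_linear(1)])

lemma k_linear_flip_map: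
  "\<lbrakk>k_linear k L (M \<boxtimes>\<^bsub>k\<^esub> N) f; module k M; module k N\<rbrakk> \<Longrightarrow>
    k_linear k L (N \<boxtimes>\<^bsub>k\<^esub> M) (\<lambda>x. flip_map k M N (f x))"
  by (rule k_linear_comp[OF flip_map_linear(1)])

lemma k_linear_assoc_left:
  "\<lbrakk>k_linear k P (L \<boxtimes>\<^bsub>k\<^esub> (M \<boxtimes>\<^bsub>k\<^esub> N)) f; module k L; module k M; module k N\<rbrakk> \<Longrightarrow>
    k_linear k P ((L \<boxtimes>\<^bsub>k\<^esub> M) \<boxtimes>\<^bsub>k\<^esub> N) (\<lambda>x. assoc_left k L M N (f x))"
  by (rule k_linear_comp[OF assoc_left_linear(1)])

lemma k_linear_assoc_right:
  "\<lbrakk>k_linear k P ((L \<boxtimes>\<^bsub>k\<^esub> M) \<boxtimes>\<^bsub>k\<^esub> N) f; module k L; module k M; module k N\<rbrakk> \<Longrightarrow>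
    k_linear k P (L \<boxtimes>\<^bsub>k\<^esub> (M \<boxtimes>\<^bsub>k\<^esub> N)) (\<lambda>x. assoc_right k L M N (f x))"
  by (rule k_linear_comp[OF assoc_right_linear(1)])

lemma k_linear_mult_map:
  "\<lbrakk>k_linear k L (X \<boxtimes>\<^bsub>k\<^esub> X) f; assoc_algebra k X\<rbrakk> \<Longrightarrow> k_linear k L X (\<lambda>x. mult_map X (f x))"
  by (rule k_linear_comp[OF mult_map_linear(1)])

text \<open>The linearity premise comes first in each of these rules, so that resolving it instantiates
  the modules occurring in the other premises.\<close>

lemmas k_linear_intros = k_linear_id k_linear_pure_tensor[rotated 3] k_linear_mult[rotated 2]
  k_linear_tensor_map k_linear_flip_map k_linear_assoc_left k_linear_assoc_right k_linear_mult_map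

text \<open>A condition on the operations alone, so that it can be stated for a product whose
  associativity is not yet established.\<close>

definition algebra_hom :: "('k, 'a) module \<Rightarrow> ('k, 'b) module \<Rightarrow> ('a \<Rightarrow> 'b) \<Rightarrow> bool"
  where "algebra_hom A X f \<longleftrightarrow> k_linear k A X f \<and> f \<one>\<^bsub>A\<^esub> = \<one>\<^bsub>X\<^esub> \<and>
    (\<forall>x\<in>carrier A. \<forall>y\<in>carrier A. f (x \<otimes>\<^bsub>A\<^esub> y) = f x \<otimes>\<^bsub>X\<^esub> f y)"

lemma algebra_homD:
  assumes "algebra_hom A X f"
  shows "k_linear k A X f" "f \<one>\<^bsub>A\<^esub> = \<one>\<^bsub>X\<^esub>" "x \<in> carrier A \<Longrightarrow> f x \<in> carrier X"
    "\<lbrakk>x \<in> carrier A; y \<in> carrier A\<rbrakk> \<Longrightarrow> f (x \<otimes>\<^bsub>A\<^esub> y) = f x \<otimes>\<^bsub>X\<^esub> f y"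
  using assms by (auto simp: algebra_hom_def k_linearD(1))

lemma algebra_homI:
  assumes "k_linear k A X f" "f \<one>\<^bsub>A\<^esub> = \<one>\<^bsub>X\<^esub>"
    "\<And>x y. \<lbrakk>x \<in> carrier A; y \<in> carrier A\<rbrakk> \<Longrightarrow> f (x \<otimes>\<^bsub>A\<^esub> y) = f x \<otimes>\<^bsub>X\<^esub> f y"
  shows "algebra_hom A X f"
  using assms by (simp add: algebra_hom_def)

lemma algebra_hom_comp:
  "\<lbrakk>algebra_hom X Y g; algebra_hom A X f\<rbrakk> \<Longrightarrow> algebra_hom A Y (\<lambda>x. g (f x))"
  using k_linearD(1)[of k A X f] by (auto simp: algebra_hom_def intro: k_linear_comp)

lemma algebra_isoI:
  assumes "assoc_algebra k A" "assoc_algebra k X" "algebra_hom A X f" "bij_betw f (carrier A) (carrier X)"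
  shows "algebra_iso k A X f"
  using assms algebra_homD[OF assms(3)] k_linearD[OF algebra_homD(1)[OF assms(3)]]
  by (auto simp: algebra_iso_def ring_iso_def ring_hom_def)

definition prod_map :: "('k, 'c) module \<Rightarrow> ('a \<Rightarrow> 'c) \<Rightarrow> ('b \<Rightarrow> 'c) \<Rightarrow> ('a, 'b) tensor \<Rightarrow> 'c"
  where "prod_map X f g t = sweedler X t (\<lambda>x y. f x \<otimes>\<^bsub>X\<^esub> g y)"

lemma prod_map_linear:
  assumes "module k M" "module k N" "assoc_algebra k X" "k_linear k M X f" "k_linear k N X g"
  shows "k_linear k (M \<boxtimes>\<^bsub>k\<^esub> N) X (prod_map X f g)"
    and prod_map_pure: "\<lbrakk>x \<in> carrier M; y \<in> carrier N\<rbrakk> \<Longrightarrow>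
      prod_map X f g (x \<otimes>\<^bsub>[k|M,N]\<^esub> y) = f x \<otimes>\<^bsub>X\<^esub> g y"
proof -
  have *: "k_bilinear k M N X (\<lambda>x y. f x \<otimes>\<^bsub>X\<^esub> g y)"
    by (intro k_bilinearI k_linear_mult assms k_linearD(1)[OF assms(4)] k_linearD(1)[OF assms(5)])
  show "k_linear k (M \<boxtimes>\<^bsub>k\<^esub> N) X (prod_map X f g)"
    unfolding prod_map_def[abs_def] by (intro sweedler_linear assms assoc_algebra_module *)
  show "prod_map X f g (x \<otimes>\<^bsub>[k|M,N]\<^esub> y) = f x \<otimes>\<^bsub>X\<^esub> g y" if "x \<in> carrier M" "y \<in> carrier N"
    unfolding prod_map_def using that by (intro sweedler_pure assms assoc_algebra_module *)
qed

end

section \<open>Twisted products and factorizations\<close>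

lemma twisted_product_simps [simp]:
  "carrier (twisted_product k A B R) = carrier (A \<boxtimes>\<^bsub>k\<^esub> B)"
  "add (twisted_product k A B R) = add (A \<boxtimes>\<^bsub>k\<^esub> B)"
  "ring.zero (twisted_product k A B R) = ring.zero (A \<boxtimes>\<^bsub>k\<^esub> B)"
  "smult (twisted_product k A B R) = smult (A \<boxtimes>\<^bsub>k\<^esub> B)"
  "\<one>\<^bsub>twisted_product k A B R\<^esub> = \<one>\<^bsub>A\<^esub> \<otimes>\<^bsub>[k|A,B]\<^esub> \<one>\<^bsub>B\<^esub>"
  by (simp_all add: twisted_product_def)

lemma tensor_twisted_product [simp]:
  "twisted_product k A B R \<boxtimes>\<^bsub>k\<^esub> C = (A \<boxtimes>\<^bsub>k\<^esub> B) \<boxtimes>\<^bsub>k\<^esub> C"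
  "C \<boxtimes>\<^bsub>k\<^esub> twisted_product k A B R = C \<boxtimes>\<^bsub>k\<^esub> (A \<boxtimes>\<^bsub>k\<^esub> B)"
  "s \<otimes>\<^bsub>[k|twisted_product k A B R,C]\<^esub> c = s \<otimes>\<^bsub>[k|A \<boxtimes>\<^bsub>k\<^esub> B,C]\<^esub> c"
  "c \<otimes>\<^bsub>[k|C,twisted_product k A B R]\<^esub> s = c \<otimes>\<^bsub>[k|C,A \<boxtimes>\<^bsub>k\<^esub> B]\<^esub> s"
  by (rule tensor_product_cong; simp)+

lemma k_linear_twisted_product [simp]:
  "k_linear k (twisted_product k' A B R) M f \<longleftrightarrow> k_linear k (A \<boxtimes>\<^bsub>k'\<^esub> B) M f"
  "k_linear k N (twisted_product k' A B R) g \<longleftrightarrow> k_linear k N (A \<boxtimes>\<^bsub>k'\<^esub> B) g"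
  by (simp_all add: k_linear_def)

text \<open>Twisting maps are obtained here by computing inside the product that they define.
  Therefore this product has to be available while \<open>R\<close> is merely linear.\<close>

locale linear_twist = A: assoc_algebra k A + B: assoc_algebra k B
  for k :: "'k ring" and A :: "('k, 'a) module" and B :: "('k, 'b) module"
    and R :: "('b, 'a) tensor \<Rightarrow> ('a, 'b) tensor" +
  assumes R_linear: "k_linear k (B \<boxtimes>\<^bsub>k\<^esub> A) (A \<boxtimes>\<^bsub>k\<^esub> B) R"
begin

abbreviation AB where "AB \<equiv> A \<boxtimes>\<^bsub>k\<^esub> B"
abbreviation X where "X \<equiv> twisted_product k A B R"
abbreviation pure_AB (infix \<open>\<oslash>\<close> 66) where "a \<oslash> b \<equiv> a \<otimes>\<^bsub>[k|A,B]\<^esub> b"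

lemma mods: "module k A" "module k B" "module k AB" "module k (B \<boxtimes>\<^bsub>k\<^esub> A)"
  by (simp_all add: A.module_axioms B.module_axioms)

lemma algs: "assoc_algebra k A" "assoc_algebra k B"
  by unfold_locales

lemmas R_closed = k_linearD(1)[OF R_linear]

text \<open>The outer factors of a product of pure tensors never pass through \<open>R\<close>.
  Separating them as a two-sided multiplication leaves \<open>R (b \<otimes> a')\<close> as the only
  nontrivial ingredient, and no Sweedler sum over \<open>R\<close> remains.\<close>

definition lr :: "'a \<Rightarrow> 'b \<Rightarrow> ('a, 'b) tensor \<Rightarrow> ('a, 'b) tensor"
  where "lr a b = tensor_map k A B (\<lambda>x. a \<otimes>\<^bsub>A\<^esub> x) (\<lambda>y. y \<otimes>\<^bsub>B\<^esub> b)"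

lemma lr_linear:
  assumes "a \<in> carrier A" "b \<in> carrier B"
  shows "k_linear k AB AB (lr a b)"
    and lr_pure [simp]: "\<lbrakk>x \<in> carrier A; y \<in> carrier B\<rbrakk> \<Longrightarrow> lr a b (x \<oslash> y) = (a \<otimes>\<^bsub>A\<^esub> x) \<oslash> (y \<otimes>\<^bsub>B\<^esub> b)"
  unfolding lr_def using assms
  by (auto intro!: tensor_map_linear mods k_linear_mult algs k_linear_id
      simp: tensor_map_pure[OF mods(1,2) mods(1,2)] k_linear_mult[OF algs(1)] k_linear_mult[OF algs(2)] k_linear_id)

lemma lr_closed [simp]:
  "\<lbrakk>a \<in> carrier A; b \<in> carrier B; t \<in> carrier AB\<rbrakk> \<Longrightarrow> lr a b t \<in> carrier AB"
  using k_linearD(1)[OF lr_linear(1)] .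

lemma lr_linear_param:
  assumes "t \<in> carrier AB"
  shows "b \<in> carrier B \<Longrightarrow> k_linear k A AB (\<lambda>a. lr a b t)"
    and "a \<in> carrier A \<Longrightarrow> k_linear k B AB (\<lambda>b. lr a b t)"
  unfolding lr_def tensor_map_def using assms
  by (auto intro!: sweedler_param_linear[where M = A and N = B] mods k_bilinearI k_linear_pure_tensor
      k_linear_mult algs k_linear_id)

text \<open>Left multiplication by a \<otimes> b, isolated because it is the summand of the outer
  sum in the product of \<open>X\<close> and must be shown to be bilinear in a and b.\<close>

definition pure_mult :: "'a \<Rightarrow> 'b \<Rightarrow> ('a, 'b) tensor \<Rightarrow> ('a, 'b) tensor"
  where "pure_mult a b t = sweedler AB t (\<lambda>a' b'. lr a b' (R (b \<otimes>\<^bsub>[k|B,A]\<^esub> a')))"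

lemma pure_mult_bilinear:
  assumes "a \<in> carrier A" "b \<in> carrier B"
  shows "k_bilinear k A B AB (\<lambda>a' b'. lr a b' (R (b \<otimes>\<^bsub>[k|B,A]\<^esub> a')))"
proof (rule k_bilinearI)
  show "k_linear k B AB (\<lambda>b'. lr a b' (R (b \<otimes>\<^bsub>[k|B,A]\<^esub> a')))" if "a' \<in> carrier A" for a'
    using that assms by (intro lr_linear_param R_closed pure_tensor_in_carrier)
  show "k_linear k A AB (\<lambda>a'. lr a b' (R (b \<otimes>\<^bsub>[k|B,A]\<^esub> a')))" if "b' \<in> carrier B" for b'
    using that assms
    by (intro k_linear_comp[OF lr_linear(1)] k_linear_comp[OF R_linear] k_linear_pure_tensor mods k_linear_id)
qed

lemma pure_mult_pure: "\<lbrakk>a \<in> carrier A; b \<in> carrier B; a' \<in> carrier A; b' \<in> carrier B\<rbrakk> \<Longrightarrow>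
    pure_mult a b (a' \<oslash> b') = lr a b' (R (b \<otimes>\<^bsub>[k|B,A]\<^esub> a'))"
  unfolding pure_mult_def using mods by (intro sweedler_pure pure_mult_bilinear)

lemma mult_eq: "s \<otimes>\<^bsub>X\<^esub> t = sweedler AB s (\<lambda>a b. pure_mult a b t)"
  by (simp add: twisted_product_def pure_mult_def lr_def tensor_map_def)

lemma pure_mult_linear_param:
  assumes "t \<in> carrier AB"
  shows "k_bilinear k A B AB (\<lambda>a b. pure_mult a b t)"
proof (rule k_bilinearI)
  show "k_linear k B AB (\<lambda>b. pure_mult a b t)" if "a \<in> carrier A" for a
    unfolding pure_mult_def
  proof (rule sweedler_param_linear[where M = A and N = B])
    show "k_linear k B AB (\<lambda>b. lr a y (R (b \<otimes>\<^bsub>[k|B,A]\<^esub> x)))" if "x \<in> carrier A" "y \<in> carrier B" for x y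
      using that \<open>a \<in> _\<close>
      by (intro k_linear_comp[OF lr_linear(1)] k_linear_comp[OF R_linear] k_linear_pure_tensor mods k_linear_id)
  qed (use assms that mods pure_mult_bilinear in auto)
  show "k_linear k A AB (\<lambda>a. pure_mult a b t)" if "b \<in> carrier B" for b
    unfolding pure_mult_def
  proof (rule sweedler_param_linear[where M = A and N = B])
    show "k_linear k A AB (\<lambda>a. lr a y (R (b \<otimes>\<^bsub>[k|B,A]\<^esub> x)))" if "x \<in> carrier A" "y \<in> carrier B" for x y
      using that \<open>b \<in> _\<close> by (intro lr_linear_param R_closed pure_tensor_in_carrier)
  qed (use assms that mods pure_mult_bilinear in auto)
qed

lemma mult_pure: "\<lbrakk>a \<in> carrier A; b \<in> carrier B; a' \<in> carrier A; b' \<in> carrier B\<rbrakk> \<Longrightarrow>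
    (a \<oslash> b) \<otimes>\<^bsub>X\<^esub> (a' \<oslash> b') = lr a b' (R (b \<otimes>\<^bsub>[k|B,A]\<^esub> a'))"
  unfolding mult_eq
  by (subst sweedler_pure) (auto simp: pure_mult_pure intro: pure_mult_linear_param mods)

lemma mult_bilinear: "k_bilinear k AB AB AB (mult X)"
proof (rule k_bilinearI)
  show "k_linear k AB AB (\<lambda>s. s \<otimes>\<^bsub>X\<^esub> t)" if "t \<in> carrier AB" for t
    unfolding mult_eq by (intro sweedler_linear mods pure_mult_linear_param that)
  show "k_linear k AB AB (mult X s)" if "s \<in> carrier AB" for s
    unfolding mult_eq[abs_def]
  proof (rule sweedler_param_linear[where M = A and N = B])
    show "k_linear k AB AB (pure_mult x y)" if "x \<in> carrier A" "y \<in> carrier B" for x y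
      unfolding pure_mult_def[abs_def] using that mods by (intro sweedler_linear pure_mult_bilinear)
  qed (auto simp: mods that pure_mult_linear_param)
qed

lemmas mult_linear = k_linear_comp[OF k_bilinearD(1)[OF mult_bilinear]] k_linear_comp[OF k_bilinearD(2)[OF mult_bilinear]]

lemmas mult_closed [simp] = k_bilinearD(3)[OF mult_bilinear]

lemmas lin = mult_linear[rotated] k_linear_comp[OF R_linear] k_linear_comp[OF lr_linear(1), rotated 2] k_linear_intros

lemma tensor_ext_AB:
  assumes "t \<in> carrier AB" "k_linear k AB P F" "k_linear k AB P G"
    and "\<And>x y. \<lbrakk>x \<in> carrier A; y \<in> carrier B\<rbrakk> \<Longrightarrow> F (x \<oslash> y) = G (x \<oslash> y)"
  shows "F t = G t"
  by (rule tensor_ext[OF assms(1) mods(1,2) assms(2-4)])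

lemma lr_lr:
  assumes "a \<in> carrier A" "b \<in> carrier B" "a' \<in> carrier A" "b' \<in> carrier B" "t \<in> carrier AB"
  shows "lr a b (lr a' b' t) = lr (a \<otimes>\<^bsub>A\<^esub> a') (b' \<otimes>\<^bsub>B\<^esub> b) t"
proof (rule tensor_ext_AB[OF assms(5)])
  show "k_linear k AB AB (\<lambda>t. lr a b (lr a' b' t))" "k_linear k AB AB (lr (a \<otimes>\<^bsub>A\<^esub> a') (b' \<otimes>\<^bsub>B\<^esub> b))"
    by (rule lin | simp add: assms)+
qed (use assms in \<open>auto simp: A.m_assoc B.m_assoc\<close>)

lemma lr_one: "t \<in> carrier AB \<Longrightarrow> lr \<one>\<^bsub>A\<^esub> \<one>\<^bsub>B\<^esub> t = t"
proof (erule tensor_ext_AB)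
  show "k_linear k AB AB (lr \<one>\<^bsub>A\<^esub> \<one>\<^bsub>B\<^esub>)" "k_linear k AB AB (\<lambda>t. t)"
    by (rule lin | simp)+
qed auto

text \<open>The product of \<open>X\<close> makes sense for every linear \<open>R\<close>. In terms of it the two axioms of a
  twisting map say that \<open>R (b \<otimes> a a') = R (b \<otimes> a) (a' \<otimes> 1)\<close> and
  \<open>R (b b' \<otimes> a) = (1 \<otimes> b) R (b' \<otimes> a)\<close>.\<close>

lemma twist_A_eqs:
  assumes "a \<in> carrier A" "a' \<in> carrier A" "b \<in> carrier B"
  defines "t \<equiv> b \<otimes>\<^bsub>[k|B,A \<boxtimes>\<^bsub>k\<^esub> A]\<^esub> (a \<otimes>\<^bsub>[k|A,A]\<^esub> a')"
  shows "(R \<circ> tensor_map k B A id (mult_map A)) t = R (b \<otimes>\<^bsub>[k|B,A]\<^esub> (a \<otimes>\<^bsub>A\<^esub> a'))"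
    and "(tensor_map k A B (mult_map A) id \<circ> assoc_left k A A B \<circ>
       tensor_map k A (A \<boxtimes>\<^bsub>k\<^esub> B) id R \<circ> assoc_right k A B A \<circ>
       tensor_map k (A \<boxtimes>\<^bsub>k\<^esub> B) A R id \<circ> assoc_left k B A A) t =
       R (b \<otimes>\<^bsub>[k|B,A]\<^esub> a) \<otimes>\<^bsub>X\<^esub> (a' \<oslash> \<one>\<^bsub>B\<^esub>)"
proof -
  note pures = tensor_map_pure[where M' = B and N' = "A \<boxtimes>\<^bsub>k\<^esub> A"]
    tensor_map_pure[where M' = "B \<boxtimes>\<^bsub>k\<^esub> A" and N' = A]
    tensor_map_pure[where M' = A and N' = "B \<boxtimes>\<^bsub>k\<^esub> A"]
    tensor_map_pure[where M' = "A \<boxtimes>\<^bsub>k\<^esub> A" and N' = B]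
    assoc_left_pure assoc_right_pure mult_map_pure
  note [simp] = mods algs mult_map_linear(1) k_linear_id R_linear R_closed
  show "(R \<circ> tensor_map k B A id (mult_map A)) t = R (b \<otimes>\<^bsub>[k|B,A]\<^esub> (a \<otimes>\<^bsub>A\<^esub> a'))"
    using assms by (simp add: pures)
  have 1: "tensor_map k A B (mult_map A) id (assoc_left k A A B (x \<otimes>\<^bsub>[k|A,AB]\<^esub> r)) = lr x \<one>\<^bsub>B\<^esub> r"
    (is "?F r = ?G r") if "r \<in> carrier AB" "x \<in> carrier A" for x r
  proof (rule tensor_ext_AB[OF that(1)])
    show "k_linear k AB AB ?F" "k_linear k AB AB ?G"
      by (rule lin | simp add: that)+
  qed (use that in \<open>auto simp: pures simp flip: id_def\<close>)
  \<comment> \<open>The composite is cut after its first application of \<open>R\<close>. The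
    remainder is linear in the value s, so it can be compared with right multiplication by a'
    \<otimes> 1 on pure s, although \<open>R (b \<otimes> a)\<close> itself is not pure.\<close>
  have 2: "tensor_map k A B (mult_map A) id (assoc_left k A A B (tensor_map k A (A \<boxtimes>\<^bsub>k\<^esub> B) id R
     (assoc_right k A B A (s \<otimes>\<^bsub>[k|AB,A]\<^esub> a')))) = s \<otimes>\<^bsub>X\<^esub> (a' \<oslash> \<one>\<^bsub>B\<^esub>)" (is "?F s = ?G s")
    if "s \<in> carrier AB" for s
  proof (rule tensor_ext_AB[OF that])
    show "k_linear k AB AB ?F" "k_linear k AB AB ?G"
      by (rule lin | simp add: assms)+
  qed (use assms in \<open>auto simp: pures 1 mult_pure simp flip: id_def\<close>)
  show "(tensor_map k A B (mult_map A) id \<circ> assoc_left k A A B \<circ>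
       tensor_map k A (A \<boxtimes>\<^bsub>k\<^esub> B) id R \<circ> assoc_right k A B A \<circ>
       tensor_map k (A \<boxtimes>\<^bsub>k\<^esub> B) A R id \<circ> assoc_left k B A A) t =
       R (b \<otimes>\<^bsub>[k|B,A]\<^esub> a) \<otimes>\<^bsub>X\<^esub> (a' \<oslash> \<one>\<^bsub>B\<^esub>)"
    using assms by (simp add: pures 2)
qed

lemma twist_B_eqs:
  assumes "a \<in> carrier A" "b \<in> carrier B" "b' \<in> carrier B"
  defines "t \<equiv> (b \<otimes>\<^bsub>[k|B,B]\<^esub> b') \<otimes>\<^bsub>[k|B \<boxtimes>\<^bsub>k\<^esub> B,A]\<^esub> a"
  shows "(R \<circ> tensor_map k B A (mult_map B) id) t = R ((b \<otimes>\<^bsub>B\<^esub> b') \<otimes>\<^bsub>[k|B,A]\<^esub> a)"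
    and "(tensor_map k A B id (mult_map B) \<circ> assoc_right k A B B \<circ>
       tensor_map k (A \<boxtimes>\<^bsub>k\<^esub> B) B R id \<circ> assoc_left k B A B \<circ>
       tensor_map k B (A \<boxtimes>\<^bsub>k\<^esub> B) id R \<circ> assoc_right k B B A) t =
       (\<one>\<^bsub>A\<^esub> \<oslash> b) \<otimes>\<^bsub>X\<^esub> R (b' \<otimes>\<^bsub>[k|B,A]\<^esub> a)"
proof -
  note pures = tensor_map_pure[where M' = "B \<boxtimes>\<^bsub>k\<^esub> B" and N' = A]
    tensor_map_pure[where M' = "B \<boxtimes>\<^bsub>k\<^esub> A" and N' = B]
    tensor_map_pure[where M' = B and N' = "B \<boxtimes>\<^bsub>k\<^esub> A"]
    tensor_map_pure[where M' = A and N' = "B \<boxtimes>\<^bsub>k\<^esub> B"]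
    assoc_left_pure assoc_right_pure mult_map_pure
  note [simp] = mods algs mult_map_linear(1) k_linear_id R_linear R_closed
  show "(R \<circ> tensor_map k B A (mult_map B) id) t = R ((b \<otimes>\<^bsub>B\<^esub> b') \<otimes>\<^bsub>[k|B,A]\<^esub> a)"
    using assms by (simp add: pures)
  have 1: "tensor_map k A B id (mult_map B) (assoc_right k A B B (r \<otimes>\<^bsub>[k|AB,B]\<^esub> y)) = lr \<one>\<^bsub>A\<^esub> y r"
    (is "?F r = ?G r") if "r \<in> carrier AB" "y \<in> carrier B" for y r
  proof (rule tensor_ext_AB[OF that(1)])
    show "k_linear k AB AB ?F" "k_linear k AB AB ?G"
      by (rule lin | simp add: that)+
  qed (use that in \<open>auto simp: pures simp flip: id_def\<close>)
  \<comment> \<open>The cut is again after the first application of \<open>R\<close>; here the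
    remainder is left multiplication by 1 \<otimes> b.\<close>
  have 2: "tensor_map k A B id (mult_map B) (assoc_right k A B B (tensor_map k (A \<boxtimes>\<^bsub>k\<^esub> B) B R id
     (assoc_left k B A B (b \<otimes>\<^bsub>[k|B,AB]\<^esub> s)))) = (\<one>\<^bsub>A\<^esub> \<oslash> b) \<otimes>\<^bsub>X\<^esub> s" (is "?F s = ?G s")
    if "s \<in> carrier AB" for s
  proof (rule tensor_ext_AB[OF that])
    show "k_linear k AB AB ?F" "k_linear k AB AB ?G"
      by (rule lin | simp add: assms)+
  qed (use assms in \<open>auto simp: pures 1 mult_pure simp flip: id_def\<close>)
  show "(tensor_map k A B id (mult_map B) \<circ> assoc_right k A B B \<circ>
       tensor_map k (A \<boxtimes>\<^bsub>k\<^esub> B) B R id \<circ> assoc_left k B A B \<circ>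
       tensor_map k B (A \<boxtimes>\<^bsub>k\<^esub> B) id R \<circ> assoc_right k B B A) t =
       (\<one>\<^bsub>A\<^esub> \<oslash> b) \<otimes>\<^bsub>X\<^esub> R (b' \<otimes>\<^bsub>[k|B,A]\<^esub> a)"
    using assms by (simp add: pures 2)
qed

lemma twisting_mapI:
  assumes "\<And>a a' b. \<lbrakk>a \<in> carrier A; a' \<in> carrier A; b \<in> carrier B\<rbrakk> \<Longrightarrow>
      R (b \<otimes>\<^bsub>[k|B,A]\<^esub> (a \<otimes>\<^bsub>A\<^esub> a')) = R (b \<otimes>\<^bsub>[k|B,A]\<^esub> a) \<otimes>\<^bsub>X\<^esub> (a' \<oslash> \<one>\<^bsub>B\<^esub>)"
    and "\<And>a b b'. \<lbrakk>a \<in> carrier A; b \<in> carrier B; b' \<in> carrier B\<rbrakk> \<Longrightarrow>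
      R ((b \<otimes>\<^bsub>B\<^esub> b') \<otimes>\<^bsub>[k|B,A]\<^esub> a) = (\<one>\<^bsub>A\<^esub> \<oslash> b) \<otimes>\<^bsub>X\<^esub> R (b' \<otimes>\<^bsub>[k|B,A]\<^esub> a)"
  shows "twisting_map k A B R"
proof
  note [simp] = mods algs
  show "(R \<circ> tensor_map k B A id (mult_map A)) t =
      (tensor_map k A B (mult_map A) id \<circ> assoc_left k A A B \<circ>
       tensor_map k A (A \<boxtimes>\<^bsub>k\<^esub> B) id R \<circ> assoc_right k A B A \<circ>
       tensor_map k (A \<boxtimes>\<^bsub>k\<^esub> B) A R id \<circ> assoc_left k B A A) t" (is "?F t = ?G t")
    if "t \<in> carrier (B \<boxtimes>\<^bsub>k\<^esub> (A \<boxtimes>\<^bsub>k\<^esub> A))" for t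
  proof (rule tensor_ext3_right[where F = ?F and G = ?G, OF that])
    show "k_linear k (B \<boxtimes>\<^bsub>k\<^esub> (A \<boxtimes>\<^bsub>k\<^esub> A)) AB ?F" "k_linear k (B \<boxtimes>\<^bsub>k\<^esub> (A \<boxtimes>\<^bsub>k\<^esub> A)) AB ?G"
      unfolding comp_def by (rule lin | simp)+
  qed (simp_all only: twist_A_eqs assms mods)
  show "(R \<circ> tensor_map k B A (mult_map B) id) t =
      (tensor_map k A B id (mult_map B) \<circ> assoc_right k A B B \<circ>
       tensor_map k (A \<boxtimes>\<^bsub>k\<^esub> B) B R id \<circ> assoc_left k B A B \<circ>
       tensor_map k B (A \<boxtimes>\<^bsub>k\<^esub> B) id R \<circ> assoc_right k B B A) t" (is "?F t = ?G t")
    if "t \<in> carrier ((B \<boxtimes>\<^bsub>k\<^esub> B) \<boxtimes>\<^bsub>k\<^esub> A)" for t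
  proof (rule tensor_ext3_left[where F = ?F and G = ?G, OF that])
    show "k_linear k ((B \<boxtimes>\<^bsub>k\<^esub> B) \<boxtimes>\<^bsub>k\<^esub> A) AB ?F" "k_linear k ((B \<boxtimes>\<^bsub>k\<^esub> B) \<boxtimes>\<^bsub>k\<^esub> A) AB ?G"
      unfolding comp_def by (rule lin | simp)+
  qed (simp_all only: twist_B_eqs assms mods)
qed (rule R_linear)

end

sublocale twisting_map \<subseteq> linear_twist
  by unfold_locales (rule linear)

context twisting_map
begin

lemma R_mult_A:
  assumes "a \<in> carrier A" "a' \<in> carrier A" "b \<in> carrier B"
  shows "R (b \<otimes>\<^bsub>[k|B,A]\<^esub> (a \<otimes>\<^bsub>A\<^esub> a')) = R (b \<otimes>\<^bsub>[k|B,A]\<^esub> a) \<otimes>\<^bsub>X\<^esub> (a' \<oslash> \<one>\<^bsub>B\<^esub>)"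
  unfolding twist_A_eqs[OF assms, symmetric] by (rule twist_mult_A) (simp add: assms)

lemma R_mult_B:
  assumes "a \<in> carrier A" "b \<in> carrier B" "b' \<in> carrier B"
  shows "R ((b \<otimes>\<^bsub>B\<^esub> b') \<otimes>\<^bsub>[k|B,A]\<^esub> a) = (\<one>\<^bsub>A\<^esub> \<oslash> b) \<otimes>\<^bsub>X\<^esub> R (b' \<otimes>\<^bsub>[k|B,A]\<^esub> a)"
  unfolding twist_B_eqs[OF assms, symmetric] by (rule twist_mult_B) (simp add: assms)

end

section \<open>Associativity and unit of the twisted product\<close>

context unital_twisting_map
begin

text \<open>At s = x \<otimes> y the left side involves \<open>R\<close> at (y b') \<otimes> a''.
  Compatibility of \<open>R\<close> with the product of \<open>B\<close> splits off y, which can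
  then be reabsorbed into s.\<close>

lemma lr_mult_right:
  assumes "a \<in> carrier A" "b' \<in> carrier B" "a'' \<in> carrier A" "b'' \<in> carrier B" "s \<in> carrier AB"
  shows "lr a b' s \<otimes>\<^bsub>X\<^esub> (a'' \<oslash> b'') = lr a b'' (s \<otimes>\<^bsub>X\<^esub> R (b' \<otimes>\<^bsub>[k|B,A]\<^esub> a''))" (is "?F s = ?G s")
proof (rule tensor_ext_AB[OF assms(5)])
  note [simp] = assms R_closed
  show "k_linear k AB AB ?F" "k_linear k AB AB ?G"
    by (rule lin | simp)+
  fix x y assume [simp]: "x \<in> carrier A" "y \<in> carrier B"
  have *: "lr (a \<otimes>\<^bsub>A\<^esub> x) b'' ((\<one>\<^bsub>A\<^esub> \<oslash> y) \<otimes>\<^bsub>X\<^esub> t) = lr a b'' ((x \<oslash> y) \<otimes>\<^bsub>X\<^esub> t)" (is "?F t = ?G t")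
    if "t \<in> carrier AB" for t
  proof (rule tensor_ext_AB[OF that])
    show "k_linear k AB AB ?F" "k_linear k AB AB ?G"
      by (rule lin | simp)+
  qed (simp add: mult_pure lr_lr)
  show "lr a b' (x \<oslash> y) \<otimes>\<^bsub>X\<^esub> (a'' \<oslash> b'') = lr a b'' ((x \<oslash> y) \<otimes>\<^bsub>X\<^esub> R (b' \<otimes>\<^bsub>[k|B,A]\<^esub> a''))"
    by (simp add: mult_pure R_mult_B *)
qed

text \<open>The mirror image of the preceding argument: at t = x \<otimes> y compatibility of
  \<open>R\<close> with the product of \<open>A\<close> splits \<open>R\<close> at b \<otimes> (a'
  x).\<close>

lemma mult_lr_left:
  assumes "a \<in> carrier A" "b \<in> carrier B" "a' \<in> carrier A" "b'' \<in> carrier B" "t \<in> carrier AB"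
  shows "(a \<oslash> b) \<otimes>\<^bsub>X\<^esub> lr a' b'' t = lr a b'' (R (b \<otimes>\<^bsub>[k|B,A]\<^esub> a') \<otimes>\<^bsub>X\<^esub> t)" (is "?F t = ?G t")
proof (rule tensor_ext_AB[OF assms(5)])
  note [simp] = assms R_closed
  show "k_linear k AB AB ?F" "k_linear k AB AB ?G"
    by (rule lin | simp)+
  fix x y assume [simp]: "x \<in> carrier A" "y \<in> carrier B"
  have *: "lr a (y \<otimes>\<^bsub>B\<^esub> b'') (s \<otimes>\<^bsub>X\<^esub> (x \<oslash> \<one>\<^bsub>B\<^esub>)) = lr a b'' (s \<otimes>\<^bsub>X\<^esub> (x \<oslash> y))" (is "?F s = ?G s")
    if "s \<in> carrier AB" for s
  proof (rule tensor_ext_AB[OF that])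
    show "k_linear k AB AB ?F" "k_linear k AB AB ?G"
      by (rule lin | simp)+
  qed (simp add: mult_pure lr_lr)
  show "(a \<oslash> b) \<otimes>\<^bsub>X\<^esub> lr a' b'' (x \<oslash> y) = lr a b'' (R (b \<otimes>\<^bsub>[k|B,A]\<^esub> a') \<otimes>\<^bsub>X\<^esub> (x \<oslash> y))"
    by (simp add: mult_pure R_mult_A *)
qed

text \<open>On pure tensors both bracketings equal \<open>lr a b''\<close> applied to the product of
  \<open>R (b \<otimes> a')\<close> and \<open>R (b' \<otimes> a'')\<close>.\<close>

lemma mult_assoc:
  assumes "s \<in> carrier AB" "t \<in> carrier AB" "u \<in> carrier AB"
  shows "s \<otimes>\<^bsub>X\<^esub> t \<otimes>\<^bsub>X\<^esub> u = s \<otimes>\<^bsub>X\<^esub> (t \<otimes>\<^bsub>X\<^esub> u)" (is "?F s = ?G s")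
proof (rule tensor_ext_AB[OF assms(1)])
  show "k_linear k AB AB ?F" "k_linear k AB AB ?G"
    by (rule lin | simp add: assms)+
  fix a b assume 1[simp]: "a \<in> carrier A" "b \<in> carrier B"
  show "(a \<oslash> b) \<otimes>\<^bsub>X\<^esub> t \<otimes>\<^bsub>X\<^esub> u = (a \<oslash> b) \<otimes>\<^bsub>X\<^esub> (t \<otimes>\<^bsub>X\<^esub> u)" (is "?F t = ?G t")
  proof (rule tensor_ext_AB[OF assms(2)])
    show "k_linear k AB AB ?F" "k_linear k AB AB ?G"
      by (rule lin | simp add: assms)+
    fix a' b' assume 2[simp]: "a' \<in> carrier A" "b' \<in> carrier B"
    show "(a \<oslash> b) \<otimes>\<^bsub>X\<^esub> (a' \<oslash> b') \<otimes>\<^bsub>X\<^esub> u = (a \<oslash> b) \<otimes>\<^bsub>X\<^esub> ((a' \<oslash> b') \<otimes>\<^bsub>X\<^esub> u)" (is "?F u = ?G u")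
    proof (rule tensor_ext_AB[OF assms(3)])
      show "k_linear k AB AB ?F" "k_linear k AB AB ?G"
        by (rule lin | simp add: assms)+
      fix a'' b'' assume 3[simp]: "a'' \<in> carrier A" "b'' \<in> carrier B"
      show "(a \<oslash> b) \<otimes>\<^bsub>X\<^esub> (a' \<oslash> b') \<otimes>\<^bsub>X\<^esub> (a'' \<oslash> b'') = (a \<oslash> b) \<otimes>\<^bsub>X\<^esub> ((a' \<oslash> b') \<otimes>\<^bsub>X\<^esub> (a'' \<oslash> b''))"
        by (simp add: mult_pure lr_mult_right mult_lr_left R_closed)
    qed
  qed
qed

lemma mult_one:
  assumes "t \<in> carrier AB"
  shows "(\<one>\<^bsub>A\<^esub> \<oslash> \<one>\<^bsub>B\<^esub>) \<otimes>\<^bsub>X\<^esub> t = t" "t \<otimes>\<^bsub>X\<^esub> (\<one>\<^bsub>A\<^esub> \<oslash> \<one>\<^bsub>B\<^esub>) = t"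
proof -
  show "(\<one>\<^bsub>A\<^esub> \<oslash> \<one>\<^bsub>B\<^esub>) \<otimes>\<^bsub>X\<^esub> t = t" (is "?F t = ?G t")
  proof (rule tensor_ext_AB[OF assms])
    show "k_linear k AB AB ?F" "k_linear k AB AB ?G"
      by (rule lin | simp)+
  qed (simp add: mult_pure twist_unit_B)
  show "t \<otimes>\<^bsub>X\<^esub> (\<one>\<^bsub>A\<^esub> \<oslash> \<one>\<^bsub>B\<^esub>) = t" (is "?F t = ?G t")
  proof (rule tensor_ext_AB[OF assms])
    show "k_linear k AB AB ?F" "k_linear k AB AB ?G"
      by (rule lin | simp)+
  qed (simp add: mult_pure twist_unit_A)
qed

lemma assoc_algebra_twisted_product: "assoc_algebra k X"
proof (rule assoc_algebraI)
  show "module k X"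
    using mods(3) module_cong[of X AB k] by simp
  show "k_bilinear k X X X (mult X)"
    using mult_bilinear by (simp add: k_bilinear_def)
qed (simp_all add: mult_assoc mult_one)

lemma incl_A_hom: "algebra_hom k A X (\<lambda>a. a \<oslash> \<one>\<^bsub>B\<^esub>)"
  by (rule algebra_homI) (auto simp: mult_pure twist_unit_B intro!: k_linear_pure_tensor mods k_linear_id)

lemma incl_B_hom: "algebra_hom k B X (\<lambda>b. \<one>\<^bsub>A\<^esub> \<oslash> b)"
  by (rule algebra_homI) (auto simp: mult_pure twist_unit_A intro!: k_linear_pure_tensor mods k_linear_id)

text \<open>These relations express pure tensors and values of \<open>R\<close> as products of the
  two inclusions, which allows Sweedler sums over \<open>R\<close> to be rewritten as
  multiplications in \<open>X\<close>.\<close>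

lemma incl_mult:
  assumes "a \<in> carrier A" "b \<in> carrier B"
  shows "(a \<oslash> \<one>\<^bsub>B\<^esub>) \<otimes>\<^bsub>X\<^esub> (\<one>\<^bsub>A\<^esub> \<oslash> b) = a \<oslash> b"
    "(\<one>\<^bsub>A\<^esub> \<oslash> b) \<otimes>\<^bsub>X\<^esub> (a \<oslash> \<one>\<^bsub>B\<^esub>) = R (b \<otimes>\<^bsub>[k|B,A]\<^esub> a)"
  using assms by (simp_all add: mult_pure twist_unit_B lr_one R_closed)

end

section \<open>Recognizing a twisting map from a factorization\<close>

context linear_twist
begin

context
  fixes E :: "('k, 'e) module" and f :: "'a \<Rightarrow> 'e" and g :: "'b \<Rightarrow> 'e"
  assumes E: "assoc_algebra k E" and f: "algebra_hom k A E f" and g: "algebra_hom k B E g"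
    and exchange: "\<And>a b. \<lbrakk>a \<in> carrier A; b \<in> carrier B\<rbrakk> \<Longrightarrow>
      prod_map E f g (R (b \<otimes>\<^bsub>[k|B,A]\<^esub> a)) = g b \<otimes>\<^bsub>E\<^esub> f a"
begin

interpretation E: assoc_algebra k E by (rule E)

lemmas fg [simp] = algebra_homD(2-4)[OF f] algebra_homD(2-4)[OF g]

lemma prod_map_lin: "k_linear k AB E (prod_map E f g)"
  by (intro prod_map_linear mods E algebra_homD(1)[OF f] algebra_homD(1)[OF g])

lemma prod_map_pure_fg [simp]:
  "\<lbrakk>a \<in> carrier A; b \<in> carrier B\<rbrakk> \<Longrightarrow> prod_map E f g (a \<oslash> b) = f a \<otimes>\<^bsub>E\<^esub> g b"
  by (intro prod_map_pure mods E algebra_homD(1)[OF f] algebra_homD(1)[OF g])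

lemmas prod_map_closed [simp] = k_linearD(1)[OF prod_map_lin]

lemma prod_map_lr:
  assumes "a \<in> carrier A" "b \<in> carrier B" "t \<in> carrier AB"
  shows "prod_map E f g (lr a b t) = f a \<otimes>\<^bsub>E\<^esub> prod_map E f g t \<otimes>\<^bsub>E\<^esub> g b" (is "?F t = ?G t")
proof (rule tensor_ext_AB[OF assms(3)])
  show "k_linear k AB E ?F" "k_linear k AB E ?G"
    by (rule lin k_linear_comp[OF prod_map_lin] | simp add: assms E)+
qed (simp add: assms E.m_assoc)

text \<open>On pure tensors the image of the product is f a (g b f a') g b', the middle part being
  \<open>exchange\<close>; associativity of \<open>E\<close> regroups it. Only the associativity of
  \<open>E\<close> is used, not that of \<open>X\<close>.\<close>

lemma prod_map_mult:
  assumes "s \<in> carrier AB" "t \<in> carrier AB"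
  shows "prod_map E f g (s \<otimes>\<^bsub>X\<^esub> t) = prod_map E f g s \<otimes>\<^bsub>E\<^esub> prod_map E f g t" (is "?F s = ?G s")
proof (rule tensor_ext_AB[OF assms(1)])
  show "k_linear k AB E ?F" "k_linear k AB E ?G"
    by (rule k_linear_comp[OF prod_map_lin] lin | simp add: assms E)+
  fix a b assume [simp]: "a \<in> carrier A" "b \<in> carrier B"
  show "prod_map E f g ((a \<oslash> b) \<otimes>\<^bsub>X\<^esub> t) = prod_map E f g (a \<oslash> b) \<otimes>\<^bsub>E\<^esub> prod_map E f g t" (is "?F t = ?G t")
  proof (rule tensor_ext_AB[OF assms(2)])
    show "k_linear k AB E ?F" "k_linear k AB E ?G"
      by (rule k_linear_comp[OF prod_map_lin] lin | simp add: assms E)+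
  qed (simp add: mult_pure prod_map_lr exchange R_closed E.m_assoc)
qed

lemma prod_map_hom: "algebra_hom k X E (prod_map E f g)"
  by (rule algebra_homI) (simp_all add: prod_map_lin prod_map_mult)

text \<open>Each axiom is an equation in \<open>AB\<close>, so it may be tested after the injective
  product map. There the two twisting identities become regroupings of g b f a f a' and of g b g b'
  f a, and the unit conditions follow since f and g preserve 1.\<close>

lemma unital_twisting_map_factorization:
  assumes inj: "inj_on (prod_map E f g) (carrier AB)"
  shows "unital_twisting_map k A B R"
proof -
  note [simp] = R_closed
  note eqI = inj_onD[OF inj]
  have "twisting_map k A B R"
    by (rule twisting_mapI; rule eqI) (simp_all add: prod_map_mult exchange E.m_assoc)
  moreover have "R (\<one>\<^bsub>B\<^esub> \<otimes>\<^bsub>[k|B,A]\<^esub> a) = a \<oslash> \<one>\<^bsub>B\<^esub>" if "a \<in> carrier A" for a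
    by (rule eqI) (simp_all add: that exchange)
  moreover have "R (b \<otimes>\<^bsub>[k|B,A]\<^esub> \<one>\<^bsub>A\<^esub>) = \<one>\<^bsub>A\<^esub> \<oslash> b" if "b \<in> carrier B" for b
    by (rule eqI) (simp_all add: that exchange)
  ultimately show ?thesis
    by (simp add: unital_twisting_map_def unital_twisting_map_axioms_def)
qed

end

text \<open>For maps that come without a factorization: the flip, and \<open>T1\<close> over the
  undeformed data, where associativity of the target is what has to be proved.\<close>

lemma unital_twisting_mapI:
  assumes "\<And>a a' b. \<lbrakk>a \<in> carrier A; a' \<in> carrier A; b \<in> carrier B\<rbrakk> \<Longrightarrow>
      R (b \<otimes>\<^bsub>[k|B,A]\<^esub> (a \<otimes>\<^bsub>A\<^esub> a')) = R (b \<otimes>\<^bsub>[k|B,A]\<^esub> a) \<otimes>\<^bsub>X\<^esub> (a' \<oslash> \<one>\<^bsub>B\<^esub>)"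
    and "\<And>a b b'. \<lbrakk>a \<in> carrier A; b \<in> carrier B; b' \<in> carrier B\<rbrakk> \<Longrightarrow>
      R ((b \<otimes>\<^bsub>B\<^esub> b') \<otimes>\<^bsub>[k|B,A]\<^esub> a) = (\<one>\<^bsub>A\<^esub> \<oslash> b) \<otimes>\<^bsub>X\<^esub> R (b' \<otimes>\<^bsub>[k|B,A]\<^esub> a)"
    and "\<And>a. a \<in> carrier A \<Longrightarrow> R (\<one>\<^bsub>B\<^esub> \<otimes>\<^bsub>[k|B,A]\<^esub> a) = a \<oslash> \<one>\<^bsub>B\<^esub>"
    and "\<And>b. b \<in> carrier B \<Longrightarrow> R (b \<otimes>\<^bsub>[k|B,A]\<^esub> \<one>\<^bsub>A\<^esub>) = \<one>\<^bsub>A\<^esub> \<oslash> b"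
  shows "unital_twisting_map k A B R"
  using twisting_mapI[OF assms(1,2)] assms(3,4)
  by (simp add: unital_twisting_map_def unital_twisting_map_axioms_def)

end

text \<open>The twisted product for the flip is the usual tensor product of algebras; the axioms can
  be read off from products of pure tensors.\<close>

lemma unital_twisting_map_flip:
  assumes "assoc_algebra k A" "assoc_algebra k C"
  shows "unital_twisting_map k A C (flip_map k C A)"
proof -
  note mods = assms[THEN assoc_algebra_module]
  interpret linear_twist k A C "flip_map k C A"
    using assms by (intro linear_twist.intro linear_twist_axioms.intro flip_map_linear mods)
  show ?thesis
    by (rule unital_twisting_mapI) (simp_all add: flip_map_pure[OF mods(2,1)] mult_pure)
qed

section \<open>Three factors\<close>

text \<open>Asks only for linearity, so that it applies to the given pair of twists as well as to
  the deformed pair, for which further properties are still to be shown.\<close>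

locale two_twists = R1: linear_twist k A B R\<^sub>1 + R2: linear_twist k B C R\<^sub>2
  for k :: "'k ring" and A :: "('k, 'a) module" and B :: "('k, 'b) module" and C :: "('k, 'c) module"
    and R\<^sub>1 :: "('b, 'a) tensor \<Rightarrow> ('a, 'b) tensor" and R\<^sub>2 :: "('c, 'b) tensor \<Rightarrow> ('b, 'c) tensor"
begin

abbreviation AB where "AB \<equiv> A \<boxtimes>\<^bsub>k\<^esub> B"
abbreviation BC where "BC \<equiv> B \<boxtimes>\<^bsub>k\<^esub> C"
abbreviation ABC where "ABC \<equiv> AB \<boxtimes>\<^bsub>k\<^esub> C"
abbreviation A_BC where "A_BC \<equiv> A \<boxtimes>\<^bsub>k\<^esub> BC"
abbreviation X1 where "X1 \<equiv> twisted_product k A B R\<^sub>1"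
abbreviation X2 where "X2 \<equiv> twisted_product k B C R\<^sub>2"
abbreviation al where "al \<equiv> assoc_left k A B C"
abbreviation ar where "ar \<equiv> assoc_right k A B C"

text \<open>The part of the left side of the hexagon that follows \<open>R\<^sub>1\<close>;
  \<open>twist_past_A\<close> is likewise the part of the right side that follows
  \<open>R\<^sub>2\<close>. With c (or a) fixed they are linear in a single tensor, and composing
  \<open>twist_past_C\<close> with \<open>al\<close> gives \<open>T1\<close>.\<close>

definition twist_past_C :: "'c \<Rightarrow> ('a, 'b) tensor \<Rightarrow> ('a, ('b, 'c) tensor) tensor"
  where "twist_past_C c r = tensor_map k A BC id R\<^sub>2 (assoc_right k A C B
    (tensor_map k (A \<boxtimes>\<^bsub>k\<^esub> C) B (flip_map k C A) id (assoc_left k C A B (c \<otimes>\<^bsub>[k|C,AB]\<^esub> r))))"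

definition twist_past_A :: "'a \<Rightarrow> ('b, 'c) tensor \<Rightarrow> ('a, ('b, 'c) tensor) tensor"
  where "twist_past_A a s = ar (tensor_map k AB C R\<^sub>1 id (assoc_left k B A C
    (tensor_map k B (A \<boxtimes>\<^bsub>k\<^esub> C) id (flip_map k C A) (assoc_right k B C A (s \<otimes>\<^bsub>[k|BC,A]\<^esub> a)))))"

abbreviation T1 where "T1 \<equiv> iterated_twist k A B C R\<^sub>2 (flip_map k C A)"

lemma mods [simp]: "module k A" "module k B" "module k C"
  using R1.mods R2.mods by simp_all

lemma algs [simp]: "assoc_algebra k A" "assoc_algebra k B" "assoc_algebra k C"
  by unfold_locales

lemmas R_linear [simp] = R1.R_linear R2.R_linear
lemmas R_closed [simp] = R1.R_closed R2.R_closed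

lemmas al_closed [simp] = k_linearD(1)[OF assoc_left_linear(1)[OF mods]]
lemmas ar_closed [simp] = k_linearD(1)[OF assoc_right_linear(1)[OF mods]]
lemmas al_pure [simp] = assoc_left_pure[OF mods]
lemmas ar_pure [simp] = assoc_right_pure[OF mods]
lemmas al_ar [simp] = assoc_left_right[OF mods]

lemmas flips = k_linear_id flip_map_linear(1) flip_map_pure
  tensor_map_pure[where M' = "C \<boxtimes>\<^bsub>k\<^esub> A" and N' = B] tensor_map_pure[where M' = A and N' = "C \<boxtimes>\<^bsub>k\<^esub> B"]
  tensor_map_pure[where M' = B and N' = "C \<boxtimes>\<^bsub>k\<^esub> A"] tensor_map_pure[where M' = "B \<boxtimes>\<^bsub>k\<^esub> A" and N' = C]
  assoc_left_pure assoc_right_pure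

lemmas lin0 = R1.mult_linear[rotated] R2.mult_linear[rotated]
  k_linear_comp[OF R1.R_linear] k_linear_comp[OF R2.R_linear]
  k_linear_comp[OF R1.lr_linear(1), rotated 2] k_linear_comp[OF R2.lr_linear(1), rotated 2] k_linear_intros

lemma twist_past_C:
  assumes [simp]: "c \<in> carrier C"
  shows twist_past_C_linear: "k_linear k AB A_BC (twist_past_C c)"
    and twist_past_C_pure [simp]: "\<lbrakk>a \<in> carrier A; b \<in> carrier B\<rbrakk> \<Longrightarrow>
      twist_past_C c (a \<otimes>\<^bsub>[k|A,B]\<^esub> b) = a \<otimes>\<^bsub>[k|A,BC]\<^esub> R\<^sub>2 (c \<otimes>\<^bsub>[k|C,B]\<^esub> b)"
proof -
  show "k_linear k AB A_BC (twist_past_C c)"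
    unfolding twist_past_C_def[abs_def] by (rule lin0 | simp)+
  show "twist_past_C c (a \<otimes>\<^bsub>[k|A,B]\<^esub> b) = a \<otimes>\<^bsub>[k|A,BC]\<^esub> R\<^sub>2 (c \<otimes>\<^bsub>[k|C,B]\<^esub> b)"
    if [simp]: "a \<in> carrier A" "b \<in> carrier B"
    by (simp add: twist_past_C_def flips)
qed

lemma twist_past_A:
  assumes [simp]: "a \<in> carrier A"
  shows twist_past_A_linear: "k_linear k BC A_BC (twist_past_A a)"
    and twist_past_A_pure [simp]: "\<lbrakk>b \<in> carrier B; c \<in> carrier C\<rbrakk> \<Longrightarrow>
      twist_past_A a (b \<otimes>\<^bsub>[k|B,C]\<^esub> c) = ar (R\<^sub>1 (b \<otimes>\<^bsub>[k|B,A]\<^esub> a) \<otimes>\<^bsub>[k|AB,C]\<^esub> c)"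
proof -
  show "k_linear k BC A_BC (twist_past_A a)"
    unfolding twist_past_A_def[abs_def] by (rule lin0 | simp)+
  show "twist_past_A a (b \<otimes>\<^bsub>[k|B,C]\<^esub> c) = ar (R\<^sub>1 (b \<otimes>\<^bsub>[k|B,A]\<^esub> a) \<otimes>\<^bsub>[k|AB,C]\<^esub> c)"
    if [simp]: "b \<in> carrier B" "c \<in> carrier C"
    by (simp add: twist_past_A_def flips)
qed

lemmas twist_past_closed [simp] = k_linearD(1)[OF twist_past_C_linear] k_linearD(1)[OF twist_past_A_linear]

lemma hexagon_iff:
  "hexagon k A B C R\<^sub>1 R\<^sub>2 (flip_map k C A) \<longleftrightarrow>
    (\<forall>a\<in>carrier A. \<forall>b\<in>carrier B. \<forall>c\<in>carrier C.
      twist_past_C c (R\<^sub>1 (b \<otimes>\<^bsub>[k|B,A]\<^esub> a)) = twist_past_A a (R\<^sub>2 (c \<otimes>\<^bsub>[k|C,B]\<^esub> b)))"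
    (is "_ \<longleftrightarrow> ?rhs")
proof -
  let ?F = "\<lambda>t. tensor_map k A BC id R\<^sub>2 (assoc_right k A C B
    (tensor_map k (A \<boxtimes>\<^bsub>k\<^esub> C) B (flip_map k C A) id (assoc_left k C A B (tensor_map k C AB id R\<^sub>1 t))))"
  let ?G = "\<lambda>t. ar (tensor_map k AB C R\<^sub>1 id (assoc_left k B A C
    (tensor_map k B (A \<boxtimes>\<^bsub>k\<^esub> C) id (flip_map k C A) (assoc_right k B C A (tensor_map k BC A R\<^sub>2 id
       (assoc_left k C B A t))))))"
  have F: "?F (c \<otimes>\<^bsub>[k|C,B \<boxtimes>\<^bsub>k\<^esub> A]\<^esub> (b \<otimes>\<^bsub>[k|B,A]\<^esub> a)) = twist_past_C c (R\<^sub>1 (b \<otimes>\<^bsub>[k|B,A]\<^esub> a))"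
    and G: "?G (c \<otimes>\<^bsub>[k|C,B \<boxtimes>\<^bsub>k\<^esub> A]\<^esub> (b \<otimes>\<^bsub>[k|B,A]\<^esub> a)) = twist_past_A a (R\<^sub>2 (c \<otimes>\<^bsub>[k|C,B]\<^esub> b))"
    if [simp]: "a \<in> carrier A" "b \<in> carrier B" "c \<in> carrier C" for a b c
    by (simp_all add: twist_past_C_def twist_past_A_def flips
        tensor_map_pure[where M' = C and N' = "B \<boxtimes>\<^bsub>k\<^esub> A"] tensor_map_pure[where M' = "C \<boxtimes>\<^bsub>k\<^esub> B" and N' = A])
  have lin: "k_linear k (C \<boxtimes>\<^bsub>k\<^esub> (B \<boxtimes>\<^bsub>k\<^esub> A)) A_BC ?F" "k_linear k (C \<boxtimes>\<^bsub>k\<^esub> (B \<boxtimes>\<^bsub>k\<^esub> A)) A_BC ?G"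
    by (rule lin0 | simp)+
  have "(\<forall>t\<in>carrier (C \<boxtimes>\<^bsub>k\<^esub> (B \<boxtimes>\<^bsub>k\<^esub> A)). ?F t = ?G t) \<longleftrightarrow> ?rhs"
  proof (intro iffI ballI)
    fix a b c assume *: "\<forall>t\<in>carrier (C \<boxtimes>\<^bsub>k\<^esub> (B \<boxtimes>\<^bsub>k\<^esub> A)). ?F t = ?G t"
      and abc: "a \<in> carrier A" "b \<in> carrier B" "c \<in> carrier C"
    have "?F (c \<otimes>\<^bsub>[k|C,B \<boxtimes>\<^bsub>k\<^esub> A]\<^esub> (b \<otimes>\<^bsub>[k|B,A]\<^esub> a)) = ?G (c \<otimes>\<^bsub>[k|C,B \<boxtimes>\<^bsub>k\<^esub> A]\<^esub> (b \<otimes>\<^bsub>[k|B,A]\<^esub> a))"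
      by (rule bspec[OF *]) (simp add: abc)
    then show "twist_past_C c (R\<^sub>1 (b \<otimes>\<^bsub>[k|B,A]\<^esub> a)) = twist_past_A a (R\<^sub>2 (c \<otimes>\<^bsub>[k|C,B]\<^esub> b))"
      by (simp only: F[OF abc] G[OF abc])
  next
    fix t assume "?rhs" and t: "t \<in> carrier (C \<boxtimes>\<^bsub>k\<^esub> (B \<boxtimes>\<^bsub>k\<^esub> A))"
    show "?F t = ?G t"
      by (rule tensor_ext3_right[where F = ?F and G = ?G, OF t mods(3,2,1) lin])
        (use \<open>?rhs\<close> in \<open>simp only: F G\<close>)
  qed
  then show ?thesis
    by (simp add: hexagon_def)
qed

lemma T1_pure: "\<lbrakk>c \<in> carrier C; x \<in> carrier AB\<rbrakk> \<Longrightarrow> T1 (c \<otimes>\<^bsub>[k|C,AB]\<^esub> x) = al (twist_past_C c x)"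
  by (simp add: iterated_twist_def twist_past_C_def)

lemma T1_linear: "k_linear k (C \<boxtimes>\<^bsub>k\<^esub> AB) ABC T1"
  unfolding iterated_twist_def comp_def by (rule lin0 | simp)+

end

text \<open>Factorization data for three algebras: relations are prescribed for each of the three
  pairs, the one for A and C being commutation because the third twist is the flip.
  \<open>unital_R1\<close> makes \<open>X1\<close> an algebra, which later serves as the first
  factor of a factorization through \<open>fAB\<close> and \<open>fC\<close>.\<close>

locale two_twists_homs = two_twists k A B C R\<^sub>1 R\<^sub>2 + E: assoc_algebra k E
  for k :: "'k ring" and A :: "('k, 'a) module" and B :: "('k, 'b) module" and C :: "('k, 'c) module"
    and R\<^sub>1 :: "('b, 'a) tensor \<Rightarrow> ('a, 'b) tensor" and R\<^sub>2 :: "('c, 'b) tensor \<Rightarrow> ('b, 'c) tensor"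
    and E :: "('k, 'e) module" +
  fixes fA :: "'a \<Rightarrow> 'e" and fB :: "'b \<Rightarrow> 'e" and fC :: "'c \<Rightarrow> 'e"
  assumes unital_R1: "unital_twisting_map k A B R\<^sub>1"
    and fA: "algebra_hom k A E fA" and fB: "algebra_hom k B E fB" and fC: "algebra_hom k C E fC"
    and exchange_AB: "\<And>a b. \<lbrakk>a \<in> carrier A; b \<in> carrier B\<rbrakk> \<Longrightarrow>
      prod_map E fA fB (R\<^sub>1 (b \<otimes>\<^bsub>[k|B,A]\<^esub> a)) = fB b \<otimes>\<^bsub>E\<^esub> fA a"
    and exchange_BC: "\<And>b c. \<lbrakk>b \<in> carrier B; c \<in> carrier C\<rbrakk> \<Longrightarrow>
      prod_map E fB fC (R\<^sub>2 (c \<otimes>\<^bsub>[k|C,B]\<^esub> b)) = fC c \<otimes>\<^bsub>E\<^esub> fB b"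
    and commute_AC: "\<And>a c. \<lbrakk>a \<in> carrier A; c \<in> carrier C\<rbrakk> \<Longrightarrow> fC c \<otimes>\<^bsub>E\<^esub> fA a = fA a \<otimes>\<^bsub>E\<^esub> fC c"
begin

abbreviation fAB where "fAB \<equiv> prod_map E fA fB"
abbreviation fBC where "fBC \<equiv> prod_map E fB fC"
abbreviation fABC where "fABC \<equiv> prod_map E fAB fC"
abbreviation fA_BC where "fA_BC \<equiv> prod_map E fA fBC"

lemmas E_alg [simp] = E.assoc_algebra_axioms
lemmas f_simps [simp] = algebra_homD(2-4)[OF fA] algebra_homD(2-4)[OF fB] algebra_homD(2-4)[OF fC]
lemmas f_linear [simp] = algebra_homD(1)[OF fA] algebra_homD(1)[OF fB] algebra_homD(1)[OF fC]
lemmas fAB_linear [simp] = prod_map_linear(1)[OF mods(1,2) E_alg f_linear(1,2)]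
lemmas fBC_linear [simp] = prod_map_linear(1)[OF mods(2,3) E_alg f_linear(2,3)]
lemmas fABC_linear = prod_map_linear(1)[OF R1.mods(3) mods(3) E_alg fAB_linear f_linear(3)]
lemmas fA_BC_linear = prod_map_linear(1)[OF mods(1) R2.mods(3) E_alg f_linear(1) fBC_linear]
lemmas f_pure [simp] = prod_map_pure[OF mods(1,2) E_alg f_linear(1,2)] prod_map_pure[OF mods(2,3) E_alg f_linear(2,3)]
  prod_map_pure[OF R1.mods(3) mods(3) E_alg fAB_linear f_linear(3)]
  prod_map_pure[OF mods(1) R2.mods(3) E_alg f_linear(1) fBC_linear]
lemmas f_closed [simp] = k_linearD(1)[OF fAB_linear] k_linearD(1)[OF fBC_linear]
  k_linearD(1)[OF fABC_linear] k_linearD(1)[OF fA_BC_linear]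

lemmas lin_f = k_linear_comp[OF fAB_linear] k_linear_comp[OF fBC_linear] k_linear_comp[OF fABC_linear]
  k_linear_comp[OF fA_BC_linear] k_linear_comp[OF twist_past_C_linear, rotated]
  k_linear_comp[OF twist_past_A_linear, rotated] lin0

lemma fA_BC_ar:
  assumes "t \<in> carrier ABC"
  shows "fA_BC (ar t) = fABC t" (is "?F t = ?G t")
proof (rule tensor_ext3_left[where F = ?F and G = ?G, OF assms mods])
  show "k_linear k ABC E ?F" "k_linear k ABC E ?G"
    by (rule lin_f | simp)+
qed (simp add: E.m_assoc)

text \<open>In \<open>E\<close> the element \<open>fC c\<close> passes \<open>fA a\<close> by
  commutation and \<open>fB b\<close> by \<open>exchange_BC\<close>; the twist records exactly these
  two moves.\<close>

lemma fA_BC_twist_past_C: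
  assumes [simp]: "r \<in> carrier AB" "c \<in> carrier C"
  shows "fA_BC (twist_past_C c r) = fC c \<otimes>\<^bsub>E\<^esub> fAB r" (is "?F r = ?G r")
proof (rule R1.tensor_ext_AB[OF assms(1)])
  show "k_linear k AB E ?F" "k_linear k AB E ?G"
    by (rule lin_f | simp)+
qed (simp add: exchange_BC commute_AC flip: E.m_assoc)

lemma fA_BC_twist_past_A:
  assumes [simp]: "s \<in> carrier BC" "a \<in> carrier A"
  shows "fA_BC (twist_past_A a s) = fBC s \<otimes>\<^bsub>E\<^esub> fA a" (is "?F s = ?G s")
proof (rule R2.tensor_ext_AB[OF assms(1)])
  show "k_linear k BC E ?F" "k_linear k BC E ?G"
    by (rule lin_f | simp)+
qed (simp add: exchange_AB commute_AC fA_BC_ar E.m_assoc)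

context
  assumes bij: "bij_betw fABC (carrier ABC) (carrier E)"
begin

lemma hexagon_factorization: "hexagon k A B C R\<^sub>1 R\<^sub>2 (flip_map k C A)"
  unfolding hexagon_iff
proof (intro ballI)
  fix a b c assume [simp]: "a \<in> carrier A" "b \<in> carrier B" "c \<in> carrier C"
  \<comment> \<open>The hexagon equation lives in A \<otimes> (B \<otimes> C), whereas
    \<open>bij\<close> concerns the other bracketing; injectivity is transported by
    \<open>al\<close> and \<open>ar\<close>.\<close>
  have inj: "s = t" if st: "s \<in> carrier A_BC" "t \<in> carrier A_BC" and eq: "fA_BC s = fA_BC t" for s t
  proof -
    have "fABC (al s) = fABC (al t)"
      using st eq by (simp flip: fA_BC_ar)
    then have "al s = al t"
      by (rule inj_onD[OF bij_betw_imp_inj_on[OF bij]]) (simp_all add: st)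
    then have "ar (al s) = ar (al t)"
      by simp
    then show ?thesis
      using st by simp
  qed
  show "twist_past_C c (R\<^sub>1 (b \<otimes>\<^bsub>[k|B,A]\<^esub> a)) = twist_past_A a (R\<^sub>2 (c \<otimes>\<^bsub>[k|C,B]\<^esub> b))"
    by (rule inj) (simp_all add: fA_BC_twist_past_C fA_BC_twist_past_A exchange_AB exchange_BC E.m_assoc)
qed

text \<open>The two-factor criterion is applied a second time, to \<open>X1\<close> and
  \<open>C\<close> with the twist \<open>T1\<close>. Its exchange relation is
  \<open>fA_BC_twist_past_C\<close> read through \<open>al\<close>, so the iterated product is an
  algebra without a new computation from the hexagon.\<close>

lemma algebra_iso_factorization:
  "algebra_iso k (iterated_product k A B C R\<^sub>1 R\<^sub>2 (flip_map k C A)) E fABC"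
proof -
  have X1: "assoc_algebra k X1"
    using unital_R1 by (rule unital_twisting_map.assoc_algebra_twisted_product)
  interpret T: linear_twist k X1 C T1
    using X1 T1_linear by (simp add: linear_twist_def linear_twist_axioms_def)
  have fAB: "algebra_hom k X1 E fAB"
    by (rule R1.prod_map_hom) (simp_all add: fA fB exchange_AB)
  have exchange: "fABC (T1 (c \<otimes>\<^bsub>[k|C,X1]\<^esub> x)) = fC c \<otimes>\<^bsub>E\<^esub> fAB x"
    if "x \<in> carrier X1" "c \<in> carrier C" for x c
    using that by (simp add: T1_pure fA_BC_twist_past_C flip: fA_BC_ar)
  have "unital_twisting_map k X1 C T1"
    by (rule T.unital_twisting_map_factorization[OF E_alg fAB fC exchange])
      (use bij in \<open>simp_all add: bij_betw_def\<close>)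
  then have "assoc_algebra k T.X"
    by (rule unital_twisting_map.assoc_algebra_twisted_product)
  moreover have "algebra_hom k T.X E fABC"
    by (rule T.prod_map_hom[OF E_alg fAB fC exchange])
  ultimately show ?thesis
    unfolding iterated_product_def using bij by (intro algebra_isoI) simp_all
qed

end

end

section \<open>The undeformed iterated product as an associative algebra\<close>

locale hexagon_twists = two_twists k A B C R\<^sub>1 R\<^sub>2 +
  R1: unital_twisting_map k A B R\<^sub>1 + R2: unital_twisting_map k B C R\<^sub>2
  for k :: "'k ring" and A :: "('k, 'a) module" and B :: "('k, 'b) module" and C :: "('k, 'c) module"
    and R\<^sub>1 :: "('b, 'a) tensor \<Rightarrow> ('a, 'b) tensor" and R\<^sub>2 :: "('c, 'b) tensor \<Rightarrow> ('b, 'c) tensor" +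
  assumes hexagon: "hexagon k A B C R\<^sub>1 R\<^sub>2 (flip_map k C A)"
begin

abbreviation E where "E \<equiv> twisted_product k X1 C T1"

text \<open>\<open>X1\<close> and \<open>AB\<close> share their underlying module. The rewrites
  state tensor products and carriers through \<open>AB\<close>, leaving \<open>X1\<close> only where
  its multiplication matters.\<close>

interpretation T: linear_twist k X1 C T1
  rewrites "X1 \<boxtimes>\<^bsub>k\<^esub> C = ABC" and "C \<boxtimes>\<^bsub>k\<^esub> X1 = C \<boxtimes>\<^bsub>k\<^esub> AB" and "carrier X1 = carrier AB"
    and "\<one>\<^bsub>X1\<^esub> = \<one>\<^bsub>A\<^esub> \<otimes>\<^bsub>[k|A,B]\<^esub> \<one>\<^bsub>B\<^esub>"
    and "\<And>x c. x \<otimes>\<^bsub>[k|X1,C]\<^esub> c = x \<otimes>\<^bsub>[k|AB,C]\<^esub> c"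
    and "\<And>x c. c \<otimes>\<^bsub>[k|C,X1]\<^esub> x = c \<otimes>\<^bsub>[k|C,AB]\<^esub> x"
  using T1_linear
  by (simp_all add: linear_twist_def linear_twist_axioms_def R1.assoc_algebra_twisted_product)

lemmas lin = T.mult_linear[rotated] k_linear_comp[OF T.R_linear] k_linear_comp[OF T.lr_linear(1), rotated 2]
  k_linear_comp[OF twist_past_C_linear, rotated] k_linear_comp[OF twist_past_A_linear, rotated] lin0

lemmas [simp] = T.R_closed

lemma T1_one:
  assumes "x \<in> carrier AB"
  shows "T1 (\<one>\<^bsub>C\<^esub> \<otimes>\<^bsub>[k|C,AB]\<^esub> x) = x \<otimes>\<^bsub>[k|AB,C]\<^esub> \<one>\<^bsub>C\<^esub>" (is "?F x = ?G x")
proof (rule R1.tensor_ext_AB[OF assms])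
  show "k_linear k AB ABC ?F" "k_linear k AB ABC ?G"
    by (rule lin | simp)+
qed (simp add: T1_pure R2.twist_unit_B)

lemma T1_unit: "c \<in> carrier C \<Longrightarrow>
    T1 (c \<otimes>\<^bsub>[k|C,AB]\<^esub> (\<one>\<^bsub>A\<^esub> \<otimes>\<^bsub>[k|A,B]\<^esub> \<one>\<^bsub>B\<^esub>)) = (\<one>\<^bsub>A\<^esub> \<otimes>\<^bsub>[k|A,B]\<^esub> \<one>\<^bsub>B\<^esub>) \<otimes>\<^bsub>[k|AB,C]\<^esub> c"
  by (simp add: T1_pure R2.twist_unit_A)

text \<open>On pure x the factor a is only carried along by the flip, so the identity comes from
  compatibility of \<open>R\<^sub>2\<close> with the product of \<open>C\<close>.\<close>

lemma T1_mult_C: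
  assumes [simp]: "x \<in> carrier AB" "c \<in> carrier C" "c' \<in> carrier C"
  shows "T1 ((c \<otimes>\<^bsub>C\<^esub> c') \<otimes>\<^bsub>[k|C,AB]\<^esub> x) =
    ((\<one>\<^bsub>A\<^esub> \<otimes>\<^bsub>[k|A,B]\<^esub> \<one>\<^bsub>B\<^esub>) \<otimes>\<^bsub>[k|AB,C]\<^esub> c) \<otimes>\<^bsub>E\<^esub> T1 (c' \<otimes>\<^bsub>[k|C,AB]\<^esub> x)" (is "?F x = ?G x")
proof (rule R1.tensor_ext_AB[OF assms(1)])
  let ?one = "\<one>\<^bsub>A\<^esub> \<otimes>\<^bsub>[k|A,B]\<^esub> \<one>\<^bsub>B\<^esub>"
  show "k_linear k AB ABC ?F" "k_linear k AB ABC ?G"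
    by (rule lin | simp)+
  fix a b assume [simp]: "a \<in> carrier A" "b \<in> carrier B"
  have 1: "al (a \<otimes>\<^bsub>[k|A,BC]\<^esub> R2.lr \<one>\<^bsub>B\<^esub> z r) = T.lr ?one z (al (a \<otimes>\<^bsub>[k|A,BC]\<^esub> r))" (is "?F r = ?G r")
    if [simp]: "r \<in> carrier BC" "z \<in> carrier C" for r z
  proof (rule R2.tensor_ext_AB[OF that(1)])
    show "k_linear k BC ABC ?F" "k_linear k BC ABC ?G"
      by (rule lin | simp)+
  qed (simp add: R1.mult_one)
  have 2: "al (a \<otimes>\<^bsub>[k|A,BC]\<^esub> ((\<one>\<^bsub>B\<^esub> \<otimes>\<^bsub>[k|B,C]\<^esub> c) \<otimes>\<^bsub>X2\<^esub> s)) =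
      (?one \<otimes>\<^bsub>[k|AB,C]\<^esub> c) \<otimes>\<^bsub>E\<^esub> al (a \<otimes>\<^bsub>[k|A,BC]\<^esub> s)" (is "?F s = ?G s")
    if [simp]: "s \<in> carrier BC" for s
  proof (rule R2.tensor_ext_AB[OF that(1)])
    show "k_linear k BC ABC ?F" "k_linear k BC ABC ?G"
      by (rule lin | simp)+
  qed (simp add: R2.mult_pure T.mult_pure T1_pure 1)
  show "T1 ((c \<otimes>\<^bsub>C\<^esub> c') \<otimes>\<^bsub>[k|C,AB]\<^esub> (a \<otimes>\<^bsub>[k|A,B]\<^esub> b)) =
    (?one \<otimes>\<^bsub>[k|AB,C]\<^esub> c) \<otimes>\<^bsub>E\<^esub> T1 (c' \<otimes>\<^bsub>[k|C,AB]\<^esub> (a \<otimes>\<^bsub>[k|A,B]\<^esub> b))"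
    by (simp add: T1_pure R2.R_mult_B 2)
qed

text \<open>For x = a \<otimes> b and x' = a' \<otimes> b' the element c must move past a,
  \<open>R\<^sub>1 (b \<otimes> a')\<close> and b'. The outer a and b' are split off as
  \<open>?M\<close>; the hexagon equation trades moving c past
  \<open>R\<^sub>1 (b \<otimes> a')\<close> for moving \<open>R\<^sub>2 (c \<otimes> b)\<close> past
  a'; the result is then recognized as the product in \<open>E\<close>.\<close>

lemma T1_mult_AB:
  assumes [simp]: "x \<in> carrier AB" "x' \<in> carrier AB" "c \<in> carrier C"
  shows "T1 (c \<otimes>\<^bsub>[k|C,AB]\<^esub> (x \<otimes>\<^bsub>X1\<^esub> x')) =
    T1 (c \<otimes>\<^bsub>[k|C,AB]\<^esub> x) \<otimes>\<^bsub>E\<^esub> (x' \<otimes>\<^bsub>[k|AB,C]\<^esub> \<one>\<^bsub>C\<^esub>)" (is "?F x = ?G x")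
proof (rule R1.tensor_ext_AB[OF assms(1)])
  show "k_linear k AB ABC ?F" "k_linear k AB ABC ?G"
    by (rule lin | simp)+
  fix a b assume [simp]: "a \<in> carrier A" "b \<in> carrier B"
  let ?x = "a \<otimes>\<^bsub>[k|A,B]\<^esub> b"
  show "T1 (c \<otimes>\<^bsub>[k|C,AB]\<^esub> (?x \<otimes>\<^bsub>X1\<^esub> x')) = T1 (c \<otimes>\<^bsub>[k|C,AB]\<^esub> ?x) \<otimes>\<^bsub>E\<^esub> (x' \<otimes>\<^bsub>[k|AB,C]\<^esub> \<one>\<^bsub>C\<^esub>)"
    (is "?F x' = ?G x'")
  proof (rule R1.tensor_ext_AB[OF assms(2)])
    show "k_linear k AB ABC ?F" "k_linear k AB ABC ?G"
      by (rule lin | simp)+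
    fix a' b' assume [simp]: "a' \<in> carrier A" "b' \<in> carrier B"
    \<comment> \<open>Restores the outer factors: a multiplies from the left in \<open>A\<close>,
      and b' from the right in the twisted product of \<open>B\<close> and \<open>C\<close>.\<close>
    let ?M = "tensor_map k A BC (\<lambda>z. a \<otimes>\<^bsub>A\<^esub> z) (\<lambda>s. s \<otimes>\<^bsub>X2\<^esub> (b' \<otimes>\<^bsub>[k|B,C]\<^esub> \<one>\<^bsub>C\<^esub>))"
    \<comment> \<open>A common normal form for both sides of fact 5, the product of a r with s
      inside \<open>E\<close>. It is written with the product of \<open>E\<close>, whose
      associativity is not yet at hand.\<close>
    let ?V = "\<lambda>r s. (R1.lr a \<one>\<^bsub>B\<^esub> r \<otimes>\<^bsub>[k|AB,C]\<^esub> \<one>\<^bsub>C\<^esub>) \<otimes>\<^bsub>E\<^esub> al (\<one>\<^bsub>A\<^esub> \<otimes>\<^bsub>[k|A,BC]\<^esub> s)"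
    have M_lin: "k_linear k A A (\<lambda>z. a \<otimes>\<^bsub>A\<^esub> z)" "k_linear k BC BC (\<lambda>s. s \<otimes>\<^bsub>X2\<^esub> (b' \<otimes>\<^bsub>[k|B,C]\<^esub> \<one>\<^bsub>C\<^esub>))"
      by (rule lin | simp)+
    have M_pure [simp]: "?M (z \<otimes>\<^bsub>[k|A,BC]\<^esub> s) = (a \<otimes>\<^bsub>A\<^esub> z) \<otimes>\<^bsub>[k|A,BC]\<^esub> (s \<otimes>\<^bsub>X2\<^esub> (b' \<otimes>\<^bsub>[k|B,C]\<^esub> \<one>\<^bsub>C\<^esub>))"
      if "z \<in> carrier A" "s \<in> carrier BC" for z s
      by (rule tensor_map_pure) (simp_all add: M_lin that)
    have lr_R1: "R1.lr a u r = R1.lr a \<one>\<^bsub>B\<^esub> r \<otimes>\<^bsub>X1\<^esub> (\<one>\<^bsub>A\<^esub> \<otimes>\<^bsub>[k|A,B]\<^esub> u)" (is "?F r = ?G r")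
      if [simp]: "r \<in> carrier AB" "u \<in> carrier B" for r u
    proof (rule R1.tensor_ext_AB[OF that(1)])
      show "k_linear k AB AB ?F" "k_linear k AB AB ?G"
        by (rule lin | simp)+
    qed (simp add: R1.mult_pure R1.twist_unit_A R1.A.m_assoc)
    have lr_mult: "(R1.lr a \<one>\<^bsub>B\<^esub> r \<otimes>\<^bsub>[k|AB,C]\<^esub> \<one>\<^bsub>C\<^esub>) \<otimes>\<^bsub>E\<^esub> ((\<one>\<^bsub>A\<^esub> \<otimes>\<^bsub>[k|A,B]\<^esub> u) \<otimes>\<^bsub>[k|AB,C]\<^esub> v) =
        R1.lr a u r \<otimes>\<^bsub>[k|AB,C]\<^esub> v"
      if [simp]: "r \<in> carrier AB" "u \<in> carrier B" "v \<in> carrier C" for r u v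
      by (simp add: T.mult_pure T1_one lr_R1[symmetric])
    have V_pure: "?V r (u \<otimes>\<^bsub>[k|B,C]\<^esub> v) = R1.lr a u r \<otimes>\<^bsub>[k|AB,C]\<^esub> v"
      if "r \<in> carrier AB" "u \<in> carrier B" "v \<in> carrier C" for r u v
      using that by (simp add: lr_mult)
    \<comment> \<open>The factor b' comes out on the right because \<open>R\<^sub>2\<close> respects
      multiplication in \<open>B\<close>.\<close>
    have 1: "twist_past_C c (R1.lr a b' r) = ?M (twist_past_C c r)" (is "?F r = ?G r")
      if [simp]: "r \<in> carrier AB" for r
    proof (rule R1.tensor_ext_AB[OF that])
      show "k_linear k AB A_BC ?F" "k_linear k AB A_BC ?G"
        by (rule lin | simp)+
    qed (simp add: R2.R_mult_A)
    have 2: "T.lr (a \<otimes>\<^bsub>[k|A,B]\<^esub> y) \<one>\<^bsub>C\<^esub> (al (a' \<otimes>\<^bsub>[k|A,BC]\<^esub> s)) = ?V (R\<^sub>1 (y \<otimes>\<^bsub>[k|B,A]\<^esub> a')) s" (is "?F s = ?G s")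
      if [simp]: "s \<in> carrier BC" "y \<in> carrier B" for s y
    proof (rule R2.tensor_ext_AB[OF that(1)])
      show "k_linear k BC ABC ?F" "k_linear k BC ABC ?G"
        by (rule lin | simp)+
    qed (simp add: lr_mult R1.mult_pure)
    have 3: "al ((a \<otimes>\<^bsub>A\<^esub> z) \<otimes>\<^bsub>[k|A,BC]\<^esub> R2.lr y \<one>\<^bsub>C\<^esub> s) = ?V (z \<otimes>\<^bsub>[k|A,B]\<^esub> y) s" (is "?F s = ?G s")
      if [simp]: "s \<in> carrier BC" "z \<in> carrier A" "y \<in> carrier B" for s z y
    proof (rule R2.tensor_ext_AB[OF that(1)])
      show "k_linear k BC ABC ?F" "k_linear k BC ABC ?G"
        by (rule lin | simp)+
      show "?F (u \<otimes>\<^bsub>[k|B,C]\<^esub> v) = ?G (u \<otimes>\<^bsub>[k|B,C]\<^esub> v)" if [simp]: "u \<in> carrier B" "v \<in> carrier C" for u v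
        by (subst V_pure) simp_all
    qed
    have 4: "al (?M (ar (r \<otimes>\<^bsub>[k|AB,C]\<^esub> z))) = ?V r (R\<^sub>2 (z \<otimes>\<^bsub>[k|C,B]\<^esub> b'))" (is "?F r = ?G r")
      if [simp]: "r \<in> carrier AB" "z \<in> carrier C" for r z
    proof (rule R1.tensor_ext_AB[OF that(1)])
      show "k_linear k AB ABC ?F" "k_linear k AB ABC ?G"
        by (rule lin | simp)+
      show "?F (x \<otimes>\<^bsub>[k|A,B]\<^esub> y) = ?G (x \<otimes>\<^bsub>[k|A,B]\<^esub> y)" if [simp]: "x \<in> carrier A" "y \<in> carrier B" for x y
        by (simp add: R2.mult_pure 3 del: R1.lr_pure)
    qed
    \<comment> \<open>For s = y \<otimes> z both sides become \<open>?V\<close> at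
      \<open>R\<^sub>1 (y \<otimes> a')\<close> and \<open>R\<^sub>2 (z \<otimes> b')\<close>, by
      facts 4 and 2.\<close>
    have 5: "al (?M (twist_past_A a' s)) = al (a \<otimes>\<^bsub>[k|A,BC]\<^esub> s) \<otimes>\<^bsub>E\<^esub> ((a' \<otimes>\<^bsub>[k|A,B]\<^esub> b') \<otimes>\<^bsub>[k|AB,C]\<^esub> \<one>\<^bsub>C\<^esub>)"
      (is "?F s = ?G s") if [simp]: "s \<in> carrier BC" for s
    proof (rule R2.tensor_ext_AB[OF that(1)])
      show "k_linear k BC ABC ?F" "k_linear k BC ABC ?G"
        by (rule lin | simp)+
    qed (simp add: T.mult_pure T1_pure 2 4)
    have "twist_past_C c (R\<^sub>1 (b \<otimes>\<^bsub>[k|B,A]\<^esub> a')) = twist_past_A a' (R\<^sub>2 (c \<otimes>\<^bsub>[k|C,B]\<^esub> b))"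
      using hexagon by (simp add: hexagon_iff)
    then show "T1 (c \<otimes>\<^bsub>[k|C,AB]\<^esub> (?x \<otimes>\<^bsub>X1\<^esub> (a' \<otimes>\<^bsub>[k|A,B]\<^esub> b'))) =
        T1 (c \<otimes>\<^bsub>[k|C,AB]\<^esub> ?x) \<otimes>\<^bsub>E\<^esub> ((a' \<otimes>\<^bsub>[k|A,B]\<^esub> b') \<otimes>\<^bsub>[k|AB,C]\<^esub> \<one>\<^bsub>C\<^esub>)"
      by (simp add: R1.mult_pure T1_pure 1 5)
  qed
qed

lemma T1_twisting: "unital_twisting_map k X1 C T1"
  by (rule T.unital_twisting_mapI) (simp_all add: T1_mult_AB T1_mult_C T1_one T1_unit)

lemma E_alg [simp]: "assoc_algebra k E"
  using T1_twisting by (rule unital_twisting_map.assoc_algebra_twisted_product)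

definition jAB :: "('a, 'b) tensor \<Rightarrow> (('a, 'b) tensor, 'c) tensor"
  where "jAB r = r \<otimes>\<^bsub>[k|AB,C]\<^esub> \<one>\<^bsub>C\<^esub>"

text \<open>Since \<open>E\<close> is bracketed as (A \<otimes> B) \<otimes> C, this embedding is
  not one of the two inclusions of a twisted product, and its multiplicativity needs an argument of
  its own (\<open>jBC_hom\<close>).\<close>

definition jBC :: "('b, 'c) tensor \<Rightarrow> (('a, 'b) tensor, 'c) tensor"
  where "jBC s = al (\<one>\<^bsub>A\<^esub> \<otimes>\<^bsub>[k|A,BC]\<^esub> s)"

lemma jAB_hom: "algebra_hom k X1 E jAB"
  using unital_twisting_map.incl_A_hom[OF T1_twisting] by (simp add: jAB_def[abs_def])

lemma jBC_linear: "k_linear k BC ABC jBC"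
  unfolding jBC_def[abs_def] by (rule lin | simp)+

lemma j_closed [simp]:
  "r \<in> carrier AB \<Longrightarrow> jAB r \<in> carrier ABC" "s \<in> carrier BC \<Longrightarrow> jBC s \<in> carrier ABC"
  by (simp_all add: jAB_def jBC_def)

lemma E_assoc:
  "\<lbrakk>s \<in> carrier ABC; t \<in> carrier ABC; u \<in> carrier ABC\<rbrakk> \<Longrightarrow> s \<otimes>\<^bsub>E\<^esub> t \<otimes>\<^bsub>E\<^esub> u = s \<otimes>\<^bsub>E\<^esub> (t \<otimes>\<^bsub>E\<^esub> u)"
  using unital_twisting_map.mult_assoc[OF T1_twisting] by simp

lemma jAB_mult_jBC:
  assumes [simp]: "r \<in> carrier AB" "b \<in> carrier B" "c \<in> carrier C"
  shows "jAB r \<otimes>\<^bsub>E\<^esub> jBC (b \<otimes>\<^bsub>[k|B,C]\<^esub> c) =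
    (r \<otimes>\<^bsub>X1\<^esub> (\<one>\<^bsub>A\<^esub> \<otimes>\<^bsub>[k|A,B]\<^esub> b)) \<otimes>\<^bsub>[k|AB,C]\<^esub> c"
  by (simp add: jAB_def jBC_def T.mult_pure T1_one)

lemma jBC_one:
  assumes [simp]: "b \<in> carrier B"
  shows "jBC (b \<otimes>\<^bsub>[k|B,C]\<^esub> \<one>\<^bsub>C\<^esub>) = jAB (\<one>\<^bsub>A\<^esub> \<otimes>\<^bsub>[k|A,B]\<^esub> b)"
  by (simp add: jAB_def jBC_def)

text \<open>The flip lets c pass a unchanged, so only b is twisted; both sides are a \<otimes>
  \<open>R\<^sub>2 (c \<otimes> b)\<close> rebracketed.\<close>

lemma jBC_mult_jAB_pure:
  assumes [simp]: "a \<in> carrier A" "b \<in> carrier B" "c \<in> carrier C"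
  shows "jBC (\<one>\<^bsub>B\<^esub> \<otimes>\<^bsub>[k|B,C]\<^esub> c) \<otimes>\<^bsub>E\<^esub> jAB (a \<otimes>\<^bsub>[k|A,B]\<^esub> b) =
    jAB (a \<otimes>\<^bsub>[k|A,B]\<^esub> \<one>\<^bsub>B\<^esub>) \<otimes>\<^bsub>E\<^esub> jBC (R\<^sub>2 (c \<otimes>\<^bsub>[k|C,B]\<^esub> b))"
proof -
  have 1: "jAB (a \<otimes>\<^bsub>[k|A,B]\<^esub> \<one>\<^bsub>B\<^esub>) \<otimes>\<^bsub>E\<^esub> jBC s = al (a \<otimes>\<^bsub>[k|A,BC]\<^esub> s)" (is "?F s = ?G s")
    if "s \<in> carrier BC" for s
  proof (rule R2.tensor_ext_AB[OF that])
    show "k_linear k BC ABC ?F" "k_linear k BC ABC ?G"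
      by (rule k_linear_comp[OF jBC_linear] lin | simp)+
  qed (simp add: jAB_mult_jBC R1.incl_mult)
  have 2: "T.lr (\<one>\<^bsub>A\<^esub> \<otimes>\<^bsub>[k|A,B]\<^esub> \<one>\<^bsub>B\<^esub>) \<one>\<^bsub>C\<^esub> t = t" if "t \<in> carrier ABC" for t
    using T.lr_one that by simp
  show ?thesis
    by (simp add: 1) (simp add: jAB_def jBC_def T.mult_pure T1_pure 2)
qed

text \<open>\<open>E\<close> receives algebra maps from \<open>B\<close> and \<open>C\<close> that
  satisfy the exchange relation for \<open>R\<^sub>2\<close>. Their product map is therefore
  multiplicative on \<open>X2\<close>, and it coincides with \<open>jBC\<close>.\<close>

lemma jBC_hom: "algebra_hom k X2 E jBC"
proof -
  let ?fB = "\<lambda>b. jAB (\<one>\<^bsub>A\<^esub> \<otimes>\<^bsub>[k|A,B]\<^esub> b)" and ?fC = "\<lambda>c. jBC (\<one>\<^bsub>B\<^esub> \<otimes>\<^bsub>[k|B,C]\<^esub> c)"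
  have fB: "algebra_hom k B E ?fB"
    by (rule algebra_hom_comp[OF jAB_hom R1.incl_B_hom])
  have fC: "algebra_hom k C E ?fC"
    using unital_twisting_map.incl_B_hom[OF T1_twisting] algebra_hom_def[of k C E ?fC]
      algebra_hom_def[of k C E "\<lambda>c. (\<one>\<^bsub>A\<^esub> \<otimes>\<^bsub>[k|A,B]\<^esub> \<one>\<^bsub>B\<^esub>) \<otimes>\<^bsub>[k|AB,C]\<^esub> c"]
      k_linear_cong[OF mods(3), of ?fC "\<lambda>c. (\<one>\<^bsub>A\<^esub> \<otimes>\<^bsub>[k|A,B]\<^esub> \<one>\<^bsub>B\<^esub>) \<otimes>\<^bsub>[k|AB,C]\<^esub> c" ABC]
    by (simp add: jBC_def)
  have pm: "prod_map E ?fB ?fC s = jBC s" (is "?F s = ?G s") if "s \<in> carrier BC" for s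
  proof (rule R2.tensor_ext_AB[OF that])
    note pm = prod_map_linear[OF mods(2,3) E_alg algebra_homD(1)[OF fB] algebra_homD(1)[OF fC]]
    show "k_linear k BC ABC ?F" "k_linear k BC ABC ?G"
      using pm(1) jBC_linear by simp_all
    show "?F (x \<otimes>\<^bsub>[k|B,C]\<^esub> y) = ?G (x \<otimes>\<^bsub>[k|B,C]\<^esub> y)" if [simp]: "x \<in> carrier B" "y \<in> carrier C" for x y
      by (simp add: pm(2) jAB_mult_jBC R1.mult_one) (simp add: jBC_def)
  qed
  have "algebra_hom k X2 E (prod_map E ?fB ?fC)"
  proof (rule R2.prod_map_hom[OF E_alg fB fC])
    fix b c assume [simp]: "b \<in> carrier B" "c \<in> carrier C"
    \<comment> \<open>At a = 1 the left factor on the right side of \<open>jBC_mult_jAB_pure\<close>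
      is the unit of \<open>E\<close>.\<close>
    have "jAB (\<one>\<^bsub>A\<^esub> \<otimes>\<^bsub>[k|A,B]\<^esub> \<one>\<^bsub>B\<^esub>) \<otimes>\<^bsub>E\<^esub> jBC s = jBC s" if "s \<in> carrier BC" for s
      using unital_twisting_map.mult_one(1)[OF T1_twisting, of "jBC s"] that by (simp add: jAB_def)
    then show "prod_map E ?fB ?fC (R\<^sub>2 (c \<otimes>\<^bsub>[k|C,B]\<^esub> b)) = ?fC c \<otimes>\<^bsub>E\<^esub> ?fB b"
      by (simp add: pm jBC_mult_jAB_pure)
  qed
  then show ?thesis
    using k_linear_cong[OF R2.mods(3), of "prod_map E ?fB ?fC" jBC ABC]
    by (simp add: algebra_hom_def pm)
qed

text \<open>In \<open>E\<close> the product b' c a b equals b' a c b; the pairs b' a and c b are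
  rewritten by \<open>R\<^sub>1\<close> and \<open>R\<^sub>2\<close>. This yields the twisted side
  of the third compatibility condition.\<close>

lemma jBC_mult_jAB:
  assumes [simp]: "a \<in> carrier A" "b \<in> carrier B" "b' \<in> carrier B" "c \<in> carrier C"
  shows "jBC (b' \<otimes>\<^bsub>[k|B,C]\<^esub> c) \<otimes>\<^bsub>E\<^esub> jAB (a \<otimes>\<^bsub>[k|A,B]\<^esub> b) =
    jAB (R\<^sub>1 (b' \<otimes>\<^bsub>[k|B,A]\<^esub> a)) \<otimes>\<^bsub>E\<^esub> jBC (R\<^sub>2 (c \<otimes>\<^bsub>[k|C,B]\<^esub> b))"
proof -
  have "jBC (b' \<otimes>\<^bsub>[k|B,C]\<^esub> c) = jAB (\<one>\<^bsub>A\<^esub> \<otimes>\<^bsub>[k|A,B]\<^esub> b') \<otimes>\<^bsub>E\<^esub> jBC (\<one>\<^bsub>B\<^esub> \<otimes>\<^bsub>[k|B,C]\<^esub> c)"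
    using algebra_homD(4)[OF jBC_hom, of "b' \<otimes>\<^bsub>[k|B,C]\<^esub> \<one>\<^bsub>C\<^esub>" "\<one>\<^bsub>B\<^esub> \<otimes>\<^bsub>[k|B,C]\<^esub> c"]
    by (simp add: R2.incl_mult jBC_one)
  moreover have "jAB (R\<^sub>1 (b' \<otimes>\<^bsub>[k|B,A]\<^esub> a)) =
      jAB (\<one>\<^bsub>A\<^esub> \<otimes>\<^bsub>[k|A,B]\<^esub> b') \<otimes>\<^bsub>E\<^esub> jAB (a \<otimes>\<^bsub>[k|A,B]\<^esub> \<one>\<^bsub>B\<^esub>)"
    using algebra_homD(4)[OF jAB_hom, of "\<one>\<^bsub>A\<^esub> \<otimes>\<^bsub>[k|A,B]\<^esub> b'" "a \<otimes>\<^bsub>[k|A,B]\<^esub> \<one>\<^bsub>B\<^esub>"]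
    by (simp add: R1.incl_mult)
  ultimately show ?thesis
    by (simp add: E_assoc jBC_mult_jAB_pure)
qed

end

section \<open>Left deformation data\<close>

lemma deformed_algebra_simps [simp]:
  "carrier (left_deformed_algebra k A B \<mu> \<rho>) = carrier A"
  "add (left_deformed_algebra k A B \<mu> \<rho>) = add A"
  "ring.zero (left_deformed_algebra k A B \<mu> \<rho>) = ring.zero A"
  "smult (left_deformed_algebra k A B \<mu> \<rho>) = smult A"
  "\<one>\<^bsub>left_deformed_algebra k A B \<mu> \<rho>\<^esub> = \<one>\<^bsub>A\<^esub>"
  "a \<otimes>\<^bsub>left_deformed_algebra k A B \<mu> \<rho>\<^esub> a' = left_star k A B \<mu> \<rho> a a'"
  "carrier (right_deformed_algebra k B C \<nu> \<theta>) = carrier C"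
  "add (right_deformed_algebra k B C \<nu> \<theta>) = add C"
  "ring.zero (right_deformed_algebra k B C \<nu> \<theta>) = ring.zero C"
  "smult (right_deformed_algebra k B C \<nu> \<theta>) = smult C"
  "\<one>\<^bsub>right_deformed_algebra k B C \<nu> \<theta>\<^esub> = \<one>\<^bsub>C\<^esub>"
  "c \<otimes>\<^bsub>right_deformed_algebra k B C \<nu> \<theta>\<^esub> c' = right_star k B C \<nu> \<theta> c c'"
  by (simp_all add: left_deformed_algebra_def right_deformed_algebra_def)

lemma tensor_deformed_algebra [simp]:
  "left_deformed_algebra k A B \<mu> \<rho> \<boxtimes>\<^bsub>k\<^esub> M = A \<boxtimes>\<^bsub>k\<^esub> M"
  "M \<boxtimes>\<^bsub>k\<^esub> left_deformed_algebra k A B \<mu> \<rho> = M \<boxtimes>\<^bsub>k\<^esub> A"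
  "x \<otimes>\<^bsub>[k|left_deformed_algebra k A B \<mu> \<rho>,M]\<^esub> y = x \<otimes>\<^bsub>[k|A,M]\<^esub> y"
  "y \<otimes>\<^bsub>[k|M,left_deformed_algebra k A B \<mu> \<rho>]\<^esub> x = y \<otimes>\<^bsub>[k|M,A]\<^esub> x"
  "right_deformed_algebra k B C \<nu> \<theta> \<boxtimes>\<^bsub>k\<^esub> N = C \<boxtimes>\<^bsub>k\<^esub> N"
  "N \<boxtimes>\<^bsub>k\<^esub> right_deformed_algebra k B C \<nu> \<theta> = N \<boxtimes>\<^bsub>k\<^esub> C"
  "z \<otimes>\<^bsub>[k|right_deformed_algebra k B C \<nu> \<theta>,N]\<^esub> w = z \<otimes>\<^bsub>[k|C,N]\<^esub> w"
  "w \<otimes>\<^bsub>[k|N,right_deformed_algebra k B C \<nu> \<theta>]\<^esub> z = w \<otimes>\<^bsub>[k|N,C]\<^esub> z"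
  by (rule tensor_product_cong; simp)+

lemma k_linear_deformed_algebra [simp]:
  "k_linear k (left_deformed_algebra k' A B \<mu> \<rho>) M f \<longleftrightarrow> k_linear k A M f"
  "k_linear k (right_deformed_algebra k' B C \<nu> \<theta>) N g \<longleftrightarrow> k_linear k C N g"
  by (simp_all add: k_linear_def)

context left_deformation_datum
begin

lemmas [simp] = mods algs R_closed linear_mu linear_rho linear_lambda

lemmas datum_closed [simp] = k_linearD(1)[OF linear_mu] k_linearD(1)[OF linear_rho] k_linearD(1)[OF linear_lambda]

abbreviation star (infixl \<open>\<star>\<close> 70) where "a \<star> a' \<equiv> left_star k A B \<mu> \<rho> a a'"
abbreviation Ad where "Ad \<equiv> left_deformed_algebra k A B \<mu> \<rho>"
abbreviation iB where "iB b \<equiv> \<one>\<^bsub>A\<^esub> \<oslash> b"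

text \<open>The factorization map a \<otimes> b -> \<rho>(a) b, in components
  \<open>a0 \<otimes> a1 b\<close>. Written as a product in \<open>X\<close>, it is visibly
  compatible with right multiplication by \<open>B\<close>.\<close>

definition deform :: "('a, 'b) tensor \<Rightarrow> ('a, 'b) tensor"
  where "deform = prod_map X \<rho> iB"

definition undeform :: "('a, 'b) tensor \<Rightarrow> ('a, 'b) tensor"
  where "undeform = prod_map X \<Lambda> iB"

lemma X_alg [simp]: "assoc_algebra k X"
  by (rule assoc_algebra_twisted_product)

lemma iB_linear [simp]: "k_linear k B AB iB"
  using algebra_homD(1)[OF incl_B_hom] by simp

lemma pure_mult_iB:
  "\<lbrakk>a \<in> carrier A; b \<in> carrier B; b' \<in> carrier B\<rbrakk> \<Longrightarrow> (a \<oslash> b) \<otimes>\<^bsub>X\<^esub> iB b' = a \<oslash> (b \<otimes>\<^bsub>B\<^esub> b')"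
  by (simp add: mult_pure twist_unit_A)

lemma deform:
  shows deform_linear [simp]: "k_linear k AB AB deform"
    and deform_pure [simp]: "\<lbrakk>a \<in> carrier A; b \<in> carrier B\<rbrakk> \<Longrightarrow> deform (a \<oslash> b) = \<rho> a \<otimes>\<^bsub>X\<^esub> iB b"
    and undeform_linear [simp]: "k_linear k AB AB undeform"
    and undeform_pure [simp]: "\<lbrakk>a \<in> carrier A; b \<in> carrier B\<rbrakk> \<Longrightarrow> undeform (a \<oslash> b) = \<Lambda> a \<otimes>\<^bsub>X\<^esub> iB b"
  using prod_map_linear[OF mods(1,2) X_alg, of \<rho> iB] prod_map_linear[OF mods(1,2) X_alg, of \<Lambda> iB]
  by (simp_all add: deform_def undeform_def)

lemmas deform_closed [simp] = k_linearD(1)[OF deform_linear] k_linearD(1)[OF undeform_linear]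

lemmas lin_d = k_linear_comp[OF linear_rho] k_linear_comp[OF linear_lambda] k_linear_comp[OF linear_mu]
  k_linear_comp[OF deform_linear] k_linear_comp[OF undeform_linear] lin

text \<open>Right \<open>B\<close>-linearity is associativity of \<open>X\<close>. It reduces
  statements about these maps to tensors a \<otimes> 1.\<close>

lemma deform_iB:
  assumes [simp]: "t \<in> carrier AB" "b \<in> carrier B"
  shows "deform (t \<otimes>\<^bsub>X\<^esub> iB b) = deform t \<otimes>\<^bsub>X\<^esub> iB b" (is "?F t = ?G t")
    and "undeform (t \<otimes>\<^bsub>X\<^esub> iB b) = undeform t \<otimes>\<^bsub>X\<^esub> iB b" (is "?F' t = ?G' t")
proof -
  show "?F t = ?G t"
  proof (rule tensor_ext_AB[OF assms(1)])
    show "k_linear k AB AB ?F" "k_linear k AB AB ?G"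
      by (rule lin_d | simp)+
  qed (simp add: pure_mult_iB mult_assoc)
  show "?F' t = ?G' t"
  proof (rule tensor_ext_AB[OF assms(1)])
    show "k_linear k AB AB ?F'" "k_linear k AB AB ?G'"
      by (rule lin_d | simp)+
  qed (simp add: pure_mult_iB mult_assoc)
qed

text \<open>The two inversion axioms of the datum in disguise: their inner sums are right
  multiplications by elements of \<open>B\<close>, so the outer sums are values of
  \<open>undeform\<close> and \<open>deform\<close>.\<close>

lemma undeform_rho:
  assumes [simp]: "a \<in> carrier A"
  shows "undeform (\<rho> a) = a \<oslash> \<one>\<^bsub>B\<^esub>" and deform_lambda: "deform (\<Lambda> a) = a \<oslash> \<one>\<^bsub>B\<^esub>"
proof -
  have inner: "sweedler AB s (\<lambda>x y. x \<oslash> (y \<otimes>\<^bsub>B\<^esub> b)) = s \<otimes>\<^bsub>X\<^esub> iB b"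
    if [simp]: "s \<in> carrier AB" "b \<in> carrier B" for s b
  proof (rule sweedler_eqI[OF mods(1-3) _ that(1)])
    show "k_linear k AB AB (\<lambda>s. s \<otimes>\<^bsub>X\<^esub> iB b)"
      by (rule lin | simp)+
  qed (simp add: pure_mult_iB)
  have "undeform (\<rho> a) = sweedler AB (\<rho> a) (\<lambda>a0 a1. sweedler AB (\<Lambda> a0) (\<lambda>x y. x \<oslash> (y \<otimes>\<^bsub>B\<^esub> a1)))"
    by (rule sweedler_eqI[symmetric, OF mods(1-3)]) (simp_all add: inner)
  then show "undeform (\<rho> a) = a \<oslash> \<one>\<^bsub>B\<^esub>"
    using rho_lambda by simp
  have "deform (\<Lambda> a) = sweedler AB (\<Lambda> a) (\<lambda>a0 a1. sweedler AB (\<rho> a0) (\<lambda>x y. x \<oslash> (y \<otimes>\<^bsub>B\<^esub> a1)))"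
    by (rule sweedler_eqI[symmetric, OF mods(1-3)]) (simp_all add: inner)
  then show "deform (\<Lambda> a) = a \<oslash> \<one>\<^bsub>B\<^esub>"
    using lambda_rho by simp
qed

text \<open>On a \<otimes> b = (a \<otimes> 1)(1 \<otimes> b) the second factor can be pulled out by
  \<open>B\<close>-linearity, and \<open>undeform_rho\<close> or \<open>deform_lambda\<close>
  settles the first.\<close>

lemma undeform_deform:
  assumes [simp]: "t \<in> carrier AB"
  shows "undeform (deform t) = t" (is "?F t = ?I t") and "deform (undeform t) = t" (is "?G t = _")
proof -
  show "?F t = ?I t"
  proof (rule tensor_ext_AB[OF assms(1)])
    show "k_linear k AB AB ?F" "k_linear k AB AB ?I"
      by (rule lin_d | simp)+
  qed (simp add: deform_iB undeform_rho incl_mult)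
  show "?G t = ?I t"
  proof (rule tensor_ext_AB[OF assms(1)])
    show "k_linear k AB AB ?G" "k_linear k AB AB ?I"
      by (rule lin_d | simp)+
  qed (simp add: deform_iB deform_lambda incl_mult)
qed

lemma star_bilinear: "k_bilinear k A A A (\<star>)"
proof -
  have *: "k_bilinear k A B A (\<lambda>a0 a1. a0 \<otimes>\<^bsub>A\<^esub> \<mu> (a1 \<otimes>\<^bsub>[k|B,A]\<^esub> a'))" if [simp]: "a' \<in> carrier A" for a'
    by (rule k_bilinearI) (rule lin_d | simp)+
  show ?thesis
  proof (rule k_bilinearI)
    show "k_linear k A A ((\<star>) a)" if "a \<in> carrier A" for a
      unfolding left_star_def[abs_def]
    proof (rule sweedler_param_linear[where M = A and N = B])
      show "k_linear k A A (\<lambda>a'. a0 \<otimes>\<^bsub>A\<^esub> \<mu> (a1 \<otimes>\<^bsub>[k|B,A]\<^esub> a'))" if [simp]: "a0 \<in> carrier A" "a1 \<in> carrier B" for a0 a1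
        by (rule lin_d | simp)+
    qed (simp_all add: * that)
    show "k_linear k A A (\<lambda>a. a \<star> a')" if "a' \<in> carrier A" for a'
      unfolding left_star_def
      by (rule k_linear_comp[OF sweedler_linear[OF mods(1,2,1) *[OF that]] linear_rho])
  qed
qed

lemmas star_closed [simp] = k_bilinearD(3)[OF star_bilinear]

text \<open>The right side of the axiom \<open>rho_star\<close> is the product of \<open>X\<close>
  written out.\<close>

lemma rho_mult: "\<lbrakk>a \<in> carrier A; a' \<in> carrier A\<rbrakk> \<Longrightarrow> \<rho> (a \<star> a') = \<rho> a \<otimes>\<^bsub>X\<^esub> \<rho> a'"
  by (simp add: rho_star twisted_product_def)

text \<open>Injectivity of \<open>\<rho>\<close> needs the axiom \<open>a\<^sub>0 (a\<^sub>1 \<cdot> 1) = a\<close>; it does not follow from bijectivity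
  of \<open>deform\<close>, since \<open>a \<mapsto> a \<otimes> 1\<close> need not be injective over a ring.\<close>

lemma rho_inj: "\<lbrakk>a \<in> carrier A; a' \<in> carrier A; \<rho> a = \<rho> a'\<rbrakk> \<Longrightarrow> a = a'"
  by (metis act_one)

text \<open>Associativity and unit laws are inherited from \<open>X\<close> through the injective
  multiplicative map \<rho>, without calculating with \<mu>.\<close>

lemma Ad_alg [simp]: "assoc_algebra k Ad"
proof (rule assoc_algebraI)
  show "module k Ad"
    using mods(1) module_cong[of Ad A k] by simp
  show "k_bilinear k Ad Ad Ad (mult Ad)"
    using star_bilinear by (simp add: k_bilinear_def k_linear_def)
  show "x \<otimes>\<^bsub>Ad\<^esub> y \<otimes>\<^bsub>Ad\<^esub> z = x \<otimes>\<^bsub>Ad\<^esub> (y \<otimes>\<^bsub>Ad\<^esub> z)"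
    if "x \<in> carrier Ad" "y \<in> carrier Ad" "z \<in> carrier Ad" for x y z
    using that by (intro rho_inj) (simp_all add: rho_mult mult_assoc)
  show "\<one>\<^bsub>Ad\<^esub> \<otimes>\<^bsub>Ad\<^esub> x = x" "x \<otimes>\<^bsub>Ad\<^esub> \<one>\<^bsub>Ad\<^esub> = x" if "x \<in> carrier Ad" for x
    using that by (auto intro!: rho_inj simp: rho_mult rho_one mult_one)
qed simp

lemma rho_hom: "algebra_hom k Ad X \<rho>"
  by (rule algebra_homI) (simp_all add: rho_mult rho_one)

abbreviation Rd where "Rd \<equiv> left_deformed_twist k A B R \<rho> \<Lambda>"

text \<open>From the inside out: the sum over \<Lambda> with the following factor from
  \<open>B\<close> is a value of \<open>undeform\<close>, the sum over \<open>R\<close> is left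
  multiplication by \<open>iB b\<close>, and \<open>a1\<close> is absorbed by right
  \<open>B\<close>-linearity. What remains is \<open>undeform\<close> of b \<rho>(a).\<close>

lemma Rd_eq:
  assumes t: "t \<in> carrier (B \<boxtimes>\<^bsub>k\<^esub> A)"
  shows "Rd t = undeform (prod_map X iB \<rho> t)"
proof -
  note pm = prod_map_linear[OF mods(2,1) X_alg, of iB \<rho>, simplified]
  have 1: "sweedler AB s (\<lambda>x y. x \<oslash> (y \<otimes>\<^bsub>B\<^esub> b \<otimes>\<^bsub>B\<^esub> a1)) = s \<otimes>\<^bsub>X\<^esub> iB b \<otimes>\<^bsub>X\<^esub> iB a1"
    if [simp]: "s \<in> carrier AB" "b \<in> carrier B" "a1 \<in> carrier B" for s b a1
  proof (rule sweedler_eqI[OF mods(1-3) _ that(1)])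
    show "k_linear k AB AB (\<lambda>s. s \<otimes>\<^bsub>X\<^esub> iB b \<otimes>\<^bsub>X\<^esub> iB a1)"
      by (rule lin | simp)+
  qed (simp add: pure_mult_iB)
  have 2: "sweedler AB s (\<lambda>x y. sweedler AB (\<Lambda> x) (\<lambda>u v. u \<oslash> (v \<otimes>\<^bsub>B\<^esub> y \<otimes>\<^bsub>B\<^esub> a1))) = undeform s \<otimes>\<^bsub>X\<^esub> iB a1"
    if [simp]: "s \<in> carrier AB" "a1 \<in> carrier B" for s a1
  proof (rule sweedler_eqI[OF mods(1-3) _ that(1)])
    show "k_linear k AB AB (\<lambda>s. undeform s \<otimes>\<^bsub>X\<^esub> iB a1)"
      by (rule lin_d | simp)+
  qed (simp add: 1)
  have 3: "sweedler AB s (\<lambda>a0 a1. sweedler AB (R (b \<otimes>\<^bsub>[k|B,A]\<^esub> a0)) (\<lambda>x y.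
      sweedler AB (\<Lambda> x) (\<lambda>u v. u \<oslash> (v \<otimes>\<^bsub>B\<^esub> y \<otimes>\<^bsub>B\<^esub> a1)))) = undeform (iB b \<otimes>\<^bsub>X\<^esub> s)"
    if [simp]: "s \<in> carrier AB" "b \<in> carrier B" for s b
  proof (rule sweedler_eqI[OF mods(1-3) _ that(1)])
    show "k_linear k AB AB (\<lambda>s. undeform (iB b \<otimes>\<^bsub>X\<^esub> s))"
      by (rule lin_d | simp)+
    fix x y assume [simp]: "x \<in> carrier A" "y \<in> carrier B"
    have "iB b \<otimes>\<^bsub>X\<^esub> (x \<oslash> y) = iB b \<otimes>\<^bsub>X\<^esub> ((x \<oslash> \<one>\<^bsub>B\<^esub>) \<otimes>\<^bsub>X\<^esub> iB y)"
      by (simp add: incl_mult(1))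
    also have "\<dots> = iB b \<otimes>\<^bsub>X\<^esub> (x \<oslash> \<one>\<^bsub>B\<^esub>) \<otimes>\<^bsub>X\<^esub> iB y"
      by (rule mult_assoc[symmetric]) simp_all
    also have "\<dots> = R (b \<otimes>\<^bsub>[k|B,A]\<^esub> x) \<otimes>\<^bsub>X\<^esub> iB y"
      by (simp add: incl_mult(2))
    finally have "iB b \<otimes>\<^bsub>X\<^esub> (x \<oslash> y) = R (b \<otimes>\<^bsub>[k|B,A]\<^esub> x) \<otimes>\<^bsub>X\<^esub> iB y" .
    then show "sweedler AB (R (b \<otimes>\<^bsub>[k|B,A]\<^esub> x)) (\<lambda>x' y'.
      sweedler AB (\<Lambda> x') (\<lambda>u v. u \<oslash> (v \<otimes>\<^bsub>B\<^esub> y' \<otimes>\<^bsub>B\<^esub> y))) = undeform (iB b \<otimes>\<^bsub>X\<^esub> (x \<oslash> y))"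
      by (simp add: 2 deform_iB)
  qed
  show ?thesis
    unfolding left_deformed_twist_def
  proof (rule sweedler_eqI[OF mods(2,1,3) _ t])
    show "k_linear k (B \<boxtimes>\<^bsub>k\<^esub> A) AB (\<lambda>t. undeform (prod_map X iB \<rho> t))"
      by (rule k_linear_comp[OF undeform_linear pm(1)])
  qed (simp add: 3 pm(2))
qed

lemma Rd_linear [simp]: "k_linear k (B \<boxtimes>\<^bsub>k\<^esub> A) AB Rd"
proof -
  have "k_linear k (B \<boxtimes>\<^bsub>k\<^esub> A) AB (\<lambda>t. undeform (prod_map X iB \<rho> t))"
    using prod_map_linear(1)[OF mods(2,1) X_alg, of iB \<rho>] by (intro k_linear_comp[OF undeform_linear]) simp
  then show ?thesis
    using k_linear_cong[OF mods(4), of Rd "\<lambda>t. undeform (prod_map X iB \<rho> t)" AB] Rd_eq by simp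
qed

text \<open>The exchange relation of the factorization; as \<open>deform\<close> is injective, it
  determines \<open>Rd\<close>.\<close>

lemma deform_Rd: "\<lbrakk>a \<in> carrier A; b \<in> carrier B\<rbrakk> \<Longrightarrow> deform (Rd (b \<otimes>\<^bsub>[k|B,A]\<^esub> a)) = iB b \<otimes>\<^bsub>X\<^esub> \<rho> a"
  using prod_map_linear(2)[OF mods(2,1) X_alg, of iB \<rho>] by (simp add: Rd_eq undeform_deform)

lemma linear_twist_Rd: "linear_twist k Ad B Rd"
  by (simp add: linear_twist_def linear_twist_axioms_def)

lemma unital_twisting_map_Rd: "unital_twisting_map k Ad B Rd"
proof -
  interpret d: linear_twist k Ad B Rd
    by (rule linear_twist_Rd)
  show ?thesis
  proof (rule d.unital_twisting_map_factorization[OF X_alg rho_hom incl_B_hom])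
    show "prod_map X \<rho> iB (Rd (b \<otimes>\<^bsub>[k|B,Ad]\<^esub> a)) = iB b \<otimes>\<^bsub>X\<^esub> \<rho> a" if "a \<in> carrier Ad" "b \<in> carrier B" for a b
      using that deform_Rd by (simp add: deform_def)
    show "inj_on (prod_map X \<rho> iB) (carrier d.AB)"
      by (rule inj_on_inverseI[of _ undeform]) (simp add: undeform_deform flip: deform_def)
  qed
qed

end

section \<open>Right deformation data\<close>

context right_deformation_datum
begin

lemmas [simp] = mods algs R_closed linear_nu linear_theta linear_gamma

lemmas datum_closed [simp] = k_linearD(1)[OF linear_nu] k_linearD(1)[OF linear_theta] k_linearD(1)[OF linear_gamma]

abbreviation pure_BC (infix \<open>\<oslash>\<close> 66) where "b \<oslash> c \<equiv> b \<otimes>\<^bsub>[k|B,C]\<^esub> c"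
abbreviation star (infixl \<open>\<star>\<close> 70) where "c \<star> c' \<equiv> right_star k B C \<nu> \<theta> c c'"
abbreviation dC where "dC \<equiv> right_deformed_algebra k B C \<nu> \<theta>"
abbreviation iB where "iB b \<equiv> b \<oslash> \<one>\<^bsub>C\<^esub>"

text \<open>The inherited names \<open>AB\<close> and \<open>X\<close> now denote B \<otimes> C and
  its twisted product, and \<open>B\<close> multiplies from the left. The map is the factorization b
  \<otimes> c -> b \<theta>(c) through \<open>B\<close> and the deformed algebra.\<close>

definition deform :: "('b, 'c) tensor \<Rightarrow> ('b, 'c) tensor"
  where "deform = prod_map X iB \<theta>"

definition undeform :: "('b, 'c) tensor \<Rightarrow> ('b, 'c) tensor"
  where "undeform = prod_map X iB \<gamma>"

lemma X_alg [simp]: "assoc_algebra k X"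
  by (rule assoc_algebra_twisted_product)

lemma iB_linear [simp]: "k_linear k B AB iB"
  using algebra_homD(1)[OF incl_A_hom] by simp

lemma iB_mult_pure:
  "\<lbrakk>b \<in> carrier B; b' \<in> carrier B; c \<in> carrier C\<rbrakk> \<Longrightarrow> iB b \<otimes>\<^bsub>X\<^esub> (b' \<oslash> c) = (b \<otimes>\<^bsub>B\<^esub> b') \<oslash> c"
  by (simp add: mult_pure twist_unit_B)

lemma deform:
  shows deform_linear [simp]: "k_linear k AB AB deform"
    and deform_pure [simp]: "\<lbrakk>b \<in> carrier B; c \<in> carrier C\<rbrakk> \<Longrightarrow> deform (b \<oslash> c) = iB b \<otimes>\<^bsub>X\<^esub> \<theta> c"
    and undeform_linear [simp]: "k_linear k AB AB undeform"
    and undeform_pure [simp]: "\<lbrakk>b \<in> carrier B; c \<in> carrier C\<rbrakk> \<Longrightarrow> undeform (b \<oslash> c) = iB b \<otimes>\<^bsub>X\<^esub> \<gamma> c"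
  using prod_map_linear[OF mods(1,2) X_alg, of iB \<theta>] prod_map_linear[OF mods(1,2) X_alg, of iB \<gamma>]
  by (simp_all add: deform_def undeform_def)

lemmas deform_closed [simp] = k_linearD(1)[OF deform_linear] k_linearD(1)[OF undeform_linear]

lemmas lin_d = k_linear_comp[OF linear_theta] k_linear_comp[OF linear_gamma] k_linear_comp[OF linear_nu]
  k_linear_comp[OF deform_linear] k_linear_comp[OF undeform_linear] lin

lemma deform_iB:
  assumes [simp]: "t \<in> carrier AB" "b \<in> carrier B"
  shows "deform (iB b \<otimes>\<^bsub>X\<^esub> t) = iB b \<otimes>\<^bsub>X\<^esub> deform t" (is "?F t = ?G t")
    and "undeform (iB b \<otimes>\<^bsub>X\<^esub> t) = iB b \<otimes>\<^bsub>X\<^esub> undeform t" (is "?F' t = ?G' t")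
proof -
  show "?F t = ?G t"
  proof (rule tensor_ext_AB[OF assms(1)])
    show "k_linear k AB AB ?F" "k_linear k AB AB ?G"
      by (rule lin_d | simp)+
  qed (simp add: iB_mult_pure flip: mult_assoc)
  show "?F' t = ?G' t"
  proof (rule tensor_ext_AB[OF assms(1)])
    show "k_linear k AB AB ?F'" "k_linear k AB AB ?G'"
      by (rule lin_d | simp)+
  qed (simp add: iB_mult_pure flip: mult_assoc)
qed

lemma undeform_theta:
  assumes [simp]: "c \<in> carrier C"
  shows "undeform (\<theta> c) = \<one>\<^bsub>B\<^esub> \<oslash> c" and deform_gamma: "deform (\<gamma> c) = \<one>\<^bsub>B\<^esub> \<oslash> c"
proof -
  have inner: "sweedler AB s (\<lambda>x y. (b \<otimes>\<^bsub>B\<^esub> x) \<oslash> y) = iB b \<otimes>\<^bsub>X\<^esub> s"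
    if [simp]: "s \<in> carrier AB" "b \<in> carrier B" for s b
  proof (rule sweedler_eqI[OF mods(1-3) _ that(1)])
    show "k_linear k AB AB (\<lambda>s. iB b \<otimes>\<^bsub>X\<^esub> s)"
      by (rule lin | simp)+
  qed (simp add: iB_mult_pure)
  have "undeform (\<theta> c) = sweedler AB (\<theta> c) (\<lambda>c1 c0. sweedler AB (\<gamma> c0) (\<lambda>x y. (c1 \<otimes>\<^bsub>B\<^esub> x) \<oslash> y))"
    by (rule sweedler_eqI[symmetric, OF mods(1-3)]) (simp_all add: inner)
  then show "undeform (\<theta> c) = \<one>\<^bsub>B\<^esub> \<oslash> c"
    using theta_gamma by simp
  have "deform (\<gamma> c) = sweedler AB (\<gamma> c) (\<lambda>c1 c0. sweedler AB (\<theta> c0) (\<lambda>x y. (c1 \<otimes>\<^bsub>B\<^esub> x) \<oslash> y))"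
    by (rule sweedler_eqI[symmetric, OF mods(1-3)]) (simp_all add: inner)
  then show "deform (\<gamma> c) = \<one>\<^bsub>B\<^esub> \<oslash> c"
    using gamma_theta by simp
qed

lemma undeform_deform:
  assumes [simp]: "t \<in> carrier AB"
  shows "undeform (deform t) = t" (is "?F t = ?I t") and "deform (undeform t) = t" (is "?G t = _")
proof -
  show "?F t = ?I t"
  proof (rule tensor_ext_AB[OF assms(1)])
    show "k_linear k AB AB ?F" "k_linear k AB AB ?I"
      by (rule lin_d | simp)+
  qed (simp add: deform_iB undeform_theta incl_mult)
  show "?G t = ?I t"
  proof (rule tensor_ext_AB[OF assms(1)])
    show "k_linear k AB AB ?G" "k_linear k AB AB ?I"
      by (rule lin_d | simp)+
  qed (simp add: deform_iB deform_gamma incl_mult)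
qed

lemma star_bilinear: "k_bilinear k C C C (\<star>)"
proof -
  have *: "k_bilinear k B C C (\<lambda>c1 c0. \<nu> (c \<otimes>\<^bsub>[k|C,B]\<^esub> c1) \<otimes>\<^bsub>C\<^esub> c0)" if [simp]: "c \<in> carrier C" for c
    by (rule k_bilinearI) (rule lin_d | simp)+
  show ?thesis
  proof (rule k_bilinearI)
    show "k_linear k C C (\<lambda>c. c \<star> c')" if "c' \<in> carrier C" for c'
      unfolding right_star_def
    proof (rule sweedler_param_linear[where M = B and N = C])
      show "k_linear k C C (\<lambda>c. \<nu> (c \<otimes>\<^bsub>[k|C,B]\<^esub> c1) \<otimes>\<^bsub>C\<^esub> c0)" if [simp]: "c1 \<in> carrier B" "c0 \<in> carrier C" for c1 c0
        by (rule lin_d | simp)+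
    qed (simp_all add: * that)
    show "k_linear k C C ((\<star>) c)" if "c \<in> carrier C" for c
      unfolding right_star_def[abs_def]
      by (rule k_linear_comp[OF sweedler_linear[OF mods(1,2,2) *[OF that]] linear_theta])
  qed
qed

lemmas star_closed [simp] = k_bilinearD(3)[OF star_bilinear]

lemma theta_mult: "\<lbrakk>c \<in> carrier C; c' \<in> carrier C\<rbrakk> \<Longrightarrow> \<theta> (c \<star> c') = \<theta> c \<otimes>\<^bsub>X\<^esub> \<theta> c'"
  by (simp add: theta_star twisted_product_def)

text \<open>The axiom \<open>one_act\<close> recovers c from \<theta>(c), even where the map c -> 1
  \<otimes> c is not injective.\<close>

lemma theta_inj: "\<lbrakk>c \<in> carrier C; c' \<in> carrier C; \<theta> c = \<theta> c'\<rbrakk> \<Longrightarrow> c = c'"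
  by (metis one_act)

lemma dC_alg [simp]: "assoc_algebra k dC"
proof (rule assoc_algebraI)
  show "module k dC"
    using mods(2) module_cong[of dC C k] by simp
  show "k_bilinear k dC dC dC (mult dC)"
    using star_bilinear by (simp add: k_bilinear_def k_linear_def)
  show "x \<otimes>\<^bsub>dC\<^esub> y \<otimes>\<^bsub>dC\<^esub> z = x \<otimes>\<^bsub>dC\<^esub> (y \<otimes>\<^bsub>dC\<^esub> z)"
    if "x \<in> carrier dC" "y \<in> carrier dC" "z \<in> carrier dC" for x y z
    using that by (intro theta_inj) (simp_all add: theta_mult mult_assoc)
  show "\<one>\<^bsub>dC\<^esub> \<otimes>\<^bsub>dC\<^esub> x = x" "x \<otimes>\<^bsub>dC\<^esub> \<one>\<^bsub>dC\<^esub> = x" if "x \<in> carrier dC" for x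
    using that by (auto intro!: theta_inj simp: theta_mult theta_one mult_one)
qed simp

lemma theta_hom: "algebra_hom k dC X \<theta>"
  by (rule algebra_homI) (simp_all add: theta_mult theta_one)

abbreviation dR where "dR \<equiv> right_deformed_twist k B C R \<theta> \<gamma>"

text \<open>The defining sum is \<open>undeform\<close> of \<theta>(c) b: the exchange of
  \<open>c0\<close> and b accounts for \<open>R\<close>, and \<open>c1\<close> is taken out on the
  left by \<open>B\<close>-linearity.\<close>

lemma dR_eq:
  assumes t: "t \<in> carrier (C \<boxtimes>\<^bsub>k\<^esub> B)"
  shows "dR t = undeform (prod_map X \<theta> iB t)"
proof -
  note pm = prod_map_linear[OF mods(2,1) X_alg, of \<theta> iB, simplified]
  have 1: "sweedler AB s (\<lambda>x y. (c1 \<otimes>\<^bsub>B\<^esub> b \<otimes>\<^bsub>B\<^esub> x) \<oslash> y) = iB c1 \<otimes>\<^bsub>X\<^esub> (iB b \<otimes>\<^bsub>X\<^esub> s)"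
    if [simp]: "s \<in> carrier AB" "b \<in> carrier B" "c1 \<in> carrier B" for s b c1
  proof (rule sweedler_eqI[OF mods(1-3) _ that(1)])
    show "k_linear k AB AB (\<lambda>s. iB c1 \<otimes>\<^bsub>X\<^esub> (iB b \<otimes>\<^bsub>X\<^esub> s))"
      by (rule lin | simp)+
  qed (simp add: iB_mult_pure A.m_assoc)
  have 2: "sweedler AB s (\<lambda>x y. sweedler AB (\<gamma> y) (\<lambda>u v. (c1 \<otimes>\<^bsub>B\<^esub> x \<otimes>\<^bsub>B\<^esub> u) \<oslash> v)) = iB c1 \<otimes>\<^bsub>X\<^esub> undeform s"
    if [simp]: "s \<in> carrier AB" "c1 \<in> carrier B" for s c1
  proof (rule sweedler_eqI[OF mods(1-3) _ that(1)])
    show "k_linear k AB AB (\<lambda>s. iB c1 \<otimes>\<^bsub>X\<^esub> undeform s)"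
      by (rule lin_d | simp)+
  qed (simp add: 1)
  have 3: "sweedler AB s (\<lambda>c1 c0. sweedler AB (R (c0 \<otimes>\<^bsub>[k|C,B]\<^esub> b)) (\<lambda>x y.
      sweedler AB (\<gamma> y) (\<lambda>u v. (c1 \<otimes>\<^bsub>B\<^esub> x \<otimes>\<^bsub>B\<^esub> u) \<oslash> v))) = undeform (s \<otimes>\<^bsub>X\<^esub> iB b)"
    if [simp]: "s \<in> carrier AB" "b \<in> carrier B" for s b
  proof (rule sweedler_eqI[OF mods(1-3) _ that(1)])
    show "k_linear k AB AB (\<lambda>s. undeform (s \<otimes>\<^bsub>X\<^esub> iB b))"
      by (rule lin_d | simp)+
    fix x y assume [simp]: "x \<in> carrier B" "y \<in> carrier C"
    have "(x \<oslash> y) \<otimes>\<^bsub>X\<^esub> iB b = iB x \<otimes>\<^bsub>X\<^esub> (\<one>\<^bsub>B\<^esub> \<oslash> y) \<otimes>\<^bsub>X\<^esub> iB b"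
      by (simp add: incl_mult(1))
    also have "\<dots> = iB x \<otimes>\<^bsub>X\<^esub> ((\<one>\<^bsub>B\<^esub> \<oslash> y) \<otimes>\<^bsub>X\<^esub> iB b)"
      by (rule mult_assoc) simp_all
    also have "\<dots> = iB x \<otimes>\<^bsub>X\<^esub> R (y \<otimes>\<^bsub>[k|C,B]\<^esub> b)"
      by (simp add: incl_mult(2))
    finally have "(x \<oslash> y) \<otimes>\<^bsub>X\<^esub> iB b = iB x \<otimes>\<^bsub>X\<^esub> R (y \<otimes>\<^bsub>[k|C,B]\<^esub> b)" .
    then show "sweedler AB (R (y \<otimes>\<^bsub>[k|C,B]\<^esub> b)) (\<lambda>x' y'.
      sweedler AB (\<gamma> y') (\<lambda>u v. (x \<otimes>\<^bsub>B\<^esub> x' \<otimes>\<^bsub>B\<^esub> u) \<oslash> v)) = undeform ((x \<oslash> y) \<otimes>\<^bsub>X\<^esub> iB b)"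
      by (simp add: 2 deform_iB)
  qed
  show ?thesis
    unfolding right_deformed_twist_def
  proof (rule sweedler_eqI[OF mods(2,1,3) _ t])
    show "k_linear k (C \<boxtimes>\<^bsub>k\<^esub> B) AB (\<lambda>t. undeform (prod_map X \<theta> iB t))"
      by (rule k_linear_comp[OF undeform_linear pm(1)])
  qed (simp add: 3 pm(2))
qed

lemma dR_linear [simp]: "k_linear k (C \<boxtimes>\<^bsub>k\<^esub> B) AB dR"
proof -
  have "k_linear k (C \<boxtimes>\<^bsub>k\<^esub> B) AB (\<lambda>t. undeform (prod_map X \<theta> iB t))"
    using prod_map_linear(1)[OF mods(2,1) X_alg, of \<theta> iB] by (intro k_linear_comp[OF undeform_linear]) simp
  then show ?thesis
    using k_linear_cong[OF mods(4), of dR "\<lambda>t. undeform (prod_map X \<theta> iB t)" AB] dR_eq by simp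
qed

lemma deform_dR: "\<lbrakk>b \<in> carrier B; c \<in> carrier C\<rbrakk> \<Longrightarrow> deform (dR (c \<otimes>\<^bsub>[k|C,B]\<^esub> b)) = \<theta> c \<otimes>\<^bsub>X\<^esub> iB b"
  using prod_map_linear(2)[OF mods(2,1) X_alg, of \<theta> iB] by (simp add: dR_eq undeform_deform)

lemma linear_twist_dR: "linear_twist k B dC dR"
  by (simp add: linear_twist_def linear_twist_axioms_def)

lemma unital_twisting_map_dR: "unital_twisting_map k B dC dR"
proof -
  interpret d: linear_twist k B dC dR
    by (rule linear_twist_dR)
  show ?thesis
  proof (rule d.unital_twisting_map_factorization[OF X_alg incl_A_hom theta_hom])
    show "prod_map X iB \<theta> (dR (c \<otimes>\<^bsub>[k|dC,B]\<^esub> b)) = \<theta> c \<otimes>\<^bsub>X\<^esub> iB b" if "b \<in> carrier B" "c \<in> carrier dC" for b c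
      using that deform_dR by (simp add: deform_def)
    show "inj_on (prod_map X iB \<theta>) (carrier d.AB)"
      by (rule inj_on_inverseI[of _ undeform]) (simp add: undeform_deform flip: deform_def)
  qed
qed

end

section \<open>The deformed iterated product\<close>

text \<open>The assumption \<open>compat\<close> is the third compatibility condition, which becomes
  commutation of two images inside \<open>E\<close>.\<close>

locale deformed_twists = hexagon_twists k A B C R\<^sub>1 R\<^sub>2 +
  D1: left_deformation_datum k A B R\<^sub>1 \<mu> \<rho> \<Lambda> + D2: right_deformation_datum k B C R\<^sub>2 \<nu> \<theta> \<gamma>
  for k :: "'k ring" and A :: "('k, 'a) module" and B :: "('k, 'b) module" and C :: "('k, 'c) module"
    and R\<^sub>1 :: "('b, 'a) tensor \<Rightarrow> ('a, 'b) tensor" and R\<^sub>2 :: "('c, 'b) tensor \<Rightarrow> ('b, 'c) tensor"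
    and \<mu> :: "('b, 'a) tensor \<Rightarrow> 'a" and \<rho> \<Lambda> :: "'a \<Rightarrow> ('a, 'b) tensor"
    and \<nu> :: "('c, 'b) tensor \<Rightarrow> 'c" and \<theta> \<gamma> :: "'c \<Rightarrow> ('b, 'c) tensor" +
  assumes compat: "\<lbrakk>a \<in> carrier A; c \<in> carrier C\<rbrakk> \<Longrightarrow>
      sweedler A_BC (\<rho> a) (\<lambda>a0 a1. sweedler A_BC (\<theta> c) (\<lambda>c1 c0.
      sweedler A_BC (R\<^sub>1 (c1 \<otimes>\<^bsub>[k|B,A]\<^esub> a0)) (\<lambda>a0R c1R.
      sweedler A_BC (R\<^sub>2 (c0 \<otimes>\<^bsub>[k|C,B]\<^esub> a1)) (\<lambda>a1R c0R.
        a0R \<otimes>\<^bsub>[k|A,BC]\<^esub> ((c1R \<otimes>\<^bsub>B\<^esub> a1R) \<otimes>\<^bsub>[k|B,C]\<^esub> c0R))))) =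
      sweedler A_BC (\<rho> a) (\<lambda>a0 a1. sweedler A_BC (\<theta> c) (\<lambda>c1 c0.
        a0 \<otimes>\<^bsub>[k|A,BC]\<^esub> ((a1 \<otimes>\<^bsub>B\<^esub> c1) \<otimes>\<^bsub>[k|B,C]\<^esub> c0)))"
begin

abbreviation Ad where "Ad \<equiv> left_deformed_algebra k A B \<mu> \<rho>"
abbreviation dC where "dC \<equiv> right_deformed_algebra k B C \<nu> \<theta>"
abbreviation R1d where "R1d \<equiv> left_deformed_twist k A B R\<^sub>1 \<rho> \<Lambda>"
abbreviation dR2 where "dR2 \<equiv> right_deformed_twist k B C R\<^sub>2 \<theta> \<gamma>"
abbreviation fA where "fA \<equiv> (\<lambda>a. jAB (\<rho> a))"
abbreviation fB where "fB \<equiv> (\<lambda>b. jAB (\<one>\<^bsub>A\<^esub> \<otimes>\<^bsub>[k|A,B]\<^esub> b))"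
abbreviation fC where "fC \<equiv> (\<lambda>c. jBC (\<theta> c))"

lemma mult_linear_E:
  "\<lbrakk>k_linear k L ABC f; y \<in> carrier ABC\<rbrakk> \<Longrightarrow> k_linear k L ABC (\<lambda>x. f x \<otimes>\<^bsub>E\<^esub> y)"
  "\<lbrakk>k_linear k L ABC f; x \<in> carrier ABC\<rbrakk> \<Longrightarrow> k_linear k L ABC (\<lambda>y. x \<otimes>\<^bsub>E\<^esub> f y)"
  using k_linear_mult[OF E_alg] by simp_all

lemma jAB_linear: "k_linear k AB ABC jAB"
  using algebra_homD(1)[OF jAB_hom] by simp

lemma E_closed [simp]:
  "\<lbrakk>s \<in> carrier ABC; t \<in> carrier ABC\<rbrakk> \<Longrightarrow> s \<otimes>\<^bsub>E\<^esub> t \<in> carrier ABC"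
  using k_bilinearD(3)[OF assoc_algebra_bilinear[OF E_alg]] by simp

lemmas lin_E = mult_linear_E k_linear_comp[OF jAB_linear] k_linear_comp[OF jBC_linear]
  k_linear_comp[OF D1.deform_linear] k_linear_comp[OF D2.deform_linear]
  k_linear_comp[OF D1.undeform_linear] k_linear_comp[OF D2.undeform_linear] lin0

lemma jAB_mult: "\<lbrakk>r \<in> carrier AB; s \<in> carrier AB\<rbrakk> \<Longrightarrow> jAB (r \<otimes>\<^bsub>X1\<^esub> s) = jAB r \<otimes>\<^bsub>E\<^esub> jAB s"
  using algebra_homD(4)[OF jAB_hom] by simp

lemma jBC_mult: "\<lbrakk>r \<in> carrier BC; s \<in> carrier BC\<rbrakk> \<Longrightarrow> jBC (r \<otimes>\<^bsub>X2\<^esub> s) = jBC r \<otimes>\<^bsub>E\<^esub> jBC s"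
  using algebra_homD(4)[OF jBC_hom] by simp

text \<open>Both sides of \<open>compat\<close> are products in \<open>E\<close> expanded into
  components: the untwisted side is \<open>fA a\<close> times \<open>fC c\<close>, and by
  \<open>jBC_mult_jAB\<close> the twisted side is the product in the opposite order.\<close>

lemma fC_fA_commute:
  assumes [simp]: "a \<in> carrier A" "c \<in> carrier C"
  shows "fC c \<otimes>\<^bsub>E\<^esub> fA a = fA a \<otimes>\<^bsub>E\<^esub> fC c"
proof -
  have pure: "jAB (x \<otimes>\<^bsub>[k|A,B]\<^esub> y) \<otimes>\<^bsub>E\<^esub> jBC (u \<otimes>\<^bsub>[k|B,C]\<^esub> v) =
      (x \<otimes>\<^bsub>[k|A,B]\<^esub> (y \<otimes>\<^bsub>B\<^esub> u)) \<otimes>\<^bsub>[k|AB,C]\<^esub> v"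
    if [simp]: "x \<in> carrier A" "y \<in> carrier B" "u \<in> carrier B" "v \<in> carrier C" for x y u v
    by (simp add: jAB_mult_jBC D1.pure_mult_iB)
  have 1: "sweedler A_BC s (\<lambda>u v. x \<otimes>\<^bsub>[k|A,BC]\<^esub> ((y \<otimes>\<^bsub>B\<^esub> u) \<otimes>\<^bsub>[k|B,C]\<^esub> v)) =
      ar (jAB (x \<otimes>\<^bsub>[k|A,B]\<^esub> y) \<otimes>\<^bsub>E\<^esub> jBC s)"
    if [simp]: "s \<in> carrier BC" "x \<in> carrier A" "y \<in> carrier B" for s x y
  proof (rule sweedler_eqI[where k = k and M = B and N = C])
    show "k_linear k BC A_BC (\<lambda>s. ar (jAB (x \<otimes>\<^bsub>[k|A,B]\<^esub> y) \<otimes>\<^bsub>E\<^esub> jBC s))"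
      by (rule lin_E | simp)+
  qed (simp_all add: pure)
  have 2: "sweedler A_BC r (\<lambda>x y. sweedler A_BC s (\<lambda>u v. x \<otimes>\<^bsub>[k|A,BC]\<^esub> ((y \<otimes>\<^bsub>B\<^esub> u) \<otimes>\<^bsub>[k|B,C]\<^esub> v))) =
      ar (jAB r \<otimes>\<^bsub>E\<^esub> jBC s)"
    if [simp]: "r \<in> carrier AB" "s \<in> carrier BC" for r s
  proof (rule sweedler_eqI[where k = k and M = A and N = B])
    show "k_linear k AB A_BC (\<lambda>r. ar (jAB r \<otimes>\<^bsub>E\<^esub> jBC s))"
      by (rule lin_E | simp)+
  qed (simp_all add: 1)
  \<comment> \<open>For fixed components of \<rho>(a) the two sums over the twists are evaluated
    together by fact 2, and \<open>jBC_mult_jAB\<close> turns the result into a map linear in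
    s.\<close>
  have 3: "sweedler A_BC s (\<lambda>c1 c0.
      sweedler A_BC (R\<^sub>1 (c1 \<otimes>\<^bsub>[k|B,A]\<^esub> a0)) (\<lambda>x y. sweedler A_BC (R\<^sub>2 (c0 \<otimes>\<^bsub>[k|C,B]\<^esub> a1)) (\<lambda>u v.
        x \<otimes>\<^bsub>[k|A,BC]\<^esub> ((y \<otimes>\<^bsub>B\<^esub> u) \<otimes>\<^bsub>[k|B,C]\<^esub> v)))) =
      ar (jBC s \<otimes>\<^bsub>E\<^esub> jAB (a0 \<otimes>\<^bsub>[k|A,B]\<^esub> a1))"
    if [simp]: "s \<in> carrier BC" "a0 \<in> carrier A" "a1 \<in> carrier B" for s a0 a1
  proof (rule sweedler_eqI[where k = k and M = B and N = C])
    show "k_linear k BC A_BC (\<lambda>s. ar (jBC s \<otimes>\<^bsub>E\<^esub> jAB (a0 \<otimes>\<^bsub>[k|A,B]\<^esub> a1)))"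
      by (rule lin_E | simp)+
  qed (simp_all add: 2 jBC_mult_jAB)
  have 4: "sweedler A_BC r (\<lambda>a0 a1. sweedler A_BC s (\<lambda>c1 c0.
      sweedler A_BC (R\<^sub>1 (c1 \<otimes>\<^bsub>[k|B,A]\<^esub> a0)) (\<lambda>x y. sweedler A_BC (R\<^sub>2 (c0 \<otimes>\<^bsub>[k|C,B]\<^esub> a1)) (\<lambda>u v.
        x \<otimes>\<^bsub>[k|A,BC]\<^esub> ((y \<otimes>\<^bsub>B\<^esub> u) \<otimes>\<^bsub>[k|B,C]\<^esub> v))))) = ar (jBC s \<otimes>\<^bsub>E\<^esub> jAB r)"
    if [simp]: "r \<in> carrier AB" "s \<in> carrier BC" for r s
  proof (rule sweedler_eqI[where k = k and M = A and N = B])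
    show "k_linear k AB A_BC (\<lambda>r. ar (jBC s \<otimes>\<^bsub>E\<^esub> jAB r))"
      by (rule lin_E | simp)+
  qed (simp_all add: 3)
  have "ar (fC c \<otimes>\<^bsub>E\<^esub> fA a) = ar (fA a \<otimes>\<^bsub>E\<^esub> fC c)"
    using compat[of a c] by (simp add: 2 4)
  \<comment> \<open>The condition is stated in A \<otimes> (B \<otimes> C), while the products live
    in the other bracketing.\<close>
  then have "al (ar (fC c \<otimes>\<^bsub>E\<^esub> fA a)) = al (ar (fA a \<otimes>\<^bsub>E\<^esub> fC c))"
    by simp
  then show ?thesis
    by simp
qed

text \<open>Since \<open>jAB\<close> is multiplicative, it carries the factorization of
  \<open>X1\<close> into \<open>E\<close>; so the exchange relation \<open>deform_Rd\<close> becomes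
  one in \<open>E\<close>.\<close>

lemma fAB_eq:
  assumes "r \<in> carrier AB"
  shows "prod_map E fA fB r = jAB (D1.deform r)" (is "?F r = ?G r")
proof (rule R1.tensor_ext_AB[OF assms])
  have f: "k_linear k A E fA" "k_linear k B E fB"
    by (simp_all add: k_linear_comp[OF jAB_linear])
  show "k_linear k AB ABC ?F" "k_linear k AB ABC ?G"
    using prod_map_linear(1)[OF mods(1,2) E_alg f]
    by (simp_all add: k_linear_comp[OF jAB_linear])
  show "?F (a \<otimes>\<^bsub>[k|A,B]\<^esub> b) = ?G (a \<otimes>\<^bsub>[k|A,B]\<^esub> b)" if "a \<in> carrier A" "b \<in> carrier B" for a b
    using that prod_map_linear(2)[OF mods(1,2) E_alg f] by (simp add: jAB_mult)
qed

lemma fBC_eq: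
  assumes "s \<in> carrier BC"
  shows "prod_map E fB fC s = jBC (D2.deform s)" (is "?F s = ?G s")
proof (rule R2.tensor_ext_AB[OF assms])
  have f: "k_linear k B E fB" "k_linear k C E fC"
    by (simp_all add: k_linear_comp[OF jAB_linear] k_linear_comp[OF jBC_linear])
  show "k_linear k BC ABC ?F" "k_linear k BC ABC ?G"
    using prod_map_linear(1)[OF mods(2,3) E_alg f]
    by (simp_all add: k_linear_comp[OF jBC_linear])
  show "?F (b \<otimes>\<^bsub>[k|B,C]\<^esub> c) = ?G (b \<otimes>\<^bsub>[k|B,C]\<^esub> c)" if "b \<in> carrier B" "c \<in> carrier C" for b c
    using that prod_map_linear(2)[OF mods(2,3) E_alg f] by (simp add: jBC_mult jBC_one)
qed

lemma two_twists_homs_deformed: "two_twists_homs k Ad B dC R1d dR2 E fA fB fC"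
proof (intro two_twists_homs.intro two_twists.intro two_twists_homs_axioms.intro)
  show "algebra_hom k Ad E fA"
    by (rule algebra_hom_comp[OF jAB_hom D1.rho_hom])
  show "algebra_hom k B E fB"
    by (rule algebra_hom_comp[OF jAB_hom R1.incl_B_hom])
  show "algebra_hom k dC E fC"
    by (rule algebra_hom_comp[OF jBC_hom D2.theta_hom])
  show "prod_map E fA fB (R1d (b \<otimes>\<^bsub>[k|B,Ad]\<^esub> a)) = fB b \<otimes>\<^bsub>E\<^esub> fA a"
    if "a \<in> carrier Ad" "b \<in> carrier B" for a b
    using that k_linearD(1)[OF D1.Rd_linear] by (simp add: fAB_eq D1.deform_Rd jAB_mult)
  show "prod_map E fB fC (dR2 (c \<otimes>\<^bsub>[k|dC,B]\<^esub> b)) = fC c \<otimes>\<^bsub>E\<^esub> fB b"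
    if "b \<in> carrier B" "c \<in> carrier dC" for b c
    using that k_linearD(1)[OF D2.dR_linear] by (simp add: fBC_eq D2.deform_dR jBC_mult jBC_one)
  show "fC c \<otimes>\<^bsub>E\<^esub> fA a = fA a \<otimes>\<^bsub>E\<^esub> fC c" if "a \<in> carrier Ad" "c \<in> carrier dC" for a c
    using that fC_fA_commute by simp
qed (simp_all add: D1.linear_twist_Rd D2.linear_twist_dR D1.unital_twisting_map_Rd)

text \<open>The map \<open>fABC\<close> of \<open>two_twists_homs\<close> at the deformed data,
  given a name independent of that interpretation.\<close>

definition deformation_iso :: "(('a, 'b) tensor, 'c) tensor \<Rightarrow> (('a, 'b) tensor, 'c) tensor"
  where "deformation_iso = prod_map E (prod_map E fA fB) fC"

lemma deformation_iso:
  shows deformation_iso_linear: "k_linear k ABC ABC deformation_iso"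
    and deformation_iso_pure: "\<lbrakk>r \<in> carrier AB; c \<in> carrier C\<rbrakk> \<Longrightarrow>
      deformation_iso (r \<otimes>\<^bsub>[k|AB,C]\<^esub> c) = jAB (D1.deform r) \<otimes>\<^bsub>E\<^esub> jBC (\<theta> c)"
proof -
  interpret d: two_twists_homs k Ad B dC R1d dR2 E fA fB fC
    by (rule two_twists_homs_deformed)
  show "k_linear k ABC ABC deformation_iso"
    using d.fABC_linear by (simp add: deformation_iso_def)
  show "deformation_iso (r \<otimes>\<^bsub>[k|AB,C]\<^esub> c) = jAB (D1.deform r) \<otimes>\<^bsub>E\<^esub> jBC (\<theta> c)" if "r \<in> carrier AB" "c \<in> carrier C"
    using d.f_pure(3)[of r c] that by (simp add: deformation_iso_def fAB_eq)
qed

text \<open>The double sum is the expansion in components of \<open>\<rho> a\<close> b times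
  \<open>\<theta> c\<close> in \<open>E\<close>; it is evaluated from the inner sum
  outwards.\<close>

lemma deformation_iso_formula:
  assumes [simp]: "a \<in> carrier A" "b \<in> carrier B" "c \<in> carrier C"
  shows "deformation_iso ((a \<otimes>\<^bsub>[k|A,B]\<^esub> b) \<otimes>\<^bsub>[k|AB,C]\<^esub> c) =
    sweedler ABC (\<rho> a) (\<lambda>a0 a1. sweedler ABC (\<theta> c) (\<lambda>c1 c0.
      (a0 \<otimes>\<^bsub>[k|A,B]\<^esub> (a1 \<otimes>\<^bsub>B\<^esub> b \<otimes>\<^bsub>B\<^esub> c1)) \<otimes>\<^bsub>[k|AB,C]\<^esub> c0))"
proof -
  let ?b = "\<one>\<^bsub>A\<^esub> \<otimes>\<^bsub>[k|A,B]\<^esub> b"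
  have 1: "sweedler ABC s (\<lambda>c1 c0. (x \<otimes>\<^bsub>[k|A,B]\<^esub> (y \<otimes>\<^bsub>B\<^esub> b \<otimes>\<^bsub>B\<^esub> c1)) \<otimes>\<^bsub>[k|AB,C]\<^esub> c0) =
      jAB ((x \<otimes>\<^bsub>[k|A,B]\<^esub> y) \<otimes>\<^bsub>X1\<^esub> ?b) \<otimes>\<^bsub>E\<^esub> jBC s"
    if [simp]: "s \<in> carrier BC" "x \<in> carrier A" "y \<in> carrier B" for s x y
  proof (rule sweedler_eqI[where k = k and M = B and N = C])
    show "k_linear k BC ABC (\<lambda>s. jAB ((x \<otimes>\<^bsub>[k|A,B]\<^esub> y) \<otimes>\<^bsub>X1\<^esub> ?b) \<otimes>\<^bsub>E\<^esub> jBC s)"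
      by (rule lin_E | simp)+
  qed (simp_all add: D1.pure_mult_iB jAB_mult_jBC)
  have 2: "sweedler ABC r (\<lambda>x y. sweedler ABC s (\<lambda>c1 c0.
      (x \<otimes>\<^bsub>[k|A,B]\<^esub> (y \<otimes>\<^bsub>B\<^esub> b \<otimes>\<^bsub>B\<^esub> c1)) \<otimes>\<^bsub>[k|AB,C]\<^esub> c0)) = jAB (r \<otimes>\<^bsub>X1\<^esub> ?b) \<otimes>\<^bsub>E\<^esub> jBC s"
    if [simp]: "r \<in> carrier AB" "s \<in> carrier BC" for r s
  proof (rule sweedler_eqI[where k = k and M = A and N = B])
    show "k_linear k AB ABC (\<lambda>r. jAB (r \<otimes>\<^bsub>X1\<^esub> ?b) \<otimes>\<^bsub>E\<^esub> jBC s)"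
      by (rule lin_E | simp)+
  qed (simp_all add: 1)
  show ?thesis
    by (simp add: 2 deformation_iso_pure)
qed

text \<open>Up to rebracketing the map is the composite a \<otimes> b \<otimes> c -> a \<otimes> b
  \<theta>(c) -> \<open>a0 \<otimes> a1 b c1 \<otimes> c0\<close>, that is, A \<otimes>
  \<open>D2.deform\<close> followed by \<open>D1.deform\<close> \<otimes> C. Each of them is
  inverted by the corresponding \<open>undeform\<close>.\<close>

lemma deformation_iso_bij: "bij_betw deformation_iso (carrier ABC) (carrier ABC)"
proof -
  note [simp] = k_linear_id
  let ?a = "tensor_map k AB C D1.deform id" and ?a' = "tensor_map k AB C D1.undeform id"
  let ?b = "tensor_map k A BC id D2.deform" and ?b' = "tensor_map k A BC id D2.undeform"
  let ?inv = "\<lambda>t. al (?b' (ar (?a' t)))"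
  note tm = tensor_map_linear[OF R1.mods(3) mods(3) R1.mods(3) mods(3) D1.deform_linear k_linear_id(2)]
    tensor_map_linear[OF R1.mods(3) mods(3) R1.mods(3) mods(3) D1.undeform_linear k_linear_id(2)]
    tensor_map_linear[OF mods(1) R2.mods(3) mods(1) R2.mods(3) k_linear_id(2) D2.deform_linear]
    tensor_map_linear[OF mods(1) R2.mods(3) mods(1) R2.mods(3) k_linear_id(2) D2.undeform_linear]
  note tm_lin = tm(1,3,5,7) and tm_pure = tm(2,4,6,8)
  note [simp] = tm_lin[THEN k_linearD(1)]
  have aa: "?a' (?a t) = t" "?a (?a' t) = t" if "t \<in> carrier ABC" for t
    by (rule tensor_map_inverse; simp add: D1.undeform_deform that)+
  have bb: "?b' (?b t) = t" "?b (?b' t) = t" if "t \<in> carrier A_BC" for t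
    by (rule tensor_map_inverse; simp add: D2.undeform_deform that)+
  have deformation_iso_eq: "deformation_iso t = ?a (al (?b (ar t)))" (is "_ = ?H t") if t: "t \<in> carrier ABC" for t
  proof (rule tensor_ext3_left[where F = deformation_iso and G = ?H, OF t mods deformation_iso_linear])
    show "k_linear k ABC ABC ?H"
      by (rule k_linear_comp[OF tm_lin(1)] k_linear_comp[OF tm_lin(3)] lin0 | simp)+
    fix a b c assume [simp]: "a \<in> carrier A" "b \<in> carrier B" "c \<in> carrier C"
    let ?b0 = "b \<otimes>\<^bsub>[k|B,C]\<^esub> \<one>\<^bsub>C\<^esub>"
    \<comment> \<open>Replacing \<theta>(c) by an arbitrary s makes both sides linear in it, so they
      can be compared on pure s.\<close>
    have "?a (al (a \<otimes>\<^bsub>[k|A,BC]\<^esub> (?b0 \<otimes>\<^bsub>X2\<^esub> s))) = jAB (D1.deform (a \<otimes>\<^bsub>[k|A,B]\<^esub> b)) \<otimes>\<^bsub>E\<^esub> jBC s" (is "?F s = ?G s")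
      if s: "s \<in> carrier BC" for s
    proof (rule R2.tensor_ext_AB[where F = ?F and G = ?G, OF s])
      show "k_linear k BC ABC ?F" "k_linear k BC ABC ?G"
        by (rule k_linear_comp[OF tm_lin(1)] lin_E | simp)+
    qed (simp add: D2.iB_mult_pure tm_pure jAB_mult_jBC R1.mult_assoc D1.pure_mult_iB flip: id_def)
    then show "deformation_iso ((a \<otimes>\<^bsub>[k|A,B]\<^esub> b) \<otimes>\<^bsub>[k|AB,C]\<^esub> c) = ?H ((a \<otimes>\<^bsub>[k|A,B]\<^esub> b) \<otimes>\<^bsub>[k|AB,C]\<^esub> c)"
      by (simp add: deformation_iso_pure tm_pure flip: id_def)
  qed
  show ?thesis
    by (rule bij_betw_byWitness[where f' = ?inv]) (auto simp: deformation_iso_eq aa bb)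
qed

lemma deformed_iterated_product_iso:
  "unital_twisting_map k Ad B R1d \<and> unital_twisting_map k B dC dR2 \<and>
    hexagon k Ad B dC R1d dR2 (flip_map k dC Ad) \<and>
    algebra_iso k (iterated_product k Ad B dC R1d dR2 (flip_map k dC Ad))
      (iterated_product k A B C R\<^sub>1 R\<^sub>2 (flip_map k C A)) deformation_iso"
proof -
  interpret d: two_twists_homs k Ad B dC R1d dR2 E fA fB fC
    by (rule two_twists_homs_deformed)
  have bij: "bij_betw d.fABC (carrier d.ABC) (carrier E)"
    using deformation_iso_bij by (simp add: deformation_iso_def)
  show ?thesis
    using D1.unital_twisting_map_Rd D2.unital_twisting_map_dR
      d.hexagon_factorization[OF bij] d.algebra_iso_factorization[OF bij]
    by (simp add: deformation_iso_def iterated_product_def)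
qed

end

text \<open>The flip sees only the underlying modules, so the same \<open>R\<^sub>3\<close> serves
  before and after deformation.\<close>

lemma flip_map_deformed_algebra:
  "flip_map k (right_deformed_algebra k B C \<nu> \<theta>) (left_deformed_algebra k A B' \<mu> \<rho>) = flip_map k C A"
  by (simp add: flip_map_def fun_eq_iff)

theorem theorem4p10:
  fixes k :: "'k ring"
    and A :: "('k, 'a) module" and B :: "('k, 'b) module" and C :: "('k, 'c) module"
    and R\<^sub>1 :: "('b, 'a) tensor \<Rightarrow> ('a, 'b) tensor"
    and R\<^sub>2 :: "('c, 'b) tensor \<Rightarrow> ('b, 'c) tensor"
    and R\<^sub>3 :: "('c, 'a) tensor \<Rightarrow> ('a, 'c) tensor"
    and \<mu> :: "('b, 'a) tensor \<Rightarrow> 'a" and \<rho> \<Lambda> :: "'a \<Rightarrow> ('a, 'b) tensor"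
    and \<nu> :: "('c, 'b) tensor \<Rightarrow> 'c" and \<theta> \<gamma> :: "'c \<Rightarrow> ('b, 'c) tensor"
    and Ad :: "('k, 'a) module" and dC :: "('k, 'c) module"
    and R\<^sub>1d :: "('b, 'a) tensor \<Rightarrow> ('a, 'b) tensor"
    and dR\<^sub>2 :: "('c, 'b) tensor \<Rightarrow> ('b, 'c) tensor"
  assumes "assoc_algebra k A" and "assoc_algebra k B" and "assoc_algebra k C"
    and "unital_twisting_map k A B R\<^sub>1"
    and "unital_twisting_map k B C R\<^sub>2"
    and R\<^sub>3_def: "R\<^sub>3 = flip_map k C A"
    and "hexagon k A B C R\<^sub>1 R\<^sub>2 R\<^sub>3"
    and "left_deformation_datum k A B R\<^sub>1 \<mu> \<rho> \<Lambda>"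
    and Ad_def: "Ad = left_deformed_algebra k A B \<mu> \<rho>"
    and R\<^sub>1d_def: "R\<^sub>1d = left_deformed_twist k A B R\<^sub>1 \<rho> \<Lambda>"
    and "right_deformation_datum k B C R\<^sub>2 \<nu> \<theta> \<gamma>"
    and dC_def: "dC = right_deformed_algebra k B C \<nu> \<theta>"
    and dR\<^sub>2_def: "dR\<^sub>2 = right_deformed_twist k B C R\<^sub>2 \<theta> \<gamma>"
    and compat1: "\<And>a c. \<lbrakk>a \<in> carrier A; c \<in> carrier C\<rbrakk> \<Longrightarrow>
      sweedler (A \<boxtimes>\<^bsub>k\<^esub> (B \<boxtimes>\<^bsub>k\<^esub> C)) (\<rho> a) (\<lambda>a0 a1.
      sweedler (A \<boxtimes>\<^bsub>k\<^esub> (B \<boxtimes>\<^bsub>k\<^esub> C)) (R\<^sub>2 (c \<otimes>\<^bsub>[k|C,B]\<^esub> a1)) (\<lambda>a1R cR.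
      sweedler (A \<boxtimes>\<^bsub>k\<^esub> (B \<boxtimes>\<^bsub>k\<^esub> C)) (\<gamma> cR) (\<lambda>x y.
        a0 \<otimes>\<^bsub>[k|A,B \<boxtimes>\<^bsub>k\<^esub> C]\<^esub> ((a1R \<otimes>\<^bsub>B\<^esub> x) \<otimes>\<^bsub>[k|B,C]\<^esub> y)))) =
      sweedler (A \<boxtimes>\<^bsub>k\<^esub> (B \<boxtimes>\<^bsub>k\<^esub> C)) (\<rho> a) (\<lambda>a0 a1.
      sweedler (A \<boxtimes>\<^bsub>k\<^esub> (B \<boxtimes>\<^bsub>k\<^esub> C)) (\<gamma> c) (\<lambda>c1 c0.
      sweedler (A \<boxtimes>\<^bsub>k\<^esub> (B \<boxtimes>\<^bsub>k\<^esub> C)) (R\<^sub>1 (c1 \<otimes>\<^bsub>[k|B,A]\<^esub> a0)) (\<lambda>a0R c1R.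
        a0R \<otimes>\<^bsub>[k|A,B \<boxtimes>\<^bsub>k\<^esub> C]\<^esub> ((c1R \<otimes>\<^bsub>B\<^esub> a1) \<otimes>\<^bsub>[k|B,C]\<^esub> c0))))"
    and compat2: "\<And>a c. \<lbrakk>a \<in> carrier A; c \<in> carrier C\<rbrakk> \<Longrightarrow>
      sweedler (A \<boxtimes>\<^bsub>k\<^esub> (B \<boxtimes>\<^bsub>k\<^esub> C)) (\<Lambda> a) (\<lambda>a0 a1.
      sweedler (A \<boxtimes>\<^bsub>k\<^esub> (B \<boxtimes>\<^bsub>k\<^esub> C)) (\<theta> c) (\<lambda>c1 c0.
      sweedler (A \<boxtimes>\<^bsub>k\<^esub> (B \<boxtimes>\<^bsub>k\<^esub> C)) (R\<^sub>2 (c0 \<otimes>\<^bsub>[k|C,B]\<^esub> a1)) (\<lambda>a1R c0R.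
        a0 \<otimes>\<^bsub>[k|A,B \<boxtimes>\<^bsub>k\<^esub> C]\<^esub> ((c1 \<otimes>\<^bsub>B\<^esub> a1R) \<otimes>\<^bsub>[k|B,C]\<^esub> c0R)))) =
      sweedler (A \<boxtimes>\<^bsub>k\<^esub> (B \<boxtimes>\<^bsub>k\<^esub> C)) (\<theta> c) (\<lambda>c1 c0.
      sweedler (A \<boxtimes>\<^bsub>k\<^esub> (B \<boxtimes>\<^bsub>k\<^esub> C)) (R\<^sub>1 (c1 \<otimes>\<^bsub>[k|B,A]\<^esub> a)) (\<lambda>aR c1R.
      sweedler (A \<boxtimes>\<^bsub>k\<^esub> (B \<boxtimes>\<^bsub>k\<^esub> C)) (\<Lambda> aR) (\<lambda>x y.
        x \<otimes>\<^bsub>[k|A,B \<boxtimes>\<^bsub>k\<^esub> C]\<^esub> ((y \<otimes>\<^bsub>B\<^esub> c1R) \<otimes>\<^bsub>[k|B,C]\<^esub> c0))))"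
    and compat3: "\<And>a c. \<lbrakk>a \<in> carrier A; c \<in> carrier C\<rbrakk> \<Longrightarrow>
      sweedler (A \<boxtimes>\<^bsub>k\<^esub> (B \<boxtimes>\<^bsub>k\<^esub> C)) (\<rho> a) (\<lambda>a0 a1.
      sweedler (A \<boxtimes>\<^bsub>k\<^esub> (B \<boxtimes>\<^bsub>k\<^esub> C)) (\<theta> c) (\<lambda>c1 c0.
      sweedler (A \<boxtimes>\<^bsub>k\<^esub> (B \<boxtimes>\<^bsub>k\<^esub> C)) (R\<^sub>1 (c1 \<otimes>\<^bsub>[k|B,A]\<^esub> a0)) (\<lambda>a0R c1R.
      sweedler (A \<boxtimes>\<^bsub>k\<^esub> (B \<boxtimes>\<^bsub>k\<^esub> C)) (R\<^sub>2 (c0 \<otimes>\<^bsub>[k|C,B]\<^esub> a1)) (\<lambda>a1R c0R.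
        a0R \<otimes>\<^bsub>[k|A,B \<boxtimes>\<^bsub>k\<^esub> C]\<^esub> ((c1R \<otimes>\<^bsub>B\<^esub> a1R) \<otimes>\<^bsub>[k|B,C]\<^esub> c0R))))) =
      sweedler (A \<boxtimes>\<^bsub>k\<^esub> (B \<boxtimes>\<^bsub>k\<^esub> C)) (\<rho> a) (\<lambda>a0 a1.
      sweedler (A \<boxtimes>\<^bsub>k\<^esub> (B \<boxtimes>\<^bsub>k\<^esub> C)) (\<theta> c) (\<lambda>c1 c0.
        a0 \<otimes>\<^bsub>[k|A,B \<boxtimes>\<^bsub>k\<^esub> C]\<^esub> ((a1 \<otimes>\<^bsub>B\<^esub> c1) \<otimes>\<^bsub>[k|B,C]\<^esub> c0)))"
  shows "unital_twisting_map k Ad B R\<^sub>1d \<and>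
         unital_twisting_map k B dC dR\<^sub>2 \<and>
         unital_twisting_map k Ad dC R\<^sub>3 \<and>
         hexagon k Ad B dC R\<^sub>1d dR\<^sub>2 R\<^sub>3 \<and>
         (\<exists>\<phi>. algebra_iso k (iterated_product k Ad B dC R\<^sub>1d dR\<^sub>2 R\<^sub>3)
                (iterated_product k A B C R\<^sub>1 R\<^sub>2 R\<^sub>3) \<phi> \<and>
          (\<forall>a\<in>carrier A. \<forall>b\<in>carrier B. \<forall>c\<in>carrier C.
             \<phi> ((a \<otimes>\<^bsub>[k|Ad,B]\<^esub> b) \<otimes>\<^bsub>[k|Ad \<boxtimes>\<^bsub>k\<^esub> B,dC]\<^esub> c) =
             sweedler ((A \<boxtimes>\<^bsub>k\<^esub> B) \<boxtimes>\<^bsub>k\<^esub> C) (\<rho> a) (\<lambda>a0 a1.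
             sweedler ((A \<boxtimes>\<^bsub>k\<^esub> B) \<boxtimes>\<^bsub>k\<^esub> C) (\<theta> c) (\<lambda>c1 c0.
               (a0 \<otimes>\<^bsub>[k|A,B]\<^esub> (a1 \<otimes>\<^bsub>B\<^esub> b \<otimes>\<^bsub>B\<^esub> c1))
                 \<otimes>\<^bsub>[k|A \<boxtimes>\<^bsub>k\<^esub> B,C]\<^esub> c0))))"
proof -
  interpret deformed_twists k A B C R\<^sub>1 R\<^sub>2 \<mu> \<rho> \<Lambda> \<nu> \<theta> \<gamma>
  proof (intro deformed_twists.intro hexagon_twists.intro two_twists.intro hexagon_twists_axioms.intro
      deformed_twists_axioms.intro)
    show "linear_twist k A B R\<^sub>1" "linear_twist k B C R\<^sub>2"
      using assms(4,5) by (simp_all add: linear_twist_def linear_twist_axioms_def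
          unital_twisting_map_def twisting_map_def twisting_map_axioms_def)
    show "hexagon k A B C R\<^sub>1 R\<^sub>2 (flip_map k C A)"
      using assms(7) R\<^sub>3_def by simp
  qed (fact assms compat3)+
  have "unital_twisting_map k Ad B R\<^sub>1d \<and> unital_twisting_map k B dC dR\<^sub>2 \<and>
      hexagon k Ad B dC R\<^sub>1d dR\<^sub>2 R\<^sub>3 \<and>
      algebra_iso k (iterated_product k Ad B dC R\<^sub>1d dR\<^sub>2 R\<^sub>3) (iterated_product k A B C R\<^sub>1 R\<^sub>2 R\<^sub>3) deformation_iso"
    using deformed_iterated_product_iso by (simp only: flip_map_deformed_algebra R\<^sub>3_def Ad_def dC_def R\<^sub>1d_def dR\<^sub>2_def)
  moreover have "unital_twisting_map k Ad dC R\<^sub>3"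
    using unital_twisting_map_flip[OF D1.Ad_alg D2.dC_alg]
    by (simp only: flip_map_deformed_algebra R\<^sub>3_def Ad_def dC_def)
  \<comment> \<open>Tensor products over the deformed algebras are those over \<open>A\<close> and
    \<open>C\<close>, so the formula for the undeformed notation applies.\<close>
  moreover have "\<forall>a\<in>carrier A. \<forall>b\<in>carrier B. \<forall>c\<in>carrier C.
      deformation_iso ((a \<otimes>\<^bsub>[k|Ad,B]\<^esub> b) \<otimes>\<^bsub>[k|Ad \<boxtimes>\<^bsub>k\<^esub> B,dC]\<^esub> c) =
      sweedler ((A \<boxtimes>\<^bsub>k\<^esub> B) \<boxtimes>\<^bsub>k\<^esub> C) (\<rho> a) (\<lambda>a0 a1. sweedler ((A \<boxtimes>\<^bsub>k\<^esub> B) \<boxtimes>\<^bsub>k\<^esub> C) (\<theta> c) (\<lambda>c1 c0.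
        (a0 \<otimes>\<^bsub>[k|A,B]\<^esub> (a1 \<otimes>\<^bsub>B\<^esub> b \<otimes>\<^bsub>B\<^esub> c1)) \<otimes>\<^bsub>[k|A \<boxtimes>\<^bsub>k\<^esub> B,C]\<^esub> c0))"
    by (simp add: Ad_def dC_def deformation_iso_formula)
  ultimately show ?thesis
    by blast
qed

end
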